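(* Assume that the meshes and spaces satisfy the assumptions stated in the context, that accepted states satisfy $0<\rho_*\le\rho(\phi_h^\ell)\le\rho^*$ and $0<\eta_*\le\eta(\phi_h^\ell)\le\eta^*$, and that $q^{n+1}>0$. Then the pressure-correction scheme of the context satisfies, for $k=1,2$, $$E_{h,k}^{n+1,\rm pc}-E_{h,k}^{n,\rm pc}+N_{h,k}^{n+1}+N_{p,h,k}^{n+1}+\frac{2\tau}{Re}\|(\eta_h^{n+1})^{1/2}D(\boldsymbol u_{*,h}^{n+1})\|_{n+1}^2+\frac{\tau q^{n+1}}{Pe\,We\,Cn}\langle m_E^{n+1}\nabla\mu_h^{n+1},\nabla\mu_h^{n+1}\rangle_\times=\tau(\boldsymbol f^{n+1},\boldsymbol u_{*,h}^{n+1})_{n+1},$$ where $$E_{h,k}^{\ell,\rm pc}=E_{h,k}^\ell+\frac{\tau^2}{2\gamma_k}\|(\rho_h^\ell)^{1/2}\nabla_{\rho,h}^\ell\pi_h^\ell\|_\ell^2,$$ $$N_{p,h,k}^{n+1}=\frac{\tau^2}{2\gamma_k}\|(\rho_h^{n+1})^{1/2}\nabla_{\rho,h}^{n+1}\delta\pi_h^{n+1}\|_{n+1}^2+\frac{\tau^2}{2\gamma_k}\|\boldsymbol\xi_{p,h}^{n+1}-(\rho_h^{n+1})^{1/2}\nabla_{\rho,h}^{n+1}\pi_{\rm tr,h}^{n+1}\|^2,$$ $$E_{h,1}^\ell=\tfrac12\|\boldsymbol g_{0,h}^\ell\|_\ell^2+q^\ell E_{\phi,r,1}^\ell+\tfrac1{2\alpha_q}(q^\ell)^2,$$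 $$E_{h,2}^\ell=\tfrac14\bigl[\|\boldsymbol g_{0,h}^\ell\|_\ell^2+\|\boldsymbol g_{1,h}^\ell\|_\ell^2\bigr]+q^\ell E_{\phi,r,2}^\ell+\tfrac1{4\alpha_q}\bigl[(q^\ell)^2+(2q^\ell-q^{\ell-1})^2\bigr],$$ $$N_{h,1}^\ell=\tfrac12\|\boldsymbol\zeta_h^\ell-\boldsymbol g_{0,H}^\ell\|_\ell^2+q^\ell\Bigl[\tfrac1{2We\,Cn}\|\phi_h^\ell-\phi_h^{\ell-1}\|_{Cn,s}^2+\tfrac1{We\,Cn}(r^\ell-r^{\ell-1})^2\Bigr]+\tfrac1{2\alpha_q}(q^\ell-q^{\ell-1})^2,$$ $$N_{h,2}^\ell=\tfrac14\|\boldsymbol\zeta_h^\ell-\boldsymbol g_{1,H}^\ell\|_\ell^2+q^\ell\Bigl[\tfrac1{4We\,Cn}\|\phi_h^\ell-2\phi_h^{\ell-1}+\phi_h^{\ell-2}\|_{Cn,s}^2+\tfrac1{2We\,Cn}(r^\ell-2r^{\ell-1}+r^{\ell-2})^2\Bigr]+\tfrac1{4\alpha_q}(q^\ell-2q^{\ell-1}+q^{\ell-2})^2.$$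
   Context: Domain and spaces. $\Omega\subset\mathbb R^d$ ($d=2,3$) is a fixed bounded polygonal or polyhedral domain, $\partial\Omega=\overline{\Gamma_D}\cup\overline{\Gamma_S}$ with disjoint relative interiors. For each accepted time level $\ell$, $\mathcal T_h^\ell$ is a conforming shape-regular triangulation of $\Omega$ preserving the boundary partition, with finite element spaces $S_h^\ell\subset H^1(\Omega)$, $V_h^\ell\subset\{\boldsymbol v\in[H^1(\Omega)]^d:\boldsymbol v=0\text{ on }\Gamma_D,\ \boldsymbol v\cdot\boldsymbol n=0\text{ on }\Gamma_S\}$, $P_h^\ell\subset L^2(\Omega)$ (finite-dimensional, with functions regular enough, as standard piecewise polynomials are, for all integrals below to be finite), $1\in S_h^\ell\cap P_h^\ell$, and zero-mean subspaces $S_{h,0}^\ell$, $P_{h,0}^\ell$; the velocity--pressure pairs satisfy a uniform discrete inf--sup condition. $(\cdot,\cdot)_\ell$, $\|\cdot\|_\ell$, $\|\cdot\|$ and the cross-mesh pairing $\langle\cdot,\cdot\rangle_\times$ all denote the $L^2(\Omega)$ inner product/norm (Frobenius product for tensors); the notation only records on which mesh(es) the arguments live. $D(\boldsymbol v)=\frac12(\nabla\boldsymbol v+\nabla\boldsymbol v^T)$. Each update $n\to n+1$ is either a fixed-topology (ALE) update or a topology-changing (remeshing) update. For fixed-topology updates there are maps $\boldsymbol X_h^\ell:\widehat\Omega\to\Omega$ from a common reference triangulation onto $\mathcal T_h^\ell$, with uniformly admissible inverses, $\boldsymbol F_h^\ell=\widehat\nabla\boldsymbol X_h^\ell$, $J_h^\ell=\det\boldsymbol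 F_h^\ell>0$ (a function on $\widehat\Omega$), and a reference scalar space $\widehat S_h$ containing $\chi_h\circ\boldsymbol X_h^\ell$ for $\chi_h\in S_h^\ell$, with zero-mean subspace $\widehat S_{h,0}$. Data. $Cn,Pe,Re,We,\alpha_q>0$, $C_A>0$, time step $\tau>0$; $\rho(\phi)=\rho_0+\rho_\phi\phi$, $\eta(\phi)=\eta_0+\eta_\phi\phi$; mobility $m\ge0$; $F(\phi)=\frac s2\phi^2+G(\phi)$, $s>0$; $C_G>0$; $\boldsymbol f^{n+1}$ a given force. $k\in\{1,2\}$ ($n\ge1$ if $k=2$; the first step uses $k=1$), $\gamma_1=1$, $\gamma_2=3/2$. For any history $z$: $z_H^{n+1}=z^n$, $z_E^{n+1}=z^n$ if $k=1$; $z_H^{n+1}=(4z^n-z^{n-1})/3$, $z_E^{n+1}=2z^n-z^{n-1}$ if $k=2$; $D_\tau^{(k)}z^{n+1}=\frac{\gamma_k}\tau(z^{n+1}-z_H^{n+1})$. $\|v\|_{Cn,s}^2=Cn^2\|\nabla v\|^2+s\|v\|^2$. All previous accepted states are given; initially $r^0=((G(\phi_h^0),1)_0+C_G)^{1/2}$, $q^0=1$. Step 1 (histories). $m_E^{n+1}=m(\phi_E^{n+1})$, and $\phi_{H,h}^{n+1}\in S_h^{n+1}$ solves $Cn^2(\nabla\phi_{H,h}^{n+1},\nabla\chi_h)_{n+1}+s(\phi_{H,h}^{n+1},\chi_h)_{n+1}=Cn^2\langle\nabla\phi_H^{n+1},\nabla\chi_h\rangle_\times+s\langle\phi_H^{n+1},\chi_h\rangle_\times$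 for all $\chi_h\in S_h^{n+1}$. With $\boldsymbol\zeta_h^\ell=(\rho_h^\ell)^{1/2}\boldsymbol u_h^\ell$, the kinetic histories $\boldsymbol g_{j,h}^n$ ($j=0$, and $j=1$ if $k=2$) are transferred by $\boldsymbol g_{j,H}^{n+1}=[(J_h^{n+1})^{-1/2}(J_h^n)^{1/2}(\boldsymbol g_{j,h}^n\circ\boldsymbol X_h^n)]\circ(\boldsymbol X_h^{n+1})^{-1}$ (fixed topology), or by $\boldsymbol g_{j,H}^{n+1}=\frac{\|\boldsymbol g_{j,h}^n\|_n}{\|\mathcal P\boldsymbol g_{j,h}^n\|_{n+1}}\mathcal P\boldsymbol g_{j,h}^n$ (topology change; $=0$ if $\boldsymbol g_{j,h}^n=0$), where $\mathcal P$ is the $L^2$-orthogonal projection onto a chosen piecewise-polynomial history space on $\mathcal T_h^{n+1}$ and it is assumed that $\mathcal P\boldsymbol g_{j,h}^n\ne0$ whenever $\boldsymbol g_{j,h}^n\ne0$. Then $\boldsymbol\zeta_{H,h}^{n+1}=\boldsymbol g_{0,H}^{n+1}$ ($k=1$), $\boldsymbol\zeta_{H,h}^{n+1}=\frac13(2\boldsymbol g_{0,H}^{n+1}+\boldsymbol g_{1,H}^{n+1})$ ($k=2$). After the step one sets $\boldsymbol g_{0,h}^{n+1}=\boldsymbol\zeta_h^{n+1}$ and (at each BDF2 level, and at level $1$ after the BE start-up) $\boldsymbol g_{1,h}^{n+1}=2\boldsymbol\zeta_h^{n+1}-\boldsymbol g_{0,H}^{n+1}$. Step 2 (carrier). Topology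 change: with $\boldsymbol u_{E,h}^{n+1}$ the extrapolation of the accepted velocities, find $\lambda_h^{n+1}\in S_{h,0}^{n+1}$ with $(\nabla\lambda_h^{n+1},\nabla\chi_h)_{n+1}=\langle\boldsymbol u_{E,h}^{n+1},\nabla\chi_h\rangle_\times$ for all $\chi_h\in S_{h,0}^{n+1}$ and set $\boldsymbol u_{c,h}^{n+1}=\boldsymbol u_{E,h}^{n+1}-\nabla\lambda_h^{n+1}$. Fixed topology: with $\widehat{\boldsymbol u}_h^m=J_h^m(\boldsymbol F_h^m)^{-1}(\boldsymbol u_h^m\circ\boldsymbol X_h^m)$ and $\widehat{\boldsymbol u}_E^{n+1}$ their extrapolation, find $\widehat\lambda_h^{n+1}\in\widehat S_{h,0}$ with $(\widehat\nabla\widehat\lambda_h^{n+1},\widehat\nabla\widehat\chi_h)_{\widehat\Omega}=(\widehat{\boldsymbol u}_E^{n+1},\widehat\nabla\widehat\chi_h)_{\widehat\Omega}$ for all $\widehat\chi_h\in\widehat S_{h,0}$ and set $\boldsymbol u_{c,h}^{n+1}\circ\boldsymbol X_h^{n+1}=\frac1{J_h^{n+1}}\boldsymbol F_h^{n+1}(\widehat{\boldsymbol u}_E^{n+1}-\widehat\nabla\widehat\lambda_h^{n+1})$. In either case $\langle\boldsymbol u_{c,h}^{n+1},\nabla\chi_h\rangle_\times=0$ for all $\chi_h\in S_h^{n+1}$. Step 3 (phase--SAV). With $U_E^{n+1}=(\langle G(\phi_E^{n+1}),1\rangle_\times+C_G)^{1/2}>0$, find $(\phi_h^{n+1},\mu_h^{n+1},r^{n+1})\in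 S_h^{n+1}\times S_h^{n+1}\times\mathbb R$ such that for all $\omega_h,\chi_h\in S_h^{n+1}$ $$\bigl(\tfrac{\gamma_k}\tau(\phi_h^{n+1}-\phi_{H,h}^{n+1}),\omega_h\bigr)_{n+1}-\langle\phi_E^{n+1}\boldsymbol u_{c,h}^{n+1},\nabla\omega_h\rangle_\times+\tfrac1{Pe}\langle m_E^{n+1}\nabla\mu_h^{n+1},\nabla\omega_h\rangle_\times=0,$$ $$(\mu_h^{n+1},\chi_h)_{n+1}=Cn^2(\nabla\phi_h^{n+1},\nabla\chi_h)_{n+1}+s(\phi_h^{n+1},\chi_h)_{n+1}+\tfrac{r^{n+1}}{U_E^{n+1}}\langle G'(\phi_E^{n+1}),\chi_h\rangle_\times,$$ $$D_\tau^{(k)}r^{n+1}=\tfrac1{2U_E^{n+1}}\bigl\langle G'(\phi_E^{n+1}),\tfrac{\gamma_k}\tau(\phi_h^{n+1}-\phi_{H,h}^{n+1})\bigr\rangle_\times.$$ Set $\rho_h^{n+1}=\rho(\phi_h^{n+1})$, $\eta_h^{n+1}=\eta(\phi_h^{n+1})$, $\rho_E^{n+1}=\rho(\phi_E^{n+1})$, $\boldsymbol J_{\rho,h}^{n+1}=\rho_E^{n+1}\boldsymbol u_{c,h}^{n+1}-\frac{\rho_\phi}{Pe}m_E^{n+1}\nabla\mu_h^{n+1}$; let $\boldsymbol w_h^{n+1,(k)}=[D_\tau^{(k)}\boldsymbol X_h^{n+1}]\circ(\boldsymbol X_h^{n+1})^{-1}$ for a fixed-topology update and $0$ for a topology-changing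 step; and $$C_{\rho,h}^{n+1}(\boldsymbol v,\boldsymbol z)=\tfrac12\bigl[\langle(\boldsymbol J_{\rho,h}^{n+1}-\rho_h^{n+1}\boldsymbol w_h^{n+1,(k)})\cdot\nabla\boldsymbol v,\boldsymbol z\rangle_\times-\langle(\boldsymbol J_{\rho,h}^{n+1}-\rho_h^{n+1}\boldsymbol w_h^{n+1,(k)})\cdot\nabla\boldsymbol z,\boldsymbol v\rangle_\times\bigr].$$ Also $E_{\phi,r,1}^\ell=\frac1{2We\,Cn}\|\phi_h^\ell\|_{Cn,s}^2+\frac1{We\,Cn}(r^\ell)^2+C_A$ and $E_{\phi,r,2}^\ell=\frac1{4We\,Cn}[\|\phi_h^\ell\|_{Cn,s}^2+\|2\phi_h^\ell-\phi_h^{\ell-1}\|_{Cn,s}^2]+\frac1{2We\,Cn}[(r^\ell)^2+(2r^\ell-r^{\ell-1})^2]+C_A$. Pressure-correction scheme (after Steps 1--3). $\pi_h^0\in P_{h,0}^0$ is prescribed. $\nabla_{\rho,h}^\ell:P_{h,0}^\ell\to V_h^\ell$ is the discrete gradient $(\rho_h^\ell\nabla_{\rho,h}^\ell\pi_h,\boldsymbol v_h)_\ell=-(\pi_h,\nabla\cdot\boldsymbol v_h)_\ell$ for all $\boldsymbol v_h\in V_h^\ell$. Set $\boldsymbol\xi_{p,h}^{n+1}=[(J_h^{n+1})^{-1/2}(J_h^n)^{1/2}((\rho_h^n)^{1/2}\nabla_{\rho,h}^n\pi_h^n)\circ\boldsymbol X_h^n]\circ(\boldsymbol X_h^{n+1})^{-1}$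 (fixed topology) or $\boldsymbol\xi_{p,h}^{n+1}=(\rho_h^n)^{1/2}\nabla_{\rho,h}^n\pi_h^n$ (topology change). Find $\pi_{\rm tr,h}^{n+1},\bar\pi_h^{n+1}\in P_{h,0}^{n+1}$ such that for all $\alpha_h\in P_{h,0}^{n+1}$ $$(\rho_h^{n+1}\nabla_{\rho,h}^{n+1}\pi_{\rm tr,h}^{n+1},\nabla_{\rho,h}^{n+1}\alpha_h)_{n+1}=\langle\boldsymbol\xi_{p,h}^{n+1},(\rho_h^{n+1})^{1/2}\nabla_{\rho,h}^{n+1}\alpha_h\rangle_\times,$$ $$(\rho_h^{n+1}\nabla_{\rho,h}^{n+1}\bar\pi_h^{n+1},\nabla_{\rho,h}^{n+1}\alpha_h)_{n+1}=\langle\boldsymbol\xi_{p,h}^{n+1}+\tfrac{\gamma_k}\tau\boldsymbol\zeta_{H,h}^{n+1},(\rho_h^{n+1})^{1/2}\nabla_{\rho,h}^{n+1}\alpha_h\rangle_\times.$$ Find $\boldsymbol u_{*,h}^{n+1}(q)\in V_h^{n+1}$ and $q^{n+1}>0$ with, for all $\boldsymbol v_h\in V_h^{n+1}$, $$\tfrac{\gamma_k}\tau((\rho_h^{n+1})^{1/2}\boldsymbol u_{*,h}^{n+1}(q)-\boldsymbol\zeta_{H,h}^{n+1},(\rho_h^{n+1})^{1/2}\boldsymbol v_h)_{n+1}+C_{\rho,h}^{n+1}(\boldsymbol u_{*,h}^{n+1}(q),\boldsymbol v_h)+\tfrac2{Re}(\eta_h^{n+1}D(\boldsymbol u_{*,h}^{n+1}(q)),D(\boldsymbol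 v_h))_{n+1}$$ $$=(\bar\pi_h^{n+1},\nabla\cdot\boldsymbol v_h)_{n+1}+(\boldsymbol f^{n+1},\boldsymbol v_h)_{n+1}-\tfrac q{We\,Cn}(\phi_h^{n+1}\nabla\mu_h^{n+1},\boldsymbol v_h)_{n+1},$$ $$\tfrac{\gamma_kq^{n+1}}{\alpha_q\tau}(q^{n+1}-q_H^{n+1})+\tfrac{q^{n+1}-q^n}\tau E_{\phi,r,k}^n+\tfrac{q^{n+1}}{We\,Cn}\langle\phi_E^{n+1}\boldsymbol u_{c,h}^{n+1},\nabla\mu_h^{n+1}\rangle_\times-\tfrac{q^{n+1}}{We\,Cn}(\phi_h^{n+1}\nabla\mu_h^{n+1},\boldsymbol u_{*,h}^{n+1}(q^{n+1}))_{n+1}=0,$$ and set $\boldsymbol u_{*,h}^{n+1}=\boldsymbol u_{*,h}^{n+1}(q^{n+1})$. Finally find $\delta\pi_h^{n+1}\in P_{h,0}^{n+1}$ with $(\rho_h^{n+1}\nabla_{\rho,h}^{n+1}\delta\pi_h^{n+1},\nabla_{\rho,h}^{n+1}\alpha_h)_{n+1}=-\frac{\gamma_k}\tau(\nabla\cdot\boldsymbol u_{*,h}^{n+1},\alpha_h)_{n+1}$ for all $\alpha_h\in P_{h,0}^{n+1}$, and set $\boldsymbol u_h^{n+1}=\boldsymbol u_{*,h}^{n+1}-\frac\tau{\gamma_k}\nabla_{\rho,h}^{n+1}\delta\pi_h^{n+1}$, $\pi_h^{n+1}=\pi_{\rm tr,h}^{n+1}+\delta\pi_h^{n+1}$. 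*)

theory Defs
  imports "HOL-Analysis.Analysis"
begin

section \<open>Square-integrable functions and weak gradients\<close>

text \<open>Functions on a domain are represented by total functions on the ambient space; only their
  values almost everywhere on the domain matter.\<close>

definition L2 :: "(real^'d) set \<Rightarrow> (real^'d \<Rightarrow> 'b::euclidean_space) set" where
  "L2 \<Omega> = {f \<in> borel_measurable (lebesgue_on \<Omega>).
            integrable (lebesgue_on \<Omega>) (\<lambda>x. (norm (f x))\<^sup>2)}"

text \<open>On matrix-valued functions the library inner product is the Frobenius product.\<close>

definition ip :: "(real^'d) set \<Rightarrow> (real^'d \<Rightarrow> 'b::euclidean_space) \<Rightarrow> (real^'d \<Rightarrow> 'b) \<Rightarrow> real" where
  "ip \<Omega> f g = (LINT x|lebesgue_on \<Omega>. f x \<bullet> g x)"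

definition nrm :: "(real^'d) set \<Rightarrow> (real^'d \<Rightarrow> 'b::euclidean_space) \<Rightarrow> real" where
  "nrm \<Omega> f = sqrt (ip \<Omega> f f)"

definition aeq :: "(real^'d) set \<Rightarrow> (real^'d \<Rightarrow> 'b) \<Rightarrow> (real^'d \<Rightarrow> 'b) \<Rightarrow> bool" where
  "aeq \<Omega> f g \<longleftrightarrow> (AE x in lebesgue_on \<Omega>. f x = g x)"

text \<open>Test functions are continuously differentiable with compact support in \<open>\<Omega>\<close>; \<open>\<psi>'\<close> is the
  gradient of \<open>\<psi>\<close>.\<close>

definition test_function ::
  "(real^'d) set \<Rightarrow> (real^'d \<Rightarrow> real) \<Rightarrow> (real^'d \<Rightarrow> real^'d) \<Rightarrow> bool" where
  "test_function \<Omega> \<psi> \<psi>' \<longleftrightarrow>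
     (\<forall>x. GDERIV \<psi> x :> \<psi>' x) \<and> continuous_on UNIV \<psi>' \<and>
     compact (closure {x. \<psi> x \<noteq> 0}) \<and> closure {x. \<psi> x \<noteq> 0} \<subseteq> \<Omega>"

definition weak_grad ::
  "(real^'d) set \<Rightarrow> (real^'d \<Rightarrow> real) \<Rightarrow> (real^'d \<Rightarrow> real^'d) \<Rightarrow> bool" where
  "weak_grad \<Omega> u g \<longleftrightarrow>
     (\<forall>\<psi> \<psi>'. test_function \<Omega> \<psi> \<psi>' \<longrightarrow>
        (LINT x|lebesgue_on \<Omega>. u x *\<^sub>R \<psi>' x) = - (LINT x|lebesgue_on \<Omega>. \<psi> x *\<^sub>R g x))"

definition H1 :: "(real^'d) set \<Rightarrow> (real^'d \<Rightarrow> real) set" where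
  "H1 \<Omega> = {u \<in> L2 \<Omega>. \<exists>g \<in> L2 \<Omega>. weak_grad \<Omega> u g}"

text \<open>Unique up to null sets for \<open>u \<in> H1 \<Omega>\<close>.\<close>

definition grad :: "(real^'d) set \<Rightarrow> (real^'d \<Rightarrow> real) \<Rightarrow> real^'d \<Rightarrow> real^'d" where
  "grad \<Omega> u = (SOME g. g \<in> L2 \<Omega> \<and> weak_grad \<Omega> u g)"

definition H1v :: "(real^'d) set \<Rightarrow> (real^'d \<Rightarrow> real^'d) set" where
  "H1v \<Omega> = {v. \<forall>i. (\<lambda>x. v x $ i) \<in> H1 \<Omega>}"

text \<open>Row \<open>i\<close> of \<open>jac \<Omega> v\<close> is the gradient of the component \<open>v $ i\<close>, so that the directional
  derivative of \<open>v\<close> along \<open>a\<close>, written \<open>a \<cdot> \<nabla>v\<close> in fluid mechanics, is \<open>jac \<Omega> v x *v a\<close>.\<close>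

definition jac :: "(real^'d) set \<Rightarrow> (real^'d \<Rightarrow> real^'d) \<Rightarrow> real^'d \<Rightarrow> real^'d^'d" where
  "jac \<Omega> v x = (\<chi> i. grad \<Omega> (\<lambda>y. v y $ i) x)"

definition divg :: "(real^'d) set \<Rightarrow> (real^'d \<Rightarrow> real^'d) \<Rightarrow> real^'d \<Rightarrow> real" where
  "divg \<Omega> v x = trace (jac \<Omega> v x)"

definition symgrad :: "(real^'d) set \<Rightarrow> (real^'d \<Rightarrow> real^'d) \<Rightarrow> real^'d \<Rightarrow> real^'d^'d" where
  "symgrad \<Omega> v x = (1/2) *\<^sub>R (jac \<Omega> v x + transpose (jac \<Omega> v x))"

definition h1norm :: "(real^'d) set \<Rightarrow> (real^'d \<Rightarrow> real^'d) \<Rightarrow> real" where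
  "h1norm \<Omega> v = sqrt ((nrm \<Omega> v)\<^sup>2 + (nrm \<Omega> (jac \<Omega> v))\<^sup>2)"

definition zero_mean :: "(real^'d) set \<Rightarrow> (real^'d \<Rightarrow> real) set \<Rightarrow> (real^'d \<Rightarrow> real) set" where
  "zero_mean \<Omega> S = {f \<in> S. (LINT x|lebesgue_on \<Omega>. f x) = 0}"

section \<open>Boundary traces\<close>

definition hausdorff_outer :: "real \<Rightarrow> 'a::metric_space set \<Rightarrow> ennreal" where
  "hausdorff_outer s A =
     (SUP \<delta>\<in>{0<..}. INF U\<in>{U :: nat \<Rightarrow> 'a set. A \<subseteq> (\<Union>i. U i) \<and> (\<forall>i. bounded (U i) \<and> diameter (U i) \<le> \<delta>)}.
        (\<Sum>i. ennreal (unit_ball_vol s * (diameter (U i) / 2) powr s)))"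

text \<open>The surface measure: \<open>(d-1)\<close>-dimensional Hausdorff measure on Borel sets.\<close>

definition surface_measure :: "(real^'d) measure" where
  "surface_measure = measure_of UNIV (sets borel) (hausdorff_outer (real CARD('d) - 1))"

text \<open>The trace is the \<open>L2\<close>-limit on the boundary of the boundary values of \<open>C1\<close> fields that
  converge in \<open>H1\<close>.\<close>

definition has_trace ::
  "(real^'d) set \<Rightarrow> (real^'d \<Rightarrow> real^'d) \<Rightarrow> (real^'d \<Rightarrow> real^'d) \<Rightarrow> bool" where
  "has_trace \<Omega> v t \<longleftrightarrow>
     t \<in> borel_measurable borel \<and>
     (\<exists>\<Phi> :: nat \<Rightarrow> real^'d \<Rightarrow> real^'d.
        (\<forall>k x. \<Phi> k differentiable (at x)) \<and>
        (\<forall>k. continuous_on UNIV (\<lambda>x. jacobian (\<Phi> k) (at x))) \<and>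
        (\<lambda>k. h1norm \<Omega> (\<lambda>x. \<Phi> k x - v x)) \<longlonglongrightarrow> 0 \<and>
        (\<lambda>k. \<integral>\<^sup>+x. ennreal ((norm (\<Phi> k x - t x))\<^sup>2) * indicator (frontier \<Omega>) x \<partial>surface_measure)
          \<longlonglongrightarrow> 0)"

definition outward_normal :: "(real^'d) set \<Rightarrow> real^'d \<Rightarrow> real^'d \<Rightarrow> bool" where
  "outward_normal \<Omega> x \<nu> \<longleftrightarrow>
     norm \<nu> = 1 \<and> (\<exists>\<epsilon>>0. \<Omega> \<inter> ball x \<epsilon> = {y \<in> ball x \<epsilon>. (y - x) \<bullet> \<nu> < 0})"

text \<open>No condition is imposed at boundary points without outward normal (vertices and edges),
  which form a null set.\<close>

definition velocity_bc ::
  "(real^'d) set \<Rightarrow> (real^'d) set \<Rightarrow> (real^'d) set \<Rightarrow> (real^'d \<Rightarrow> real^'d) \<Rightarrow> bool" where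
  "velocity_bc \<Omega> \<Gamma>D \<Gamma>S v \<longleftrightarrow>
     (\<exists>t. has_trace \<Omega> v t \<and>
        (AE x in surface_measure. x \<in> \<Gamma>D \<longrightarrow> t x = 0) \<and>
        (AE x in surface_measure. x \<in> \<Gamma>S \<longrightarrow> (\<forall>\<nu>. outward_normal \<Omega> x \<nu> \<longrightarrow> t x \<bullet> \<nu> = 0)))"

section \<open>Domains, triangulations and finite element spaces\<close>

text \<open>A bounded polygonal (polyhedral) domain lying on one side of its boundary.\<close>

definition polyhedral_domain :: "(real^'d) set \<Rightarrow> bool" where
  "polyhedral_domain \<Omega> \<longleftrightarrow>
     open \<Omega> \<and> connected \<Omega> \<and> bounded \<Omega> \<and> \<Omega> \<noteq> {} \<and> interior (closure \<Omega>) = \<Omega> \<and>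
     (\<exists>\<F>. finite \<F> \<and> (\<forall>f\<in>\<F>. polytope f \<and> aff_dim f = int CARD('d) - 1) \<and> frontier \<Omega> = \<Union>\<F>)"

definition boundary_partition :: "(real^'d) set \<Rightarrow> (real^'d) set \<Rightarrow> (real^'d) set \<Rightarrow> bool" where
  "boundary_partition \<Omega> \<Gamma>D \<Gamma>S \<longleftrightarrow>
     frontier \<Omega> = closure \<Gamma>D \<union> closure \<Gamma>S \<and>
     (top_of_set (frontier \<Omega>) interior_of \<Gamma>D) \<inter> (top_of_set (frontier \<Omega>) interior_of \<Gamma>S) = {}"

text \<open>The library predicate \<open>triangulation\<close> contains conformity: two simplices meet in a common
  face.\<close>

definition triangulates :: "(real^'d) set set \<Rightarrow> (real^'d) set \<Rightarrow> bool" where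
  "triangulates \<T> \<Omega> \<longleftrightarrow>
     triangulation \<T> \<and> (\<forall>K\<in>\<T>. int CARD('d) simplex K) \<and> \<Union>\<T> = closure \<Omega>"

definition shape_regular :: "real \<Rightarrow> (real^'d) set set \<Rightarrow> bool" where
  "shape_regular \<kappa> \<T> \<longleftrightarrow>
     (\<forall>K\<in>\<T>. \<exists>c r. 0 < r \<and> cball c r \<subseteq> K \<and> diameter K \<le> \<kappa> * r)"

definition preserves_partition ::
  "(real^'d) set \<Rightarrow> (real^'d) set \<Rightarrow> (real^'d) set \<Rightarrow> (real^'d) set set \<Rightarrow> bool" where
  "preserves_partition \<Omega> \<Gamma>D \<Gamma>S \<T> \<longleftrightarrow>
     (\<forall>K\<in>\<T>. \<forall>f. f facet_of K \<and> f \<subseteq> frontier \<Omega> \<longrightarrow> f \<subseteq> closure \<Gamma>D \<or> f \<subseteq> closure \<Gamma>S)"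

definition finite_dim_space :: "(real^'d \<Rightarrow> 'b::real_vector) set \<Rightarrow> bool" where
  "finite_dim_space S \<longleftrightarrow> (\<exists>B. finite B \<and> S = {(\<lambda>x. \<Sum>b\<in>B. c b *\<^sub>R b x) | c. True})"

definition contains_one :: "(real^'d) set \<Rightarrow> (real^'d \<Rightarrow> real) set \<Rightarrow> bool" where
  "contains_one \<Omega> S \<longleftrightarrow> (\<exists>e\<in>S. aeq \<Omega> e (\<lambda>x. 1))"

text \<open>The quotient is \<open>0\<close> for \<open>v = 0\<close>, which does not affect the supremum.\<close>

definition inf_sup ::
  "real \<Rightarrow> (real^'d) set \<Rightarrow> (real^'d \<Rightarrow> real^'d) set \<Rightarrow> (real^'d \<Rightarrow> real) set \<Rightarrow> bool" where
  "inf_sup \<beta> \<Omega> V P0 \<longleftrightarrow>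
     (\<forall>p\<in>P0. \<beta> * nrm \<Omega> p \<le> (SUP v\<in>V. ip \<Omega> p (divg \<Omega> v) / h1norm \<Omega> v))"

definition piecewise_polynomial ::
  "(real^'d) set set \<Rightarrow> (real^'d \<Rightarrow> real^'d) \<Rightarrow> bool" where
  "piecewise_polynomial \<T> h \<longleftrightarrow>
     (\<forall>K\<in>\<T>. \<exists>p. polynomial_function p \<and> (\<forall>x\<in>interior K. h x = p x))"

definition L2_projection ::
  "(real^'d) set \<Rightarrow> (real^'d \<Rightarrow> real^'d) set \<Rightarrow> ((real^'d \<Rightarrow> real^'d) \<Rightarrow> real^'d \<Rightarrow> real^'d) \<Rightarrow> bool" where
  "L2_projection \<Omega> H pr \<longleftrightarrow>
     (\<forall>g\<in>L2 \<Omega>. pr g \<in> H \<and> (\<forall>h\<in>H. ip \<Omega> (\<lambda>x. pr g x - g x) h = 0))"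

text \<open>Functions of the time level \<open>l\<close>. The update from \<open>n\<close> to \<open>n+1\<close> has fixed topology (ALE) if
  \<open>fixed_topo n\<close> holds and changes the topology otherwise. The reference data of level \<open>l\<close> are
  relevant only if the level takes part in a fixed-topology update.\<close>

record ('d::finite) fe_setting =
  region :: "(real^'d) set"
  gammaD :: "(real^'d) set"
  gammaS :: "(real^'d) set"
  mesh :: "nat \<Rightarrow> (real^'d) set set"
  Ssp :: "nat \<Rightarrow> (real^'d \<Rightarrow> real) set"
  Vsp :: "nat \<Rightarrow> (real^'d \<Rightarrow> real^'d) set"
  Psp :: "nat \<Rightarrow> (real^'d \<Rightarrow> real) set"
  Hsp :: "nat \<Rightarrow> (real^'d \<Rightarrow> real^'d) set"  \<comment> \<open>history space\<close>
  Hproj :: "nat \<Rightarrow> (real^'d \<Rightarrow> real^'d) \<Rightarrow> real^'d \<Rightarrow> real^'d"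
  fixed_topo :: "nat \<Rightarrow> bool"
  refdom :: "nat \<Rightarrow> (real^'d) set"
  refmesh :: "nat \<Rightarrow> (real^'d) set set"
  refS :: "nat \<Rightarrow> (real^'d \<Rightarrow> real) set"
  Xmap :: "nat \<Rightarrow> real^'d \<Rightarrow> real^'d"

abbreviation Ssp0 :: "('d::finite) fe_setting \<Rightarrow> nat \<Rightarrow> (real^'d \<Rightarrow> real) set" where
  "Ssp0 D l \<equiv> zero_mean (region D) (Ssp D l)"

abbreviation Psp0 :: "('d::finite) fe_setting \<Rightarrow> nat \<Rightarrow> (real^'d \<Rightarrow> real) set" where
  "Psp0 D l \<equiv> zero_mean (region D) (Psp D l)"

abbreviation refS0 :: "('d::finite) fe_setting \<Rightarrow> nat \<Rightarrow> (real^'d \<Rightarrow> real) set" where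
  "refS0 D l \<equiv> zero_mean (refdom D l) (refS D l)"

definition Fmat :: "('d::finite) fe_setting \<Rightarrow> nat \<Rightarrow> real^'d \<Rightarrow> real^'d^'d" where
  "Fmat D l x = jacobian (Xmap D l) (at x)"

definition Jdet :: "('d::finite) fe_setting \<Rightarrow> nat \<Rightarrow> real^'d \<Rightarrow> real" where
  "Jdet D l x = det (Fmat D l x)"

definition Xinv :: "('d::finite) fe_setting \<Rightarrow> nat \<Rightarrow> real^'d \<Rightarrow> real^'d" where
  "Xinv D l = inv_into (closure (refdom D l)) (Xmap D l)"

definition valid_domain :: "('d::finite) fe_setting \<Rightarrow> bool" where
  "valid_domain D \<longleftrightarrow>
     polyhedral_domain (region D) \<and> boundary_partition (region D) (gammaD D) (gammaS D)"

definition valid_level :: "('d::finite) fe_setting \<Rightarrow> real \<Rightarrow> real \<Rightarrow> nat \<Rightarrow> bool" where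
  "valid_level D \<kappa> \<beta> l \<longleftrightarrow>
     triangulates (mesh D l) (region D) \<and> shape_regular \<kappa> (mesh D l) \<and>
     preserves_partition (region D) (gammaD D) (gammaS D) (mesh D l) \<and>
     finite_dim_space (Ssp D l) \<and> Ssp D l \<subseteq> H1 (region D) \<and> contains_one (region D) (Ssp D l) \<and>
     finite_dim_space (Psp D l) \<and> Psp D l \<subseteq> L2 (region D) \<and> contains_one (region D) (Psp D l) \<and>
     finite_dim_space (Vsp D l) \<and> Vsp D l \<subseteq> H1v (region D) \<and>
     (\<forall>v\<in>Vsp D l. velocity_bc (region D) (gammaD D) (gammaS D) v) \<and>
     inf_sup \<beta> (region D) (Vsp D l) (Psp0 D l) \<and>
     finite_dim_space (Hsp D l) \<and> Hsp D l \<subseteq> L2 (region D) \<and>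
     (\<forall>h\<in>Hsp D l. piecewise_polynomial (mesh D l) h) \<and>
     L2_projection (region D) (Hsp D l) (Hproj D l)"

text \<open>The map is bi-Lipschitz (with level-independent constant), carries reference elements onto
  elements, and is \<open>C1\<close> inside each of them; its Jacobian matrix is thus the elementwise one.\<close>

definition valid_ref_map :: "('d::finite) fe_setting \<Rightarrow> real \<Rightarrow> nat \<Rightarrow> bool" where
  "valid_ref_map D \<Lambda> l \<longleftrightarrow>
     polyhedral_domain (refdom D l) \<and> triangulates (refmesh D l) (refdom D l) \<and>
     bij_betw (Xmap D l) (closure (refdom D l)) (closure (region D)) \<and>
     Xmap D l ` refdom D l = region D \<and>
     (\<lambda>K. Xmap D l ` K) ` refmesh D l = mesh D l \<and>
     \<Lambda>-lipschitz_on (closure (refdom D l)) (Xmap D l) \<and>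
     \<Lambda>-lipschitz_on (closure (region D)) (Xinv D l) \<and>
     (\<forall>K\<in>refmesh D l.
        (\<forall>x\<in>interior K. Xmap D l differentiable (at x) \<and> Jdet D l x > 0) \<and>
        continuous_on (interior K) (Fmat D l)) \<and>
     finite_dim_space (refS D l) \<and> refS D l \<subseteq> H1 (refdom D l) \<and>
     (\<forall>\<theta>\<in>Ssp D l. \<exists>\<theta>'\<in>refS D l. aeq (refdom D l) \<theta>' (\<lambda>x. \<theta> (Xmap D l x)))"

text \<open>A fixed-topology update of order \<open>k\<close> involves the levels \<open>n+1\<close>, \<open>n\<close> and, for \<open>k = 2\<close>,
  \<open>n-1\<close>; these share one reference configuration.\<close>

definition valid_update :: "('d::finite) fe_setting \<Rightarrow> real \<Rightarrow> nat \<Rightarrow> nat \<Rightarrow> bool" where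
  "valid_update D \<Lambda> k n \<longleftrightarrow>
     (fixed_topo D n \<longrightarrow>
       (\<forall>l\<in>{Suc n, n} \<union> (if k = 2 then {n - 1} else {}).
          valid_ref_map D \<Lambda> l \<and> refdom D l = refdom D (Suc n) \<and>
          refmesh D l = refmesh D (Suc n) \<and> refS D l = refS D (Suc n)))"

section \<open>Data and unknowns\<close>

record ('d::finite) model =
  Cn :: real
  Pe :: real
  Rey :: real
  We :: real
  alphaq :: real
  CA :: real
  tau :: real
  rho0 :: real
  rhophi :: real
  eta0 :: real
  etaphi :: real
  mob :: "real \<Rightarrow> real"
  Fpot :: "real \<Rightarrow> real"
  Gpot :: "real \<Rightarrow> real"
  stab :: real
  CG :: real
  force :: "nat \<Rightarrow> real^'d \<Rightarrow> real^'d"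

definition rho :: "('d::finite) model \<Rightarrow> real \<Rightarrow> real" where
  "rho M c = rho0 M + rhophi M * c"

definition eta :: "('d::finite) model \<Rightarrow> real \<Rightarrow> real" where
  "eta M c = eta0 M + etaphi M * c"

definition valid_model :: "('d::finite) model \<Rightarrow> (real^'d) set \<Rightarrow> bool" where
  "valid_model M \<Omega> \<longleftrightarrow>
     Cn M > 0 \<and> Pe M > 0 \<and> Rey M > 0 \<and> We M > 0 \<and> alphaq M > 0 \<and> CA M > 0 \<and> tau M > 0 \<and>
     (\<forall>c. mob M c \<ge> 0) \<and> stab M > 0 \<and> CG M > 0 \<and>
     (\<forall>c. Fpot M c = stab M / 2 * c\<^sup>2 + Gpot M c) \<and> (\<forall>c. Gpot M differentiable (at c)) \<and>
     (\<forall>l. force M l \<in> L2 \<Omega>)"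

text \<open>\<open>ustarq l q\<close> is the velocity \<open>u\<^sub>*(q)\<close> depending on the scalar argument; \<open>prtr\<close>, \<open>prbar\<close>,
  \<open>dpr\<close> are the transported pressure, the pressure in the momentum equation and the increment.
  \<open>phiH\<close> is the discrete projection of the phase history.\<close>

record ('d::finite) state =
  phi :: "nat \<Rightarrow> real^'d \<Rightarrow> real"
  mu :: "nat \<Rightarrow> real^'d \<Rightarrow> real"
  rsav :: "nat \<Rightarrow> real"
  qsav :: "nat \<Rightarrow> real"
  vel :: "nat \<Rightarrow> real^'d \<Rightarrow> real^'d"
  pr :: "nat \<Rightarrow> real^'d \<Rightarrow> real"
  phiH :: "nat \<Rightarrow> real^'d \<Rightarrow> real"
  uc :: "nat \<Rightarrow> real^'d \<Rightarrow> real^'d"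
  prtr :: "nat \<Rightarrow> real^'d \<Rightarrow> real"
  prbar :: "nat \<Rightarrow> real^'d \<Rightarrow> real"
  dpr :: "nat \<Rightarrow> real^'d \<Rightarrow> real"
  ustarq :: "nat \<Rightarrow> real \<Rightarrow> real^'d \<Rightarrow> real^'d"
  dgrad :: "nat \<Rightarrow> (real^'d \<Rightarrow> real) \<Rightarrow> real^'d \<Rightarrow> real^'d"

section \<open>Time differences\<close>

text \<open>Quantities of the update \<open>n\<close> to \<open>n+1\<close> are indexed by \<open>n\<close>: \<open>histH k z n\<close> is
  \<open>z\<^sub>H\<close> at level \<open>n+1\<close>, and so on. A scheme of order \<open>K\<close> starts with one first-order step.\<close>

definition step_order :: "nat \<Rightarrow> nat \<Rightarrow> nat" where
  "step_order K n = (if n = 0 then 1 else K)"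

definition gam :: "nat \<Rightarrow> real" where
  "gam k = (if k = 1 then 1 else 3/2)"

definition histH :: "nat \<Rightarrow> (nat \<Rightarrow> 'a::real_vector) \<Rightarrow> nat \<Rightarrow> 'a" where
  "histH k z n = (if k = 1 then z n else (1/3) *\<^sub>R (4 *\<^sub>R z n - z (n - 1)))"

definition histE :: "nat \<Rightarrow> (nat \<Rightarrow> 'a::real_vector) \<Rightarrow> nat \<Rightarrow> 'a" where
  "histE k z n = (if k = 1 then z n else 2 *\<^sub>R z n - z (n - 1))"

definition Dtau :: "real \<Rightarrow> nat \<Rightarrow> (nat \<Rightarrow> 'a::real_vector) \<Rightarrow> nat \<Rightarrow> 'a" where
  "Dtau \<tau> k z n = (gam k / \<tau>) *\<^sub>R (z (Suc n) - histH k z n)"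

definition phiE :: "nat \<Rightarrow> ('d::finite) state \<Rightarrow> nat \<Rightarrow> real^'d \<Rightarrow> real" where
  "phiE k Z n x = histE k (\<lambda>l. phi Z l x) n"

definition mE :: "nat \<Rightarrow> ('d::finite) model \<Rightarrow> 'd state \<Rightarrow> nat \<Rightarrow> real^'d \<Rightarrow> real" where
  "mE k M Z n x = mob M (phiE k Z n x)"

definition velE :: "nat \<Rightarrow> ('d::finite) state \<Rightarrow> nat \<Rightarrow> real^'d \<Rightarrow> real^'d" where
  "velE k Z n x = histE k (\<lambda>l. vel Z l x) n"

definition rhoh :: "('d::finite) model \<Rightarrow> 'd state \<Rightarrow> nat \<Rightarrow> real^'d \<Rightarrow> real" where
  "rhoh M Z l x = rho M (phi Z l x)"

definition etah :: "('d::finite) model \<Rightarrow> 'd state \<Rightarrow> nat \<Rightarrow> real^'d \<Rightarrow> real" where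
  "etah M Z l x = eta M (phi Z l x)"

definition zeta :: "('d::finite) model \<Rightarrow> 'd state \<Rightarrow> nat \<Rightarrow> real^'d \<Rightarrow> real^'d" where
  "zeta M Z l x = sqrt (rhoh M Z l x) *\<^sub>R vel Z l x"

definition ustar :: "('d::finite) state \<Rightarrow> nat \<Rightarrow> real^'d \<Rightarrow> real^'d" where
  "ustar Z l = ustarq Z l (qsav Z l)"

section \<open>History transfer\<close>

definition ale_transfer ::
  "('d::finite) fe_setting \<Rightarrow> nat \<Rightarrow> (real^'d \<Rightarrow> real^'d) \<Rightarrow> real^'d \<Rightarrow> real^'d" where
  "ale_transfer D n g y =
     (let x = Xinv D (Suc n) y
      in (1 / sqrt (Jdet D (Suc n) x) * sqrt (Jdet D n x)) *\<^sub>R g (Xmap D n x))"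

definition remesh_transfer ::
  "('d::finite) fe_setting \<Rightarrow> nat \<Rightarrow> (real^'d \<Rightarrow> real^'d) \<Rightarrow> real^'d \<Rightarrow> real^'d" where
  "remesh_transfer D n g y =
     (if nrm (region D) g = 0 then 0
      else (nrm (region D) g / nrm (region D) (Hproj D (Suc n) g)) *\<^sub>R Hproj D (Suc n) g y)"

definition kin_transfer ::
  "('d::finite) fe_setting \<Rightarrow> nat \<Rightarrow> (real^'d \<Rightarrow> real^'d) \<Rightarrow> real^'d \<Rightarrow> real^'d" where
  "kin_transfer D n g = (if fixed_topo D n then ale_transfer D n g else remesh_transfer D n g)"

text \<open>The kinetic histories. \<open>kin 1 l\<close> is meaningful for \<open>l \<ge> 1\<close> only; it is used only at BDF2
  updates.\<close>

definition kin ::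
  "('d::finite) fe_setting \<Rightarrow> 'd model \<Rightarrow> 'd state \<Rightarrow> nat \<Rightarrow> nat \<Rightarrow> real^'d \<Rightarrow> real^'d" where
  "kin D M Z j l =
     (if j = 0 then zeta M Z l
      else (\<lambda>x. 2 *\<^sub>R zeta M Z l x - kin_transfer D (l - 1) (zeta M Z (l - 1)) x))"

definition kinH ::
  "('d::finite) fe_setting \<Rightarrow> 'd model \<Rightarrow> 'd state \<Rightarrow> nat \<Rightarrow> nat \<Rightarrow> real^'d \<Rightarrow> real^'d" where
  "kinH D M Z j n = kin_transfer D n (kin D M Z j n)"

definition zetaH ::
  "nat \<Rightarrow> ('d::finite) fe_setting \<Rightarrow> 'd model \<Rightarrow> 'd state \<Rightarrow> nat \<Rightarrow> real^'d \<Rightarrow> real^'d" where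
  "zetaH k D M Z n x =
     (if k = 1 then kinH D M Z 0 n x
      else (1/3) *\<^sub>R (2 *\<^sub>R kinH D M Z 0 n x + kinH D M Z 1 n x))"

definition history_nondegenerate ::
  "nat \<Rightarrow> ('d::finite) fe_setting \<Rightarrow> 'd model \<Rightarrow> 'd state \<Rightarrow> nat \<Rightarrow> bool" where
  "history_nondegenerate k D M Z n \<longleftrightarrow>
     (\<not> fixed_topo D n \<longrightarrow>
       (\<forall>j<k. nrm (region D) (kin D M Z j n) \<noteq> 0 \<longrightarrow>
              nrm (region D) (Hproj D (Suc n) (kin D M Z j n)) \<noteq> 0))"

section \<open>The scheme\<close>

definition phase_history ::
  "nat \<Rightarrow> ('d::finite) fe_setting \<Rightarrow> 'd model \<Rightarrow> 'd state \<Rightarrow> nat \<Rightarrow> bool" where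
  "phase_history k D M Z n \<longleftrightarrow>
     (let \<Omega> = region D; hist = (\<lambda>x. histH k (\<lambda>l. phi Z l x) n) in
      phiH Z (Suc n) \<in> Ssp D (Suc n) \<and>
      (\<forall>\<theta>\<in>Ssp D (Suc n).
         (Cn M)\<^sup>2 * ip \<Omega> (grad \<Omega> (phiH Z (Suc n))) (grad \<Omega> \<theta>) + stab M * ip \<Omega> (phiH Z (Suc n)) \<theta>
         = (Cn M)\<^sup>2 * ip \<Omega> (grad \<Omega> hist) (grad \<Omega> \<theta>) + stab M * ip \<Omega> hist \<theta>))"

definition pulled_velocity ::
  "('d::finite) fe_setting \<Rightarrow> 'd state \<Rightarrow> nat \<Rightarrow> real^'d \<Rightarrow> real^'d" where
  "pulled_velocity D Z l x =
     Jdet D l x *\<^sub>R (matrix_inv (Fmat D l x) *v vel Z l (Xmap D l x))"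

definition carrier_remesh ::
  "nat \<Rightarrow> ('d::finite) fe_setting \<Rightarrow> 'd state \<Rightarrow> nat \<Rightarrow> bool" where
  "carrier_remesh k D Z n \<longleftrightarrow>
     (let \<Omega> = region D in
      \<exists>lam\<in>Ssp0 D (Suc n).
        (\<forall>\<theta>\<in>Ssp0 D (Suc n). ip \<Omega> (grad \<Omega> lam) (grad \<Omega> \<theta>) = ip \<Omega> (velE k Z n) (grad \<Omega> \<theta>)) \<and>
        aeq \<Omega> (uc Z (Suc n)) (\<lambda>x. velE k Z n x - grad \<Omega> lam x))"

definition carrier_ale ::
  "nat \<Rightarrow> ('d::finite) fe_setting \<Rightarrow> 'd state \<Rightarrow> nat \<Rightarrow> bool" where
  "carrier_ale k D Z n \<longleftrightarrow>
     (let R = refdom D (Suc n); uE = (\<lambda>x. histE k (\<lambda>l. pulled_velocity D Z l x) n) in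
      \<exists>lam\<in>refS0 D (Suc n).
        (\<forall>\<theta>\<in>refS0 D (Suc n). ip R (grad R lam) (grad R \<theta>) = ip R uE (grad R \<theta>)) \<and>
        aeq R (\<lambda>x. uc Z (Suc n) (Xmap D (Suc n) x))
              (\<lambda>x. (1 / Jdet D (Suc n) x) *\<^sub>R (Fmat D (Suc n) x *v (uE x - grad R lam x))))"

definition carrier_step ::
  "nat \<Rightarrow> ('d::finite) fe_setting \<Rightarrow> 'd state \<Rightarrow> nat \<Rightarrow> bool" where
  "carrier_step k D Z n \<longleftrightarrow>
     (if fixed_topo D n then carrier_ale k D Z n else carrier_remesh k D Z n)"

definition UE :: "nat \<Rightarrow> ('d::finite) fe_setting \<Rightarrow> 'd model \<Rightarrow> 'd state \<Rightarrow> nat \<Rightarrow> real" where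
  "UE k D M Z n = sqrt (ip (region D) (\<lambda>x. Gpot M (phiE k Z n x)) (\<lambda>x. 1) + CG M)"

definition phase_step ::
  "nat \<Rightarrow> ('d::finite) fe_setting \<Rightarrow> 'd model \<Rightarrow> 'd state \<Rightarrow> nat \<Rightarrow> bool" where
  "phase_step k D M Z n \<longleftrightarrow>
     (let \<Omega> = region D; S = Ssp D (Suc n); \<phi> = phi Z (Suc n); \<mu> = mu Z (Suc n);
          U = UE k D M Z n; dG = (\<lambda>x. deriv (Gpot M) (phiE k Z n x));
          d\<phi> = (\<lambda>x. (gam k / tau M) * (\<phi> x - phiH Z (Suc n) x)) in
      U > 0 \<and> \<phi> \<in> S \<and> \<mu> \<in> S \<and>
      (\<forall>\<omega>\<in>S. ip \<Omega> d\<phi> \<omega> - ip \<Omega> (\<lambda>x. phiE k Z n x *\<^sub>R uc Z (Suc n) x) (grad \<Omega> \<omega>)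
              + 1 / Pe M * ip \<Omega> (\<lambda>x. mE k M Z n x *\<^sub>R grad \<Omega> \<mu> x) (grad \<Omega> \<omega>) = 0) \<and>
      (\<forall>\<theta>\<in>S. ip \<Omega> \<mu> \<theta> = (Cn M)\<^sup>2 * ip \<Omega> (grad \<Omega> \<phi>) (grad \<Omega> \<theta>) + stab M * ip \<Omega> \<phi> \<theta>
                         + rsav Z (Suc n) / U * ip \<Omega> dG \<theta>) \<and>
      Dtau (tau M) k (rsav Z) n = 1 / (2 * U) * ip \<Omega> dG d\<phi>)"

definition mass_flux ::
  "nat \<Rightarrow> ('d::finite) fe_setting \<Rightarrow> 'd model \<Rightarrow> 'd state \<Rightarrow> nat \<Rightarrow> real^'d \<Rightarrow> real^'d" where
  "mass_flux k D M Z n x =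
     rho M (phiE k Z n x) *\<^sub>R uc Z (Suc n) x
     - (rhophi M / Pe M * mE k M Z n x) *\<^sub>R grad (region D) (mu Z (Suc n)) x"

definition mesh_velocity ::
  "nat \<Rightarrow> ('d::finite) fe_setting \<Rightarrow> 'd model \<Rightarrow> nat \<Rightarrow> real^'d \<Rightarrow> real^'d" where
  "mesh_velocity k D M n y =
     (if fixed_topo D n
      then Dtau (tau M) k (\<lambda>l. Xmap D l (Xinv D (Suc n) y)) n
      else 0)"

definition rel_flux ::
  "nat \<Rightarrow> ('d::finite) fe_setting \<Rightarrow> 'd model \<Rightarrow> 'd state \<Rightarrow> nat \<Rightarrow> real^'d \<Rightarrow> real^'d" where
  "rel_flux k D M Z n x =
     mass_flux k D M Z n x - rhoh M Z (Suc n) x *\<^sub>R mesh_velocity k D M n x"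

definition convection ::
  "nat \<Rightarrow> ('d::finite) fe_setting \<Rightarrow> 'd model \<Rightarrow> 'd state \<Rightarrow> nat \<Rightarrow>
     (real^'d \<Rightarrow> real^'d) \<Rightarrow> (real^'d \<Rightarrow> real^'d) \<Rightarrow> real" where
  "convection k D M Z n v z =
     1/2 * (ip (region D) (\<lambda>x. jac (region D) v x *v rel_flux k D M Z n x) z
            - ip (region D) (\<lambda>x. jac (region D) z x *v rel_flux k D M Z n x) v)"

definition cns_sq :: "('d::finite) fe_setting \<Rightarrow> 'd model \<Rightarrow> (real^'d \<Rightarrow> real) \<Rightarrow> real" where
  "cns_sq D M v = (Cn M)\<^sup>2 * (nrm (region D) (grad (region D) v))\<^sup>2 + stab M * (nrm (region D) v)\<^sup>2"

definition E_phase ::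
  "nat \<Rightarrow> ('d::finite) fe_setting \<Rightarrow> 'd model \<Rightarrow> 'd state \<Rightarrow> nat \<Rightarrow> real" where
  "E_phase k D M Z l =
     (if k = 1 then
        1 / (2 * We M * Cn M) * cns_sq D M (phi Z l) + 1 / (We M * Cn M) * (rsav Z l)\<^sup>2 + CA M
      else
        1 / (4 * We M * Cn M) * (cns_sq D M (phi Z l)
          + cns_sq D M (\<lambda>x. 2 * phi Z l x - phi Z (l - 1) x))
        + 1 / (2 * We M * Cn M) * ((rsav Z l)\<^sup>2 + (2 * rsav Z l - rsav Z (l - 1))\<^sup>2) + CA M)"

definition discrete_gradient ::
  "('d::finite) fe_setting \<Rightarrow> 'd model \<Rightarrow> 'd state \<Rightarrow> nat \<Rightarrow> bool" where
  "discrete_gradient D M Z l \<longleftrightarrow>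
     (\<forall>p\<in>Psp0 D l. dgrad Z l p \<in> Vsp D l \<and>
        (\<forall>v\<in>Vsp D l. ip (region D) (\<lambda>x. rhoh M Z l x *\<^sub>R dgrad Z l p x) v
                      = - ip (region D) p (divg (region D) v)))"

definition rgrad ::
  "('d::finite) model \<Rightarrow> 'd state \<Rightarrow> nat \<Rightarrow> (real^'d \<Rightarrow> real) \<Rightarrow> real^'d \<Rightarrow> real^'d" where
  "rgrad M Z l p x = sqrt (rhoh M Z l x) *\<^sub>R dgrad Z l p x"

definition xi ::
  "('d::finite) fe_setting \<Rightarrow> 'd model \<Rightarrow> 'd state \<Rightarrow> nat \<Rightarrow> real^'d \<Rightarrow> real^'d" where
  "xi D M Z n =
     (if fixed_topo D n then ale_transfer D n (rgrad M Z n (pr Z n)) else rgrad M Z n (pr Z n))"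

definition pressure_transport ::
  "nat \<Rightarrow> ('d::finite) fe_setting \<Rightarrow> 'd model \<Rightarrow> 'd state \<Rightarrow> nat \<Rightarrow> bool" where
  "pressure_transport k D M Z n \<longleftrightarrow>
     (let \<Omega> = region D; P0 = Psp0 D (Suc n); dg = dgrad Z (Suc n); \<rho> = rhoh M Z (Suc n) in
      prtr Z (Suc n) \<in> P0 \<and> prbar Z (Suc n) \<in> P0 \<and>
      (\<forall>\<alpha>\<in>P0. ip \<Omega> (\<lambda>x. \<rho> x *\<^sub>R dg (prtr Z (Suc n)) x) (dg \<alpha>)
                = ip \<Omega> (xi D M Z n) (\<lambda>x. sqrt (\<rho> x) *\<^sub>R dg \<alpha> x)) \<and>
      (\<forall>\<alpha>\<in>P0. ip \<Omega> (\<lambda>x. \<rho> x *\<^sub>R dg (prbar Z (Suc n)) x) (dg \<alpha>)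
                = ip \<Omega> (\<lambda>x. xi D M Z n x + (gam k / tau M) *\<^sub>R zetaH k D M Z n x)
                       (\<lambda>x. sqrt (\<rho> x) *\<^sub>R dg \<alpha> x)))"

definition momentum_step ::
  "nat \<Rightarrow> ('d::finite) fe_setting \<Rightarrow> 'd model \<Rightarrow> 'd state \<Rightarrow> nat \<Rightarrow> bool" where
  "momentum_step k D M Z n \<longleftrightarrow>
     (let \<Omega> = region D; \<rho> = rhoh M Z (Suc n); \<eta> = etah M Z (Suc n);
          cap = (\<lambda>x. phi Z (Suc n) x *\<^sub>R grad \<Omega> (mu Z (Suc n)) x) in
      \<forall>q. ustarq Z (Suc n) q \<in> Vsp D (Suc n) \<and>
        (\<forall>v\<in>Vsp D (Suc n).
          gam k / tau M * ip \<Omega> (\<lambda>x. sqrt (\<rho> x) *\<^sub>R ustarq Z (Suc n) q x - zetaH k D M Z n x)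
                                (\<lambda>x. sqrt (\<rho> x) *\<^sub>R v x)
          + convection k D M Z n (ustarq Z (Suc n) q) v
          + 2 / Rey M * ip \<Omega> (\<lambda>x. \<eta> x *\<^sub>R symgrad \<Omega> (ustarq Z (Suc n) q) x) (symgrad \<Omega> v)
          = ip \<Omega> (prbar Z (Suc n)) (divg \<Omega> v) + ip \<Omega> (force M (Suc n)) v
            - q / (We M * Cn M) * ip \<Omega> cap v))"

definition q_step ::
  "nat \<Rightarrow> ('d::finite) fe_setting \<Rightarrow> 'd model \<Rightarrow> 'd state \<Rightarrow> nat \<Rightarrow> bool" where
  "q_step k D M Z n \<longleftrightarrow>
     (let \<Omega> = region D; q = qsav Z (Suc n); g\<mu> = grad \<Omega> (mu Z (Suc n)) in
      q > 0 \<and>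
      gam k * q / (alphaq M * tau M) * (q - histH k (qsav Z) n)
      + (q - qsav Z n) / tau M * E_phase k D M Z n
      + q / (We M * Cn M) * ip \<Omega> (\<lambda>x. phiE k Z n x *\<^sub>R uc Z (Suc n) x) g\<mu>
      - q / (We M * Cn M) * ip \<Omega> (\<lambda>x. phi Z (Suc n) x *\<^sub>R g\<mu> x) (ustarq Z (Suc n) q) = 0)"

definition projection_step ::
  "nat \<Rightarrow> ('d::finite) fe_setting \<Rightarrow> 'd model \<Rightarrow> 'd state \<Rightarrow> nat \<Rightarrow> bool" where
  "projection_step k D M Z n \<longleftrightarrow>
     (let \<Omega> = region D; P0 = Psp0 D (Suc n); dg = dgrad Z (Suc n) in
      dpr Z (Suc n) \<in> P0 \<and>
      (\<forall>\<alpha>\<in>P0. ip \<Omega> (\<lambda>x. rhoh M Z (Suc n) x *\<^sub>R dg (dpr Z (Suc n)) x) (dg \<alpha>)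
                = - (gam k / tau M) * ip \<Omega> (divg \<Omega> (ustar Z (Suc n))) \<alpha>) \<and>
      vel Z (Suc n) = (\<lambda>x. ustar Z (Suc n) x - (tau M / gam k) *\<^sub>R dg (dpr Z (Suc n)) x) \<and>
      pr Z (Suc n) = (\<lambda>x. prtr Z (Suc n) x + dpr Z (Suc n) x))"

text \<open>Finiteness of those integrals in the scheme that is not already guaranteed by
  square-integrability and the bounds on density and viscosity.\<close>

definition integrals_finite ::
  "nat \<Rightarrow> ('d::finite) fe_setting \<Rightarrow> 'd model \<Rightarrow> 'd state \<Rightarrow> nat \<Rightarrow> bool" where
  "integrals_finite k D M Z n \<longleftrightarrow>
     (let \<Omega> = region D; g\<mu> = grad \<Omega> (mu Z (Suc n)) in
      integrable (lebesgue_on \<Omega>) (\<lambda>x. Gpot M (phiE k Z n x)) \<and>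
      (\<forall>\<omega>\<in>Ssp D (Suc n).
         integrable (lebesgue_on \<Omega>) (\<lambda>x. deriv (Gpot M) (phiE k Z n x) * \<omega> x) \<and>
         integrable (lebesgue_on \<Omega>) (\<lambda>x. (phiE k Z n x *\<^sub>R uc Z (Suc n) x) \<bullet> grad \<Omega> \<omega> x) \<and>
         integrable (lebesgue_on \<Omega>) (\<lambda>x. (mE k M Z n x *\<^sub>R g\<mu> x) \<bullet> grad \<Omega> \<omega> x)) \<and>
      (\<forall>v\<in>Vsp D (Suc n).
         integrable (lebesgue_on \<Omega>) (\<lambda>x. (phi Z (Suc n) x *\<^sub>R g\<mu> x) \<bullet> v x) \<and>
         (\<forall>z\<in>Vsp D (Suc n).
            integrable (lebesgue_on \<Omega>) (\<lambda>x. (jac \<Omega> v x *v rel_flux k D M Z n x) \<bullet> z x))))"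

definition initial_state :: "('d::finite) fe_setting \<Rightarrow> 'd model \<Rightarrow> 'd state \<Rightarrow> bool" where
  "initial_state D M Z \<longleftrightarrow>
     phi Z 0 \<in> Ssp D 0 \<and> vel Z 0 \<in> Vsp D 0 \<and> pr Z 0 \<in> Psp0 D 0 \<and>
     rsav Z 0 = sqrt (ip (region D) (\<lambda>x. Gpot M (phi Z 0 x)) (\<lambda>x. 1) + CG M) \<and> qsav Z 0 = 1"

definition pc_step ::
  "nat \<Rightarrow> ('d::finite) fe_setting \<Rightarrow> 'd model \<Rightarrow> 'd state \<Rightarrow> nat \<Rightarrow> bool" where
  "pc_step k D M Z n \<longleftrightarrow>
     history_nondegenerate k D M Z n \<and> integrals_finite k D M Z n \<and>
     phase_history k D M Z n \<and> carrier_step k D Z n \<and> phase_step k D M Z n \<and>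
     pressure_transport k D M Z n \<and> momentum_step k D M Z n \<and> q_step k D M Z n \<and>
     projection_step k D M Z n"

section \<open>Energy and numerical dissipation\<close>

definition E_h :: "nat \<Rightarrow> ('d::finite) fe_setting \<Rightarrow> 'd model \<Rightarrow> 'd state \<Rightarrow> nat \<Rightarrow> real" where
  "E_h k D M Z l =
     (if k = 1 then
        1/2 * (nrm (region D) (kin D M Z 0 l))\<^sup>2 + qsav Z l * E_phase 1 D M Z l
        + 1 / (2 * alphaq M) * (qsav Z l)\<^sup>2
      else
        1/4 * ((nrm (region D) (kin D M Z 0 l))\<^sup>2 + (nrm (region D) (kin D M Z 1 l))\<^sup>2)
        + qsav Z l * E_phase 2 D M Z l
        + 1 / (4 * alphaq M) * ((qsav Z l)\<^sup>2 + (2 * qsav Z l - qsav Z (l - 1))\<^sup>2))"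

definition E_pc :: "nat \<Rightarrow> ('d::finite) fe_setting \<Rightarrow> 'd model \<Rightarrow> 'd state \<Rightarrow> nat \<Rightarrow> real" where
  "E_pc k D M Z l =
     E_h k D M Z l + (tau M)\<^sup>2 / (2 * gam k) * (nrm (region D) (rgrad M Z l (pr Z l)))\<^sup>2"

text \<open>\<open>N_h k D M Z n\<close> and \<open>N_p k D M Z n\<close> are the dissipation terms of level \<open>n+1\<close>.\<close>

definition N_h :: "nat \<Rightarrow> ('d::finite) fe_setting \<Rightarrow> 'd model \<Rightarrow> 'd state \<Rightarrow> nat \<Rightarrow> real" where
  "N_h k D M Z n =
     (let \<phi> = phi Z; r = rsav Z; q = qsav Z in
      if k = 1 then
        1/2 * (nrm (region D) (\<lambda>x. zeta M Z (Suc n) x - kinH D M Z 0 n x))\<^sup>2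
        + q (Suc n) * (1 / (2 * We M * Cn M) * cns_sq D M (\<lambda>x. \<phi> (Suc n) x - \<phi> n x)
                       + 1 / (We M * Cn M) * (r (Suc n) - r n)\<^sup>2)
        + 1 / (2 * alphaq M) * (q (Suc n) - q n)\<^sup>2
      else
        1/4 * (nrm (region D) (\<lambda>x. zeta M Z (Suc n) x - kinH D M Z 1 n x))\<^sup>2
        + q (Suc n) * (1 / (4 * We M * Cn M)
                         * cns_sq D M (\<lambda>x. \<phi> (Suc n) x - 2 * \<phi> n x + \<phi> (n - 1) x)
                       + 1 / (2 * We M * Cn M) * (r (Suc n) - 2 * r n + r (n - 1))\<^sup>2)
        + 1 / (4 * alphaq M) * (q (Suc n) - 2 * q n + q (n - 1))\<^sup>2)"

definition N_p :: "nat \<Rightarrow> ('d::finite) fe_setting \<Rightarrow> 'd model \<Rightarrow> 'd state \<Rightarrow> nat \<Rightarrow> real" where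
  "N_p k D M Z n =
     (tau M)\<^sup>2 / (2 * gam k) * (nrm (region D) (rgrad M Z (Suc n) (dpr Z (Suc n))))\<^sup>2
     + (tau M)\<^sup>2 / (2 * gam k)
       * (nrm (region D) (\<lambda>x. xi D M Z n x - rgrad M Z (Suc n) (prtr Z (Suc n)) x))\<^sup>2"

end

(* Test the phase equation with the chemical potential, the potential equation with the discrete time
   derivative of the phase field, and the momentum equation with u_*; the capillary terms cancel
   against the equation for q and the skew-symmetric convection term vanishes.  What remains are
   telescoping identities of the form 2(a - b, a) = |a|^2 - |b|^2 + |a - b|^2 (and their BDF2
   analogues), the orthogonality of the new kinetic variable to all weighted discrete pressure
   gradients, and the fact that the history transfers preserve the L2 norm.  The latter is the change
   of variables formula for the ALE transfer and holds by normalisation for the remeshing transfer.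
   Linearity of the weak gradient, needed to expand the (Cn,s)-norms, follows from the fundamental
   lemma of the calculus of variations. *)

theory Submission
  imports Defs
begin

text \<open>The new kinetic variable is compared with histories from another mesh. The remeshing
  transfer keeps norms but is neither linear nor compatible with mixed products, so a balance closes
  only if old-level data enter through norms of single transferred fields. This explains the second
  BDF2 history: g1 plays the part of 2 zeta^n - zeta^(n-1), is carried as one field, and (2 g0 +
  g1)/3 then plays the part of (4 zeta^n - zeta^(n-1))/3. The intermediate pressure contains the
  kinetic history on its right-hand side so that the pairing of this history with the pressure
  increment cancels. The pairing of the transported gradient with the increment is left, and the
  orthogonal splitting of that gradient turns it into a difference of pressure energies plus
  squares. A further obstacle is that \<open>grad\<close> and \<open>dgrad\<close> are given by a
  choice or by a defining property. They are determined only up to null sets, so every linear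
  manipulation of them rests on a uniqueness argument and on exchanging representatives inside
  integrals.\<close>

section \<open>Change of variables for arbitrary index types\<close>

text \<open>The library states the change of variables formula for well-ordered index types only;
  renaming coordinates transports it to any two- or three-element index type.\<close>

definition recoord :: "('d::finite \<Rightarrow> 'e::finite) \<Rightarrow> real^'e \<Rightarrow> real^'d" where
  "recoord \<tau> u = (\<chi> i. u $ \<tau> i)"

lemma recoord_nth [simp]: "recoord \<tau> u $ i = u $ \<tau> i"
  by (simp add: recoord_def)

lemma linear_recoord: "linear (recoord \<tau>)"
  by (intro linearI) (simp_all add: vec_eq_iff)

lemma continuous_on_recoord: "continuous_on S (recoord \<tau>)"
  by (intro linear_continuous_on linear_linear[THEN iffD2] linear_recoord)

lemma recoord_inverse:
  assumes "bij \<tau>"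
  shows "recoord \<tau> (recoord (inv \<tau>) x) = x" "recoord (inv \<tau>) (recoord \<tau> u) = u"
  using assms by (simp_all add: vec_eq_iff bij_is_inj bij_is_surj surj_f_inv_f)

text \<open>Lebesgue measure is determined by its values on boxes. Renaming coordinates pulls a box
  back to a box with permuted side lengths, and their product does not see the order.\<close>

lemma distr_lborel_recoord:
  fixes \<tau> :: "'d::finite \<Rightarrow> 'e::finite"
  assumes \<tau>: "bij \<tau>"
  shows "distr lborel borel (recoord \<tau>) = (lborel :: (real^'d) measure)"
proof (rule lborel_eqI[symmetric])
  fix l u :: "real^'d"
  assume le: "\<And>b. b \<in> Basis \<Longrightarrow> l \<bullet> b \<le> u \<bullet> b"
  have le': "l $ i \<le> u $ i" for i
    using le[of "axis i 1"] by (simp add: inner_axis axis_in_Basis_iff)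
  have "recoord \<tau> -` box l u = box (recoord (inv \<tau>) l) (recoord (inv \<tau>) u)"
  proof (intro equalityI subsetI)
    fix v assume "v \<in> recoord \<tau> -` box l u"
    then have "l $ i < v $ \<tau> i \<and> v $ \<tau> i < u $ i" for i
      by (auto simp: mem_box_cart)
    then have "l $ inv \<tau> j < v $ \<tau> (inv \<tau> j) \<and> v $ \<tau> (inv \<tau> j) < u $ inv \<tau> j" for j
      by blast
    then show "v \<in> box (recoord (inv \<tau>) l) (recoord (inv \<tau>) u)"
      using \<tau> by (simp add: mem_box_cart bij_is_surj surj_f_inv_f)
  next
    fix v assume "v \<in> box (recoord (inv \<tau>) l) (recoord (inv \<tau>) u)"
    then have "l $ inv \<tau> (\<tau> i) < v $ \<tau> i \<and> v $ \<tau> i < u $ inv \<tau> (\<tau> i)" for i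
      by (auto simp: mem_box_cart)
    then show "v \<in> recoord \<tau> -` box l u"
      using \<tau> by (simp add: mem_box_cart bij_is_inj)
  qed
  moreover have "recoord \<tau> \<in> borel_measurable lborel"
    using continuous_on_recoord borel_measurable_continuous_onI by auto
  ultimately have "emeasure (distr lborel borel (recoord \<tau>)) (box l u)
      = emeasure lborel (box (recoord (inv \<tau>) l) (recoord (inv \<tau>) u))"
    by (simp add: emeasure_distr)
  also have "\<dots> = (\<Prod>b\<in>Basis. (recoord (inv \<tau>) u - recoord (inv \<tau>) l) \<bullet> b)"
    by (intro emeasure_lborel_box) (auto simp: Basis_vec_def inner_axis le')
  also have "(\<Prod>b\<in>Basis. (recoord (inv \<tau>) u - recoord (inv \<tau>) l) \<bullet> b)
      = (\<Prod>j\<in>UNIV. u $ inv \<tau> j - l $ inv \<tau> j)"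
    by (simp add: Basis_vec_def inner_axis prod.UNION_disjoint axis_eq_axis)
  also have "\<dots> = (\<Prod>i\<in>UNIV. u $ i - l $ i)"
    using \<tau> by (intro prod.reindex_bij_betw[of "inv \<tau>" UNIV UNIV "\<lambda>i. u $ i - l $ i"])
      (simp add: bij_imp_bij_inv)
  also have "\<dots> = (\<Prod>b\<in>Basis. (u - l) \<bullet> b)"
    by (simp add: Basis_vec_def inner_axis prod.UNION_disjoint axis_eq_axis)
  finally show "emeasure (distr lborel borel (recoord \<tau>)) (box l u) = ennreal (\<Prod>b\<in>Basis. (u - l) \<bullet> b)" .
qed simp

text \<open>A map that carries \<open>lborel\<close> to \<open>lborel\<close> respects null sets, so
  both statements pass to the completion, which is Lebesgue measure.\<close>

lemma
  fixes \<tau> :: "'d::finite \<Rightarrow> 'e::finite"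
  assumes \<tau>: "bij \<tau>"
  shows recoord_measurable: "recoord \<tau> \<in> lebesgue \<rightarrow>\<^sub>M lebesgue"
    and distr_lebesgue_recoord: "distr lebesgue lebesgue (recoord \<tau>) = (lebesgue :: (real^'d) measure)"
proof -
  have m: "recoord \<tau> \<in> borel_measurable lborel"
    using continuous_on_recoord borel_measurable_continuous_onI by auto
  have eq: "distr lebesgue lborel (recoord \<tau>) = (lborel :: (real^'d) measure)"
    using distr_completion[of "recoord \<tau>" lborel lborel] distr_lborel_recoord[OF \<tau>] m
    by (simp cong: distr_cong)
  show r: "recoord \<tau> \<in> lebesgue \<rightarrow>\<^sub>M lebesgue"
    by (rule completion.measurable_completion2) (use m eq in \<open>auto intro: measurable_completion\<close>)
  show "distr lebesgue lebesgue (recoord \<tau>) = (lebesgue :: (real^'d) measure)"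
    using completion.completion_distr_eq[of "recoord \<tau>" lborel "lborel :: (real^'d) measure"] m
    by (simp add: eq measurable_completion)
qed

lemma absolutely_integrable_recoord:
  fixes \<tau> :: "'d::finite \<Rightarrow> 'e::finite" and f :: "real^'d \<Rightarrow> 'b::euclidean_space"
  assumes \<tau>: "bij \<tau>" and f: "f absolutely_integrable_on S"
  shows "(f \<circ> recoord \<tau>) absolutely_integrable_on (recoord \<tau> -` S)"
    and "integral (recoord \<tau> -` S) (f \<circ> recoord \<tau>) = integral S f"
proof -
  let ?g = "\<lambda>x. indicator S x *\<^sub>R f x"
  have eq: "(\<lambda>u. indicator (recoord \<tau> -` S) u *\<^sub>R (f \<circ> recoord \<tau>) u) = (\<lambda>u. ?g (recoord \<tau> u))"
    by (auto simp: fun_eq_iff indicator_def)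
  have int: "integrable lebesgue ?g"
    using f by (simp add: set_integrable_def)
  then show i: "(f \<circ> recoord \<tau>) absolutely_integrable_on (recoord \<tau> -` S)"
    unfolding set_integrable_def eq
    by (intro integrable_distr[OF recoord_measurable[OF \<tau>]]) (simp add: distr_lebesgue_recoord[OF \<tau>])
  have "(LINT u|lebesgue. ?g (recoord \<tau> u)) = (LINT x|distr lebesgue lebesgue (recoord \<tau>). ?g x)"
    by (rule integral_distr[symmetric]) (use recoord_measurable[OF \<tau>] int in auto)
  then have "(LINT u|lebesgue. ?g (recoord \<tau> u)) = (LINT x|lebesgue. ?g x)"
    by (simp add: distr_lebesgue_recoord[OF \<tau>])
  then show "integral (recoord \<tau> -` S) (f \<circ> recoord \<tau>) = integral S f"
    using set_lebesgue_integral_eq_integral(2)[OF i] set_lebesgue_integral_eq_integral(2)[OF f]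
    unfolding set_lebesgue_integral_def eq by simp
qed

text \<open>Renaming rows and columns by the same bijection conjugates the permutations in the
  Leibniz sum; conjugation keeps the sign and only reorders the factors of each product.\<close>

lemma det_reindex:
  fixes \<tau> :: "'d::finite \<Rightarrow> 'e::finite" and A :: "real^'d^'d"
  assumes \<tau>: "bij \<tau>"
  shows "det (\<chi> i j. A $ inv \<tau> i $ inv \<tau> j) = det A"
proof -
  have inj: "inj \<tau>" and inv: "\<And>i. inv \<tau> (\<tau> i) = i" "\<And>j. \<tau> (inv \<tau> j) = j"
    using \<tau> by (simp_all add: bij_is_inj bij_is_surj surj_f_inv_f)
  have "det A = (\<Sum>p | p permutes UNIV. of_int (sign p) * (\<Prod>i\<in>UNIV. A $ i $ p i))"
    by (simp add: det_def)
  also have "\<dots> = (\<Sum>p | p permutes UNIV. of_int (sign p) * (\<Prod>i\<in>UNIV. A $ inv \<tau> i $ inv \<tau> (p i)))"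
  proof (rule sum.reindex_bij_witness[where j = "\<lambda>p. \<tau> \<circ> p \<circ> inv \<tau>" and i = "\<lambda>p. inv \<tau> \<circ> p \<circ> \<tau>"])
    fix p :: "'d \<Rightarrow> 'd" assume p: "p \<in> {p. p permutes UNIV}"
    \<comment> \<open>The conjugate is read as a \<open>map_permutation\<close>, whose sign is that
      of \<open>p\<close>.\<close>
    have mp: "\<tau> \<circ> p \<circ> inv \<tau> = map_permutation UNIV \<tau> p"
      using \<tau> by (auto simp: map_permutation_def fun_eq_iff restrict_id_def bij_is_surj)
    have "sign (\<tau> \<circ> p \<circ> inv \<tau>) = sign p"
      unfolding mp using p inj by (intro sign_map_permutation) auto
    moreover have "(\<Prod>i\<in>UNIV. A $ inv \<tau> i $ p (inv \<tau> i)) = (\<Prod>i\<in>UNIV. A $ i $ p i)"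
      using \<tau> by (intro prod.reindex_bij_betw[of "inv \<tau>" UNIV UNIV "\<lambda>i. A $ i $ p i"])
        (simp add: bij_imp_bij_inv)
    ultimately show "of_int (sign (\<tau> \<circ> p \<circ> inv \<tau>)) * (\<Prod>i\<in>UNIV. A $ inv \<tau> i $ inv \<tau> ((\<tau> \<circ> p \<circ> inv \<tau>) i))
        = of_int (sign p) * (\<Prod>i\<in>UNIV. A $ i $ p i)"
      by (simp add: inv)
    show "\<tau> \<circ> p \<circ> inv \<tau> \<in> {p. p permutes UNIV}"
      using p \<tau> permutes_bij[of p UNIV] bij_imp_bij_inv[OF \<tau>]
      by (auto intro!: bij_imp_permutes bij_comp)
    show "inv \<tau> \<circ> (\<tau> \<circ> p \<circ> inv \<tau>) \<circ> \<tau> = p"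
      by (rule ext) (simp only: o_apply inv)
  next
    fix p :: "'e \<Rightarrow> 'e" assume p: "p \<in> {p. p permutes UNIV}"
    show "inv \<tau> \<circ> p \<circ> \<tau> \<in> {p. p permutes UNIV}"
      using p \<tau> permutes_bij[of p UNIV] bij_imp_bij_inv[OF \<tau>]
      by (auto intro!: bij_imp_permutes bij_comp)
    show "\<tau> \<circ> (inv \<tau> \<circ> p \<circ> \<tau>) \<circ> inv \<tau> = p"
      by (rule ext) (simp only: o_apply inv)
  qed
  finally show ?thesis by (simp add: det_def)
qed

text \<open>Conjugating \<open>X\<close> with the renaming gives a map \<open>?X\<close> on
  coordinates indexed by the well-ordered type \<open>'e\<close>. Its Jacobian matrix is the
  reindexed \<open>?B\<close>, which has the same determinant, and the integrals on both sides are
  unchanged by the renaming.\<close>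

lemma change_of_variables_via_recoord:
  fixes \<tau> :: "'d::finite \<Rightarrow> 'e::{finite,wellorder}" and X :: "real^'d \<Rightarrow> real^'d" and f :: "real^'d \<Rightarrow> real"
  assumes \<tau>: "bij \<tau>" and S: "S \<in> sets lebesgue"
    and der: "\<And>x. x \<in> S \<Longrightarrow> (X has_derivative (*v) (A x)) (at x)"
    and inj: "inj_on X S"
  shows "(\<lambda>x. \<bar>det (A x)\<bar> * f (X x)) absolutely_integrable_on S \<and>
           integral S (\<lambda>x. \<bar>det (A x)\<bar> * f (X x)) = b
         \<longleftrightarrow> f absolutely_integrable_on (X ` S) \<and> integral (X ` S) f = b"
proof -
  let ?r = "recoord \<tau>" and ?r' = "recoord (inv \<tau>)"
  let ?X = "\<lambda>u. ?r' (X (?r u))" and ?S = "?r -` S"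
  let ?B = "\<lambda>u. \<chi> i j. A (?r u) $ inv \<tau> i $ inv \<tau> j"
  have \<tau>': "bij (inv \<tau>)" using \<tau> by (rule bij_imp_bij_inv)
  have inv: "\<And>i. inv \<tau> (\<tau> i) = i" "\<And>j. \<tau> (inv \<tau> j) = j"
    using \<tau> by (simp_all add: bij_is_inj bij_is_surj surj_f_inv_f)
  have \<tau>'': "inv (inv \<tau>) = \<tau>" using \<tau> by (rule inv_inv_eq)
  note rr = recoord_inverse[OF \<tau>]
  \<comment> \<open>The two directions are the one-sided transfer for \<tau> and for its
    inverse.\<close>
  have tr: "g absolutely_integrable_on T \<and> integral T g = b \<longleftrightarrow>
      (\<lambda>u. g (?r u)) absolutely_integrable_on (?r -` T) \<and> integral (?r -` T) (\<lambda>u. g (?r u)) = b"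
    for g :: "real^'d \<Rightarrow> real" and T
  proof -
    have "?r' -` ?r -` T = T" "(g \<circ> ?r) \<circ> ?r' = g"
      by (auto simp: rr)
    then show ?thesis
      using absolutely_integrable_recoord[OF \<tau>, where f = g and S = T]
        absolutely_integrable_recoord[OF \<tau>', where f = "g \<circ> ?r" and S = "?r -` T"]
      by (auto simp: o_def)
  qed
  \<comment> \<open>The change of variables theorem integrates vectors, so a real integrand is
    embedded as the vector with all components equal.\<close>
  have tv: "(h :: (real, 'e) vec \<Rightarrow> real) absolutely_integrable_on T \<and> integral T h = b \<longleftrightarrow>
      (\<lambda>u. vec (h u) :: (real, 'e) vec) absolutely_integrable_on T \<and> integral T (\<lambda>u. vec (h u) :: (real, 'e) vec) = vec b" for h T
  proof -
    have 1: "(\<lambda>u. vec (h u) :: (real, 'e) vec) absolutely_integrable_on T \<longleftrightarrow> h absolutely_integrable_on T"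
      using absolutely_integrable_componentwise_iff[where f = "\<lambda>u. vec (h u) :: (real, 'e) vec"]
      by (auto simp: Basis_vec_def inner_axis)
    have "integral T (\<lambda>u. vec (h u) :: (real, 'e) vec) = vec (integral T h)" if "h absolutely_integrable_on T"
    proof -
      have "(h has_integral integral T h) T"
        using that by (simp add: absolutely_integrable_on_def integrable_integral)
      then have "((\<lambda>u. vec (h u) :: (real, 'e) vec) has_integral vec (integral T h)) T"
        by (subst has_integral_componentwise_iff) (auto simp: Basis_vec_def inner_axis)
      then show ?thesis by (rule integral_unique)
    qed
    then show ?thesis using 1 by (auto simp: vec_eq_iff)
  qed
  have der': "(?X has_derivative (*v) (?B u)) (at u within ?S)" if "u \<in> ?S" for u
  proof -
    have l: "(recoord \<sigma> has_derivative recoord \<sigma>) (at x within T)"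
      for \<sigma> :: "'p::finite \<Rightarrow> 'q::finite" and x T
      by (rule linear_imp_has_derivative[OF linear_recoord])
    have "((\<lambda>u. X (?r u)) has_derivative (\<lambda>h. A (?r u) *v ?r h)) (at u)"
      using has_derivative_compose[OF l[of \<tau>] der[of "?r u"]] that by simp
    then have "((\<lambda>u. ?r' (X (?r u))) has_derivative (\<lambda>h. ?r' (A (?r u) *v ?r h))) (at u)"
      by (rule has_derivative_compose) (rule l)
    moreover have "?r' (A (?r u) *v ?r h) = ?B u *v h" for h
    proof -
      have "(\<Sum>j\<in>UNIV. A (?r u) $ inv \<tau> i $ j * h $ \<tau> j) = (\<Sum>j\<in>UNIV. A (?r u) $ inv \<tau> i $ inv \<tau> j * h $ j)" for i
        using sum.reindex_bij_betw[of "inv \<tau>" UNIV UNIV "\<lambda>j. A (?r u) $ inv \<tau> i $ j * h $ \<tau> j"] \<tau>'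
        by (simp add: inv)
      then show ?thesis by (simp add: vec_eq_iff matrix_vector_mult_def)
    qed
    ultimately show ?thesis by (simp add: has_derivative_at_withinI)
  qed
  have S': "?S \<in> sets lebesgue"
    using measurable_sets[OF recoord_measurable[OF \<tau>] S] by simp
  have inj': "inj_on ?X ?S"
  proof (rule inj_onI)
    fix u v assume *: "u \<in> ?S" "v \<in> ?S" and "?X u = ?X v"
    then have "?r (?X u) = ?r (?X v)" by simp
    then have "X (?r u) = X (?r v)" by (simp add: rr)
    then have "?r u = ?r v" using inj * by (auto dest: inj_onD)
    then have "?r' (?r u) = ?r' (?r v)" by simp
    then show "u = v" by (simp add: rr)
  qed
  have im: "?X ` ?S = ?r -` (X ` S)"
  proof (intro equalityI subsetI)
    fix v assume "v \<in> ?r -` (X ` S)"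
    then obtain x where "x \<in> S" "?r v = X x" by auto
    then have "v = ?X (?r' x)" "?r' x \<in> ?S" using rr(2)[of v] by (simp_all add: rr)
    then show "v \<in> ?X ` ?S" by blast
  qed (auto simp: rr)
  have "(\<lambda>x. \<bar>det (A x)\<bar> * f (X x)) absolutely_integrable_on S \<and>
           integral S (\<lambda>x. \<bar>det (A x)\<bar> * f (X x)) = b
     \<longleftrightarrow> (\<lambda>u. \<bar>det (A (?r u))\<bar> * f (X (?r u))) absolutely_integrable_on ?S \<and>
           integral ?S (\<lambda>u. \<bar>det (A (?r u))\<bar> * f (X (?r u))) = b"
    by (rule tr)
  also have "\<dots> \<longleftrightarrow> (\<lambda>u. \<bar>det (matrix ((*v) (?B u)))\<bar> *\<^sub>R (vec (f (?r (?X u))) :: (real, 'e) vec)) absolutely_integrable_on ?S \<and>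
           integral ?S (\<lambda>u. \<bar>det (matrix ((*v) (?B u)))\<bar> *\<^sub>R (vec (f (?r (?X u))) :: (real, 'e) vec)) = vec b"
  proof -
    have "\<bar>det (matrix ((*v) (?B u)))\<bar> *\<^sub>R (vec (f (?r (?X u))) :: (real, 'e) vec)
        = vec (\<bar>det (A (?r u))\<bar> * f (X (?r u)))" for u
      by (simp add: vec_eq_iff rr det_reindex[OF \<tau>])
    then show ?thesis by (subst tv) simp
  qed
  also have "\<dots> \<longleftrightarrow> (\<lambda>v. vec (f (?r v)) :: (real, 'e) vec) absolutely_integrable_on (?X ` ?S) \<and>
      integral (?X ` ?S) (\<lambda>v. vec (f (?r v)) :: (real, 'e) vec) = vec b"
    by (rule has_absolute_integral_change_of_variables[OF S' der' inj'])
  also have "\<dots> \<longleftrightarrow> (\<lambda>v. f (?r v)) absolutely_integrable_on (?r -` (X ` S)) \<and>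
      integral (?r -` (X ` S)) (\<lambda>v. f (?r v)) = b"
    unfolding im by (rule tv[symmetric])
  also have "\<dots> \<longleftrightarrow> f absolutely_integrable_on (X ` S) \<and> integral (X ` S) f = b"
    by (rule tr[symmetric])
  finally show ?thesis .
qed

text \<open>The dimension hypothesis enters here: an index type with two or three elements is in
  bijection with the numeral type \<open>2\<close> or \<open>3\<close>, and these are
  well-ordered.\<close>

lemma change_of_variables_dim_2_3:
  fixes X :: "real^'d \<Rightarrow> real^'d" and f :: "real^'d \<Rightarrow> real"
  assumes dim: "CARD('d::finite) = 2 \<or> CARD('d) = 3" and S: "S \<in> sets lebesgue"
    and der: "\<And>x. x \<in> S \<Longrightarrow> (X has_derivative (*v) (A x)) (at x)"
    and inj: "inj_on X S"
  shows "(\<lambda>x. \<bar>det (A x)\<bar> * f (X x)) absolutely_integrable_on S \<and>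
           integral S (\<lambda>x. \<bar>det (A x)\<bar> * f (X x)) = b
         \<longleftrightarrow> f absolutely_integrable_on (X ` S) \<and> integral (X ` S) f = b"
  using dim
proof
  assume "CARD('d) = 2"
  then have "CARD('d) = CARD(2)" by simp
  then obtain \<tau> :: "'d \<Rightarrow> 2" where "bij \<tau>"
    using finite_same_card_bij[of "UNIV :: 'd set" "UNIV :: 2 set"] by auto
  then show ?thesis by (rule change_of_variables_via_recoord[OF _ S der inj])
next
  assume "CARD('d) = 3"
  then have "CARD('d) = CARD(3)" by simp
  then obtain \<tau> :: "'d \<Rightarrow> 3" where "bij \<tau>"
    using finite_same_card_bij[of "UNIV :: 'd set" "UNIV :: 3 set"] by auto
  then show ?thesis by (rule change_of_variables_via_recoord[OF _ S der inj])
qed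

section \<open>Square-integrable functions\<close>

lemma L2_measurable: "f \<in> L2 \<Omega> \<Longrightarrow> f \<in> borel_measurable (lebesgue_on \<Omega>)"
  by (simp add: L2_def)

lemma integrable_inner_L2:
  assumes f: "f \<in> L2 \<Omega>" and g: "g \<in> L2 \<Omega>"
  shows "integrable (lebesgue_on \<Omega>) (\<lambda>x. f x \<bullet> g x)"
proof (rule Bochner_Integration.integrable_bound)
  show "integrable (lebesgue_on \<Omega>) (\<lambda>x. (norm (f x))\<^sup>2 + (norm (g x))\<^sup>2)"
    using f g by (auto simp: L2_def)
  show "(\<lambda>x. f x \<bullet> g x) \<in> borel_measurable (lebesgue_on \<Omega>)"
    using f g by (auto simp: L2_def)
  have "\<bar>a \<bullet> b\<bar> \<le> (norm a)\<^sup>2 + (norm b)\<^sup>2" for a b :: 'b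
  proof -
    have "\<bar>a \<bullet> b\<bar> \<le> norm a * norm b" by (rule Cauchy_Schwarz_ineq2)
    also have "\<dots> \<le> 2 * norm a * norm b" by simp
    also have "\<dots> \<le> (norm a)\<^sup>2 + (norm b)\<^sup>2" by (rule sum_squares_bound)
    finally show ?thesis .
  qed
  then show "AE x in lebesgue_on \<Omega>. norm (f x \<bullet> g x) \<le> norm ((norm (f x))\<^sup>2 + (norm (g x))\<^sup>2)"
    by (auto intro!: AE_I2)
qed

text \<open>The multiplier is bounded only almost everywhere because the density bounds are assumed
  in this sense.\<close>

lemma L2_bounded_scaleR:
  assumes g: "g \<in> borel_measurable (lebesgue_on \<Omega>)" "AE x in lebesgue_on \<Omega>. \<bar>g x\<bar> \<le> B" and f: "f \<in> L2 \<Omega>"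
  shows "(\<lambda>x. g x *\<^sub>R f x) \<in> L2 \<Omega>"
proof -
  have "integrable (lebesgue_on \<Omega>) (\<lambda>x. (norm (g x *\<^sub>R f x))\<^sup>2)"
  proof (rule Bochner_Integration.integrable_bound)
    show "integrable (lebesgue_on \<Omega>) (\<lambda>x. B\<^sup>2 * (norm (f x))\<^sup>2)"
      using f by (auto simp: L2_def)
    show "AE x in lebesgue_on \<Omega>. norm ((norm (g x *\<^sub>R f x))\<^sup>2) \<le> norm (B\<^sup>2 * (norm (f x))\<^sup>2)"
      using g(2)
    proof eventually_elim
      case (elim x)
      then have "(g x)\<^sup>2 \<le> B\<^sup>2" by (metis abs_ge_zero power2_abs power_mono)
      then show ?case by (simp add: power_mult_distrib mult_right_mono)
    qed
  qed (use f g in \<open>auto simp: L2_def\<close>)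
  with f g show ?thesis by (auto simp: L2_def)
qed

lemma L2_scaleR: "f \<in> L2 \<Omega> \<Longrightarrow> (\<lambda>x. c *\<^sub>R f x) \<in> L2 \<Omega>"
  by (rule L2_bounded_scaleR[where B = "\<bar>c\<bar>"]) auto

lemma L2_add:
  assumes f: "f \<in> L2 \<Omega>" and g: "g \<in> L2 \<Omega>"
  shows "(\<lambda>x. f x + g x) \<in> L2 \<Omega>"
proof -
  have "(norm (a + b))\<^sup>2 = (norm a)\<^sup>2 + 2 * (a \<bullet> b) + (norm b)\<^sup>2" for a b :: 'b
    by (simp add: power2_norm_eq_inner inner_add_left inner_add_right inner_commute)
  then show ?thesis
    using f g integrable_inner_L2[OF f g] by (auto simp: L2_def)
qed

lemma L2_diff: "f \<in> L2 \<Omega> \<Longrightarrow> g \<in> L2 \<Omega> \<Longrightarrow> (\<lambda>x. f x - g x) \<in> L2 \<Omega>"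
  using L2_add[of f \<Omega> "\<lambda>x. (-1) *\<^sub>R g x"] L2_scaleR[of g \<Omega> "-1"] by simp

lemma L2_mult: "f \<in> L2 \<Omega> \<Longrightarrow> (\<lambda>x. c * f x) \<in> L2 \<Omega>" for c :: real
  using L2_scaleR[of f \<Omega> c] by simp

lemma L2_zero: "(\<lambda>x. 0) \<in> L2 \<Omega>"
  by (simp add: L2_def)

lemma L2_sum:
  assumes "\<And>i. i \<in> I \<Longrightarrow> f i \<in> L2 \<Omega>"
  shows "(\<lambda>x. \<Sum>i\<in>I. f i x) \<in> L2 \<Omega>"
  using assms
proof (induction I rule: infinite_finite_induct)
  case (insert a I)
  then show ?case using L2_add[of "f a" \<Omega> "\<lambda>x. \<Sum>i\<in>I. f i x"] by simp
qed (simp_all add: L2_zero)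

lemma L2_dominated:
  assumes "f \<in> borel_measurable (lebesgue_on \<Omega>)" "g \<in> L2 \<Omega>" "\<And>x. norm (f x) \<le> norm (g x)"
  shows "f \<in> L2 \<Omega>"
proof -
  have "integrable (lebesgue_on \<Omega>) (\<lambda>x. (norm (f x))\<^sup>2)"
    by (rule Bochner_Integration.integrable_bound[where f = "\<lambda>x. (norm (g x))\<^sup>2"])
      (use assms in \<open>auto simp: L2_def intro!: AE_I2 power_mono\<close>)
  with assms show ?thesis by (simp add: L2_def)
qed

lemma L2_vec:
  fixes f :: "real^'d \<Rightarrow> 'b::euclidean_space^'n"
  assumes f: "\<And>i. (\<lambda>x. f x $ i) \<in> L2 \<Omega>"
  shows "f \<in> L2 \<Omega>"
proof -
  have "(\<lambda>x. f x $ i \<bullet> b) \<in> borel_measurable (lebesgue_on \<Omega>)" for i b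
    using L2_measurable[OF f[of i]] by simp
  then have "f \<in> borel_measurable (lebesgue_on \<Omega>)"
    unfolding borel_measurable_euclidean_space[of f] by (auto simp: Basis_vec_def inner_axis)
  moreover have "integrable (lebesgue_on \<Omega>) (\<lambda>x. \<Sum>i\<in>UNIV. (norm (f x $ i))\<^sup>2)"
    using f by (auto simp: L2_def)
  ultimately show ?thesis
    by (simp add: L2_def norm_vec_def L2_set_def sum_nonneg)
qed

lemma L2_nth:
  fixes f :: "real^'d \<Rightarrow> 'b::euclidean_space^'n"
  assumes f: "f \<in> L2 \<Omega>"
  shows "(\<lambda>x. f x $ i) \<in> L2 \<Omega>"
proof (rule L2_dominated[OF _ f])
  have "(\<lambda>x. f x $ i \<bullet> b) = (\<lambda>x. f x \<bullet> axis i b)" for b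
    by (simp add: inner_axis)
  then show "(\<lambda>x. f x $ i) \<in> borel_measurable (lebesgue_on \<Omega>)"
    unfolding borel_measurable_euclidean_space[of "\<lambda>x. f x $ i"]
    using f by (auto simp: L2_def)
qed (rule Finite_Cartesian_Product.norm_nth_le)

lemma L2_const: "\<Omega> \<in> lmeasurable \<Longrightarrow> (\<lambda>x. c) \<in> L2 \<Omega>"
  by (simp add: L2_def finite_measure.integrable_const finite_measure_lebesgue_on)

lemma integrable_L2:
  assumes "\<Omega> \<in> lmeasurable" "f \<in> L2 \<Omega>"
  shows "integrable (lebesgue_on \<Omega>) f"
proof -
  have "integrable (lebesgue_on \<Omega>) (\<lambda>x. (f x \<bullet> b) *\<^sub>R b)" for b
    using integrable_inner_L2[OF assms(2) L2_const[OF assms(1), of b]] by auto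
  then have "integrable (lebesgue_on \<Omega>) (\<lambda>x. \<Sum>b\<in>Basis. (f x \<bullet> b) *\<^sub>R b)"
    by auto
  then show ?thesis by (simp add: euclidean_representation)
qed

lemma ip_commute: "ip \<Omega> f g = ip \<Omega> g f"
  by (simp add: ip_def inner_commute)

lemma ip_add_left: "f \<in> L2 \<Omega> \<Longrightarrow> g \<in> L2 \<Omega> \<Longrightarrow> h \<in> L2 \<Omega> \<Longrightarrow> ip \<Omega> (\<lambda>x. f x + g x) h = ip \<Omega> f h + ip \<Omega> g h"
  by (simp add: ip_def inner_add_left integrable_inner_L2)

lemma ip_diff_left: "f \<in> L2 \<Omega> \<Longrightarrow> g \<in> L2 \<Omega> \<Longrightarrow> h \<in> L2 \<Omega> \<Longrightarrow> ip \<Omega> (\<lambda>x. f x - g x) h = ip \<Omega> f h - ip \<Omega> g h"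
  by (simp add: ip_def inner_diff_left integrable_inner_L2)

lemma ip_scaleR_left: "ip \<Omega> (\<lambda>x. c *\<^sub>R f x) g = c * ip \<Omega> f g"
  by (simp add: ip_def)

lemma ip_add_right: "f \<in> L2 \<Omega> \<Longrightarrow> g \<in> L2 \<Omega> \<Longrightarrow> h \<in> L2 \<Omega> \<Longrightarrow> ip \<Omega> h (\<lambda>x. f x + g x) = ip \<Omega> h f + ip \<Omega> h g"
  by (simp add: ip_def inner_add_right integrable_inner_L2)

lemma ip_diff_right: "f \<in> L2 \<Omega> \<Longrightarrow> g \<in> L2 \<Omega> \<Longrightarrow> h \<in> L2 \<Omega> \<Longrightarrow> ip \<Omega> h (\<lambda>x. f x - g x) = ip \<Omega> h f - ip \<Omega> h g"
  by (simp add: ip_def inner_diff_right integrable_inner_L2)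

lemma ip_scaleR_right: "ip \<Omega> f (\<lambda>x. c *\<^sub>R g x) = c * ip \<Omega> f g"
  by (simp add: ip_def)

lemmas ip_linear = ip_add_left ip_diff_left ip_scaleR_left ip_add_right ip_diff_right ip_scaleR_right
lemmas L2_linear = L2_add L2_diff L2_scaleR

lemma ip_nonneg: "0 \<le> ip \<Omega> f f"
  by (simp add: ip_def)

lemma nrm_sq: "(nrm \<Omega> f)\<^sup>2 = ip \<Omega> f f"
  by (simp add: nrm_def ip_nonneg)

text \<open>Exchanges representatives of weak and discrete gradients inside an inner product;
  membership in \<open>L2\<close> supplies the measurability.\<close>

lemma ip_cong_AE:
  assumes "f \<in> L2 \<Omega>" "f' \<in> L2 \<Omega>" "g \<in> L2 \<Omega>" "g' \<in> L2 \<Omega>" "aeq \<Omega> f f'" "aeq \<Omega> g g'"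
  shows "ip \<Omega> f g = ip \<Omega> f' g'"
  unfolding ip_def
proof (rule integral_cong_AE)
  show "AE x in lebesgue_on \<Omega>. f x \<bullet> g x = f' x \<bullet> g' x"
    using assms(5,6) unfolding aeq_def by eventually_elim simp
qed (use assms in \<open>auto simp: L2_def\<close>)

lemma ip_self_eq_0:
  assumes "f \<in> L2 \<Omega>" "ip \<Omega> f f = 0" shows "aeq \<Omega> f (\<lambda>x. 0)"
proof -
  have "AE x in lebesgue_on \<Omega>. f x \<bullet> f x = 0"
    using integral_nonneg_eq_0_iff_AE[OF integrable_inner_L2[OF assms(1,1)]] assms(2)
    by (simp add: ip_def)
  then show ?thesis by (simp add: aeq_def)
qed

section \<open>Fundamental lemma of the calculus of variations\<close>

text \<open>A C1 approximation of the indicator of the positive half-line: squaring the positive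
  part removes the kink at 0, and the saturating quotient tends to 1 wherever \<open>t\<close> is
  positive.\<close>

definition cutoff :: "nat \<Rightarrow> real \<Rightarrow> real" where
  "cutoff k t = real k * (max 0 t)\<^sup>2 / (1 + real k * (max 0 t)\<^sup>2)"

lemma cutoff_bounds: "0 \<le> cutoff k t" "cutoff k t \<le> 1" "t \<le> 0 \<Longrightarrow> cutoff k t = 0"
proof -
  have "0 < 1 + real k * (max 0 t)\<^sup>2" by (intro add_pos_nonneg) auto
  then show "0 \<le> cutoff k t" "cutoff k t \<le> 1" "t \<le> 0 \<Longrightarrow> cutoff k t = 0"
    by (auto simp: cutoff_def field_simps)
qed

lemma cutoff_tendsto: "(\<lambda>k. cutoff k t) \<longlonglongrightarrow> indicator {0<..} t"
proof (cases "0 < t")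
  case True
  define c where "c = t\<^sup>2"
  have c: "0 < c" using True by (simp add: c_def)
  have "filterlim (\<lambda>k. c * real k) at_top sequentially"
    by (rule filterlim_tendsto_pos_mult_at_top[OF tendsto_const c filterlim_real_sequentially])
  then have "filterlim (\<lambda>k. 1 + real k * c) at_infinity sequentially"
    by (intro filterlim_at_top_imp_at_infinity filterlim_tendsto_add_at_top[OF tendsto_const])
      (simp add: mult.commute)
  then have "(\<lambda>k. 1 - 1 / (1 + real k * c)) \<longlonglongrightarrow> 1 - 0"
    by (intro tendsto_diff tendsto_const tendsto_divide_0[OF tendsto_const])
  moreover have "1 - 1 / (1 + real k * c) = cutoff k t" for k
  proof -
    have "0 < 1 + real k * c" using c by (intro add_pos_nonneg) auto
    then show ?thesis using True by (simp add: cutoff_def c_def field_simps)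
  qed
  ultimately show ?thesis using True by simp
next
  case False
  then show ?thesis by (simp add: cutoff_bounds(3))
qed

lemma DERIV_max_sq: "((\<lambda>t. (max 0 t)\<^sup>2) has_real_derivative 2 * max 0 t) (at t)"
proof (cases t "0 :: real" rule: linorder_cases)
  case less
  have "((\<lambda>t. 0 :: real) has_real_derivative 0) (at t)" by simp
  then have "((\<lambda>t. (max 0 t)\<^sup>2) has_real_derivative 0) (at t)"
    by (rule has_field_derivative_transform_within_open[where S = "{..<0}"]) (use less in auto)
  with less show ?thesis by simp
next
  case equal
  have "(\<lambda>h::real. ((max 0 h)\<^sup>2) / h) \<midarrow>0\<rightarrow> 0"
  proof (rule Lim_null_comparison[where g = "\<lambda>h. \<bar>h\<bar>"])
    show "\<forall>\<^sub>F h in at 0. norm ((max 0 h)\<^sup>2 / h) \<le> \<bar>h\<bar>"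
      by (rule always_eventually) (auto simp: max_def power2_eq_square)
    show "(\<lambda>h::real. \<bar>h\<bar>) \<midarrow>0\<rightarrow> 0" by (rule tendsto_rabs_zero) simp
  qed
  with equal show ?thesis by (simp add: has_field_derivative_iff)
next
  case greater
  have "((\<lambda>t. t\<^sup>2) has_real_derivative 2 * t) (at t)" by (auto intro!: derivative_eq_intros)
  then have "((\<lambda>t. (max 0 t)\<^sup>2) has_real_derivative 2 * t) (at t)"
    by (rule has_field_derivative_transform_within_open[where S = "{0<..}"]) (use greater in auto)
  with greater show ?thesis by simp
qed

text \<open>The smoothness half of \<open>test_function\<close>. It is closed under products, so a
  bump can be assembled from one-dimensional cutoffs before its support is considered.\<close>

definition C1_grad :: "(real^'d::finite \<Rightarrow> real) \<Rightarrow> (real^'d \<Rightarrow> real^'d) \<Rightarrow> bool" where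
  "C1_grad f f' \<longleftrightarrow> (\<forall>x. GDERIV f x :> f' x) \<and> continuous_on UNIV f'"

lemma C1_grad_continuous: "C1_grad f f' \<Longrightarrow> continuous_on UNIV f"
  unfolding C1_grad_def gderiv_def
  by (meson continuous_at_imp_continuous_on has_derivative_continuous)

lemma C1_grad_mult:
  assumes "C1_grad f f'" "C1_grad g g'"
  shows "C1_grad (\<lambda>x. f x * g x) (\<lambda>x. f x *\<^sub>R g' x + g x *\<^sub>R f' x)"
  using assms assms[THEN C1_grad_continuous]
  by (auto simp: C1_grad_def intro!: GDERIV_mult continuous_intros)

lemma C1_grad_prod:
  assumes "finite I" "\<And>i. i \<in> I \<Longrightarrow> \<exists>f'. C1_grad (f i) f'"
  shows "\<exists>f'. C1_grad (\<lambda>x. \<Prod>i\<in>I. f i x) f'"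
  using assms
proof (induction I rule: finite_induct)
  case empty
  have "C1_grad (\<lambda>x. 1) (\<lambda>x. 0)" by (simp add: C1_grad_def GDERIV_const)
  then show ?case by auto
next
  case (insert a I)
  then obtain f' g' where "C1_grad (f a) f'" "C1_grad (\<lambda>x. \<Prod>i\<in>I. f i x) g'" by blast
  from C1_grad_mult[OF this] show ?case using insert.hyps by auto
qed

lemma C1_grad_cutoff:
  fixes c :: "real^'d"
  shows "\<exists>f'. C1_grad (\<lambda>x. cutoff k (x \<bullet> c + e)) f'"
proof -
  let ?d = "\<lambda>t. (real k * (2 * max 0 t)) / (1 + real k * (max 0 t)\<^sup>2)\<^sup>2"
  have pos: "1 + real k * (max 0 t)\<^sup>2 \<noteq> 0" for t
    by (smt (verit) of_nat_0_le_iff mult_nonneg_nonneg zero_le_power2)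
  have d: "(cutoff k has_real_derivative ?d t) (at t)" for t
    unfolding cutoff_def
    by (rule derivative_eq_intros DERIV_max_sq refl pos)+ (use pos in \<open>simp add: power2_eq_square algebra_simps\<close>)
  have "GDERIV (\<lambda>x. x \<bullet> c + e) x :> c" for x
    by (auto simp: gderiv_def inner_commute intro!: derivative_eq_intros)
  then have "GDERIV (\<lambda>x. cutoff k (x \<bullet> c + e)) x :> ?d (x \<bullet> c + e) *\<^sub>R c" for x
    by (rule GDERIV_DERIV_compose[OF _ d])
  moreover have "continuous_on UNIV (\<lambda>x. ?d (x \<bullet> c + e) *\<^sub>R c)"
    by (intro continuous_intros) (use pos in auto)
  ultimately show ?thesis unfolding C1_grad_def by (intro exI conjI allI)
qed

definition bump :: "nat \<Rightarrow> real^'d \<Rightarrow> real^'d \<Rightarrow> real^'d::finite \<Rightarrow> real" where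
  "bump k a b x = (\<Prod>i\<in>UNIV. cutoff k (x $ i - a $ i) * cutoff k (b $ i - x $ i))"

lemma bump_bounds: "0 \<le> bump k a b x" "bump k a b x \<le> 1"
  unfolding bump_def
  by (intro prod_nonneg prod_le_1 conjI mult_nonneg_nonneg mult_le_one ballI cutoff_bounds)+

lemma bump_tendsto: "(\<lambda>k. bump k a b x) \<longlonglongrightarrow> indicator (box a b) x"
proof -
  have "(\<lambda>k. bump k a b x) \<longlonglongrightarrow> (\<Prod>i\<in>UNIV. indicator {0<..} (x $ i - a $ i) * indicator {0<..} (b $ i - x $ i))"
    unfolding bump_def by (intro tendsto_prod tendsto_mult cutoff_tendsto)
  also have "(\<Prod>i\<in>UNIV. indicator {0<..} (x $ i - a $ i) * indicator {0<..} (b $ i - x $ i) :: real)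
      = indicator (box a b) x"
    by (auto simp: indicator_def mem_box_cart split: if_splits)
  finally show ?thesis .
qed

text \<open>The bump vanishes outside the open box, but its support may reach the faces; hence the
  closed box has to lie in \<open>\<Omega>\<close>.\<close>

lemma test_function_bump:
  fixes a b :: "real^'d"
  assumes "cbox a b \<subseteq> \<Omega>"
  shows "\<exists>\<psi>'. test_function \<Omega> (bump k a b) \<psi>'"
proof -
  have "\<exists>f'. C1_grad (\<lambda>x. cutoff k (x $ i - a $ i) * cutoff k (b $ i - x $ i)) f'" for i
    using C1_grad_cutoff[of k "axis i 1" "- a $ i"] C1_grad_cutoff[of k "- axis i 1" "b $ i"]
    by (simp add: inner_axis) (use C1_grad_mult in blast)
  then have "\<exists>f'. C1_grad (bump k a b) f'"
    unfolding bump_def[abs_def] by (intro C1_grad_prod) auto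
  moreover have sub: "closure {x. bump k a b x \<noteq> 0} \<subseteq> cbox a b"
  proof (rule closure_minimal)
    show "{x. bump k a b x \<noteq> 0} \<subseteq> cbox a b"
      unfolding bump_def by (auto simp: mem_box_cart) (meson cutoff_bounds(3) diff_ge_0_iff_ge diff_le_0_iff_le linorder_linear)+
  qed (rule closed_cbox)
  moreover have "compact (closure {x. bump k a b x \<noteq> 0})"
    using sub by (meson bounded_cbox bounded_subset closed_closure compact_eq_bounded_closed)
  ultimately show ?thesis
    using assms by (auto simp: test_function_def C1_grad_def)
qed

text \<open>Dominated convergence along the bumps turns the hypothesis into a vanishing integral
  over every closed box inside \<open>\<Omega>\<close>; Lebesgue differentiation over shrinking
  cubes then recovers \<open>g\<close> almost everywhere.\<close>

lemma fundamental_lemma_calculus_of_variations: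
  fixes g :: "real^'d \<Rightarrow> 'b::euclidean_space"
  assumes \<Omega>: "open \<Omega>" "bounded \<Omega>" and g: "g \<in> L2 \<Omega>"
    and 0: "\<And>\<psi> \<psi>'. test_function \<Omega> \<psi> \<psi>' \<Longrightarrow> (LINT x|lebesgue_on \<Omega>. \<psi> x *\<^sub>R g x) = 0"
  shows "aeq \<Omega> g (\<lambda>x. 0)"
proof -
  \<comment> \<open>Differentiation is applied on the whole space, hence the extension by
    zero.\<close>
  let ?G = "\<lambda>x. indicator \<Omega> x *\<^sub>R g x"
  have lm: "\<Omega> \<in> lmeasurable" using \<Omega> by (simp add: lmeasurable_open)
  then have sl: "\<Omega> \<in> sets lebesgue" by auto
  have gi: "integrable (lebesgue_on \<Omega>) g" by (rule integrable_L2[OF lm g])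
  have Gi: "integrable lebesgue ?G"
    using gi sl by (simp add: integrable_restrict_space)
  have Gon: "?G integrable_on cbox a b" for a b
    using integrable_on_lebesgue[OF Gi] integrable_on_subcbox[of ?G UNIV a b] by simp
  have box0: "integral (cbox a b) ?G = 0" if ab: "cbox a b \<subseteq> \<Omega>" for a b
  proof -
    have "(\<lambda>k. LINT x|lebesgue_on \<Omega>. bump k a b x *\<^sub>R g x) \<longlonglongrightarrow> (LINT x|lebesgue_on \<Omega>. indicator (box a b) x *\<^sub>R g x)"
    proof (rule integral_dominated_convergence[where w = "\<lambda>x. norm (g x)"])
      show "(\<lambda>x. bump k a b x *\<^sub>R g x) \<in> borel_measurable (lebesgue_on \<Omega>)" for k
      proof -
        obtain \<psi>' where "test_function \<Omega> (bump k a b) \<psi>'" using test_function_bump[OF ab] by blast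
        then have "continuous_on UNIV (bump k a b)"
          using C1_grad_continuous by (auto simp: test_function_def C1_grad_def)
        then have "bump k a b \<in> borel_measurable (lebesgue_on \<Omega>)"
          by (intro measurable_restrict_space1 measurable_completion) (simp add: borel_measurable_continuous_onI)
        then show ?thesis using gi by auto
      qed
      show "AE x in lebesgue_on \<Omega>. (\<lambda>k. bump k a b x *\<^sub>R g x) \<longlonglongrightarrow> indicator (box a b) x *\<^sub>R g x"
        by (intro AE_I2 tendsto_scaleR bump_tendsto tendsto_const)
      show "AE x in lebesgue_on \<Omega>. norm (bump k a b x *\<^sub>R g x) \<le> norm (g x)" for k
        using bump_bounds[of k a b] by (auto intro!: AE_I2 mult_left_le_one_le)
      have "(indicator (box a b) :: _ \<Rightarrow> real) \<in> borel_measurable (lebesgue_on \<Omega>)"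
        by (intro measurable_restrict_space1 measurable_completion) simp
      then show "(\<lambda>x. indicator (box a b) x *\<^sub>R g x) \<in> borel_measurable (lebesgue_on \<Omega>)"
        using gi by auto
      show "integrable (lebesgue_on \<Omega>) (\<lambda>x. norm (g x))" using gi by simp
    qed
    moreover have "(LINT x|lebesgue_on \<Omega>. bump k a b x *\<^sub>R g x) = 0" for k
      using test_function_bump[OF ab] 0 by blast
    ultimately have "(LINT x|lebesgue_on \<Omega>. indicator (box a b) x *\<^sub>R g x) = 0"
      by (simp add: LIMSEQ_const_iff)
    moreover have "(LINT x|lebesgue_on \<Omega>. indicator (box a b) x *\<^sub>R g x) = (LINT x:box a b|lebesgue. ?G x)"
      using sl by (simp add: integral_restrict_space set_lebesgue_integral_def mult.commute)
    moreover have "set_integrable lebesgue (box a b) ?G"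
      unfolding set_integrable_def by (intro integrable_mult_indicator Gi) simp
    ultimately have "integral (box a b) ?G = 0"
      by (simp add: set_lebesgue_integral_eq_integral(2))
    then show ?thesis by (simp add: integral_open_interval)
  qed
  obtain N where N: "negligible N" "\<And>x e. \<lbrakk>x \<notin> N; 0 < e\<rbrakk> \<Longrightarrow>
      \<exists>d>0. \<forall>h. 0 < h \<and> h < d \<longrightarrow> norm (integral (cbox x (x + h *\<^sub>R One)) ?G /\<^sub>R h ^ DIM(real^'d) - ?G x) < e"
  proof (rule integrable_ccontinuous_explicit[OF Gon], goal_cases)
    case (1 N)
    from 1(1)[OF 1(2,3)] show ?case .
  qed
  \<comment> \<open>At a Lebesgue point, \<open>g\<close> is the limit of its averages over small boxes.\<close>
  have "g x = 0" if x: "x \<in> \<Omega>" "x \<notin> N" for x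
  proof (rule ccontr)
    assume "g x \<noteq> 0"
    \<comment> \<open>A zero average lies at distance exactly \<open>norm (g x)\<close> from
      \<open>g x\<close>, so this tolerance leads to the contradiction.\<close>
    then obtain d where d: "d > 0" "\<And>h. 0 < h \<Longrightarrow> h < d \<Longrightarrow>
        norm (integral (cbox x (x + h *\<^sub>R One)) ?G /\<^sub>R h ^ DIM(real^'d) - ?G x) < norm (g x)"
      using N(2)[OF x(2), of "norm (g x)"] by auto
    obtain r where r: "r > 0" "ball x r \<subseteq> \<Omega>" using \<Omega>(1) x(1) openE by blast
    \<comment> \<open>The first bound keeps \<open>h\<close> below \<open>d\<close>. The second fits
      the cube with corner \<open>x\<close> into the ball: in the 1-norm its points are at most
      \<open>DIM * h\<close> away from \<open>x\<close>, hence at most r/2.\<close>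
    define h where "h = min (d / 2) (r / (2 * DIM(real^'d)))"
    have D: "0 < real (DIM(real^'d))" using DIM_positive by simp
    then have h: "0 < h" "h < d" using d r by (auto simp: h_def)
    have "h * DIM(real^'d) \<le> r / 2"
    proof -
      have "h \<le> r / (2 * DIM(real^'d))" by (simp add: h_def)
      with D show ?thesis by (simp add: field_simps)
    qed
    then have hr: "DIM(real^'d) * h < r" using r by (simp add: mult.commute)
    have "cbox x (x + h *\<^sub>R One) \<subseteq> \<Omega>"
    proof
      fix y assume y: "y \<in> cbox x (x + h *\<^sub>R One)"
      have "norm (y - x) \<le> (\<Sum>b\<in>Basis. \<bar>(y - x) \<bullet> b\<bar>)" by (rule norm_le_l1)
      also have "\<dots> \<le> (\<Sum>b\<in>(Basis :: (real^'d) set). h)"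
      proof (rule sum_mono)
        fix b :: "real^'d" assume b: "b \<in> Basis"
        then have "x \<bullet> b \<le> y \<bullet> b" "y \<bullet> b \<le> x \<bullet> b + h"
          using y by (auto simp: mem_box inner_add_left inner_scaleR_left inner_sum_left_Basis)
        then show "\<bar>(y - x) \<bullet> b\<bar> \<le> h" by (simp add: inner_diff_left)
      qed
      also have "\<dots> = DIM(real^'d) * h" by (simp only: sum_constant)
      finally show "y \<in> \<Omega>" using hr r by (auto simp: dist_norm norm_minus_commute)
    qed
    from box0[OF this] d(2)[OF h] x(1) show False by simp
  qed
  then have "AE x in lebesgue. x \<in> \<Omega> \<longrightarrow> g x = 0"
    using N(1) by (intro AE_I'[of N]) (auto simp: negligible_iff_null_sets)
  then show ?thesis
    unfolding aeq_def using sl by (simp add: AE_restrict_space_iff)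
qed

section \<open>Weak gradients\<close>

lemma integrable_scaleR_L2:
  fixes u :: "real^'d \<Rightarrow> real"
  assumes u: "u \<in> L2 \<Omega>" and f: "f \<in> L2 \<Omega>"
  shows "integrable (lebesgue_on \<Omega>) (\<lambda>x. u x *\<^sub>R f x)"
proof (rule Bochner_Integration.integrable_bound)
  have "(\<lambda>x. norm (f x)) \<in> L2 \<Omega>" "(\<lambda>x. norm (u x)) \<in> L2 \<Omega>" using u f by (auto simp: L2_def)
  from integrable_inner_L2[OF this] show "integrable (lebesgue_on \<Omega>) (\<lambda>x. norm (f x) * norm (u x))"
    by simp
qed (use u f in \<open>auto simp: L2_def\<close>)

lemma continuous_bounded_L2:
  fixes f :: "real^'d \<Rightarrow> 'b::euclidean_space"
  assumes \<Omega>: "open \<Omega>" "bounded \<Omega>" and f: "continuous_on UNIV f"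
  shows "f \<in> L2 \<Omega>"
proof -
  have lm: "\<Omega> \<in> lmeasurable" using \<Omega> by (simp add: lmeasurable_open)
  have "compact (f ` closure \<Omega>)"
    using \<Omega> f by (intro compact_continuous_image) (auto intro: continuous_on_subset)
  then obtain B where B: "\<And>x. x \<in> \<Omega> \<Longrightarrow> norm (f x) \<le> B"
    using closure_subset[of \<Omega>] by (fastforce dest: compact_imp_bounded simp: bounded_iff)
  have m: "f \<in> borel_measurable (lebesgue_on \<Omega>)"
    by (intro measurable_restrict_space1 measurable_completion) (simp add: borel_measurable_continuous_onI f)
  have "integrable (lebesgue_on \<Omega>) (\<lambda>x. (norm (f x))\<^sup>2)"
  proof (rule Bochner_Integration.integrable_bound)
    show "integrable (lebesgue_on \<Omega>) (\<lambda>x. B\<^sup>2)"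
      by (rule finite_measure.integrable_const[OF finite_measure_lebesgue_on[OF lm]])
    show "AE x in lebesgue_on \<Omega>. norm ((norm (f x))\<^sup>2) \<le> norm (B\<^sup>2)"
      using B lm by (intro AE_I2) (auto intro!: power_mono)
  qed (use m in auto)
  with m show ?thesis by (simp add: L2_def)
qed

lemma test_function_L2:
  assumes "open \<Omega>" "bounded \<Omega>" "test_function \<Omega> \<psi> \<psi>'"
  shows "\<psi> \<in> L2 \<Omega>" "\<psi>' \<in> L2 \<Omega>"
  using assms C1_grad_continuous[of \<psi> \<psi>']
  by (auto simp: test_function_def C1_grad_def intro!: continuous_bounded_L2)

lemma weak_grad_linear:
  fixes u v :: "real^'d \<Rightarrow> real"
  assumes \<Omega>: "open \<Omega>" "bounded \<Omega>"
    and L2: "u \<in> L2 \<Omega>" "v \<in> L2 \<Omega>" "g \<in> L2 \<Omega>" "h \<in> L2 \<Omega>"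
    and w: "weak_grad \<Omega> u g" "weak_grad \<Omega> v h"
  shows "weak_grad \<Omega> (\<lambda>x. c * u x + e * v x) (\<lambda>x. c *\<^sub>R g x + e *\<^sub>R h x)"
  unfolding weak_grad_def
proof (intro allI impI)
  fix \<psi> \<psi>' assume t: "test_function \<Omega> \<psi> \<psi>'"
  note \<psi> = test_function_L2[OF \<Omega> t]
  have i: "integrable (lebesgue_on \<Omega>) (\<lambda>x. u x *\<^sub>R \<psi>' x)" "integrable (lebesgue_on \<Omega>) (\<lambda>x. v x *\<^sub>R \<psi>' x)"
    "integrable (lebesgue_on \<Omega>) (\<lambda>x. \<psi> x *\<^sub>R g x)" "integrable (lebesgue_on \<Omega>) (\<lambda>x. \<psi> x *\<^sub>R h x)"
    using L2 \<psi> by (simp_all add: integrable_scaleR_L2)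
  have "(LINT x|lebesgue_on \<Omega>. (c * u x + e * v x) *\<^sub>R \<psi>' x)
      = (LINT x|lebesgue_on \<Omega>. c *\<^sub>R (u x *\<^sub>R \<psi>' x) + e *\<^sub>R (v x *\<^sub>R \<psi>' x))"
    by (simp add: algebra_simps)
  also have "\<dots> = c *\<^sub>R (LINT x|lebesgue_on \<Omega>. u x *\<^sub>R \<psi>' x) + e *\<^sub>R (LINT x|lebesgue_on \<Omega>. v x *\<^sub>R \<psi>' x)"
    using i by (simp del: scaleR_scaleR)
  also have "\<dots> = - (c *\<^sub>R (LINT x|lebesgue_on \<Omega>. \<psi> x *\<^sub>R g x) + e *\<^sub>R (LINT x|lebesgue_on \<Omega>. \<psi> x *\<^sub>R h x))"
    using w t by (simp add: weak_grad_def)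
  also have "\<dots> = - (LINT x|lebesgue_on \<Omega>. c *\<^sub>R (\<psi> x *\<^sub>R g x) + e *\<^sub>R (\<psi> x *\<^sub>R h x))"
    using i by (simp del: scaleR_scaleR)
  also have "\<dots> = - (LINT x|lebesgue_on \<Omega>. \<psi> x *\<^sub>R (c *\<^sub>R g x + e *\<^sub>R h x))"
    by (simp add: algebra_simps)
  finally show "(LINT x|lebesgue_on \<Omega>. (c * u x + e * v x) *\<^sub>R \<psi>' x)
      = - (LINT x|lebesgue_on \<Omega>. \<psi> x *\<^sub>R (c *\<^sub>R g x + e *\<^sub>R h x))" .
qed

lemma weak_grad_unique:
  assumes \<Omega>: "open \<Omega>" "bounded \<Omega>" and L2: "g \<in> L2 \<Omega>" "h \<in> L2 \<Omega>"
    and w: "weak_grad \<Omega> u g" "weak_grad \<Omega> u h"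
  shows "aeq \<Omega> g h"
proof -
  have "aeq \<Omega> (\<lambda>x. g x - h x) (\<lambda>x. 0)"
  proof (rule fundamental_lemma_calculus_of_variations[OF \<Omega> L2_diff[OF L2]])
    fix \<psi> \<psi>' assume t: "test_function \<Omega> \<psi> \<psi>'"
    have "integrable (lebesgue_on \<Omega>) (\<lambda>x. \<psi> x *\<^sub>R g x)" "integrable (lebesgue_on \<Omega>) (\<lambda>x. \<psi> x *\<^sub>R h x)"
      using L2 test_function_L2[OF \<Omega> t] by (simp_all add: integrable_scaleR_L2)
    then have "(LINT x|lebesgue_on \<Omega>. \<psi> x *\<^sub>R (g x - h x))
        = (LINT x|lebesgue_on \<Omega>. \<psi> x *\<^sub>R g x) - (LINT x|lebesgue_on \<Omega>. \<psi> x *\<^sub>R h x)"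
      by (simp add: scaleR_diff_right)
    also have "\<dots> = 0"
      using w(1)[unfolded weak_grad_def, rule_format, OF t] w(2)[unfolded weak_grad_def, rule_format, OF t]
      by simp
    finally show "(LINT x|lebesgue_on \<Omega>. \<psi> x *\<^sub>R (g x - h x)) = 0" .
  qed
  then show ?thesis by (simp add: aeq_def)
qed

lemma grad_H1:
  assumes "u \<in> H1 \<Omega>"
  shows "grad \<Omega> u \<in> L2 \<Omega>" "weak_grad \<Omega> u (grad \<Omega> u)"
proof -
  have "\<exists>g. g \<in> L2 \<Omega> \<and> weak_grad \<Omega> u g" using assms by (auto simp: H1_def)
  then have "grad \<Omega> u \<in> L2 \<Omega> \<and> weak_grad \<Omega> u (grad \<Omega> u)"
    unfolding grad_def by (rule someI_ex)
  then show "grad \<Omega> u \<in> L2 \<Omega>" "weak_grad \<Omega> u (grad \<Omega> u)" by auto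
qed

lemma H1_L2: "u \<in> H1 \<Omega> \<Longrightarrow> u \<in> L2 \<Omega>"
  by (simp add: H1_def)

text \<open>\<open>grad\<close> selects some weak gradient by \<open>SOME\<close>, so linearity can
  hold only almost everywhere. It holds because the combination of the two gradients is a weak
  gradient of the combination, and weak gradients are unique up to null sets.\<close>

lemma
  fixes u v :: "real^'d \<Rightarrow> real"
  assumes \<Omega>: "open \<Omega>" "bounded \<Omega>" and u: "u \<in> H1 \<Omega>" and v: "v \<in> H1 \<Omega>"
  shows H1_linear: "(\<lambda>x. c * u x + e * v x) \<in> H1 \<Omega>"
    and grad_linear: "aeq \<Omega> (grad \<Omega> (\<lambda>x. c * u x + e * v x)) (\<lambda>x. c *\<^sub>R grad \<Omega> u x + e *\<^sub>R grad \<Omega> v x)"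
proof -
  note w = weak_grad_linear[OF \<Omega> H1_L2[OF u] H1_L2[OF v] grad_H1(1)[OF u] grad_H1(1)[OF v]
      grad_H1(2)[OF u] grad_H1(2)[OF v], of c e]
  have l: "(\<lambda>x. c *\<^sub>R grad \<Omega> u x + e *\<^sub>R grad \<Omega> v x) \<in> L2 \<Omega>"
    using grad_H1(1)[OF u] grad_H1(1)[OF v] by (intro L2_linear)
  have "(\<lambda>x. c * u x + e * v x) \<in> L2 \<Omega>"
    using H1_L2[OF u] H1_L2[OF v] by (intro L2_add L2_mult)
  with w l show h: "(\<lambda>x. c * u x + e * v x) \<in> H1 \<Omega>" by (auto simp: H1_def)
  show "aeq \<Omega> (grad \<Omega> (\<lambda>x. c * u x + e * v x)) (\<lambda>x. c *\<^sub>R grad \<Omega> u x + e *\<^sub>R grad \<Omega> v x)"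
    by (rule weak_grad_unique[OF \<Omega> grad_H1(1)[OF h] l grad_H1(2)[OF h] w])
qed

lemma jac_L2: "v \<in> H1v \<Omega> \<Longrightarrow> jac \<Omega> v \<in> L2 \<Omega>"
  by (rule L2_vec) (simp add: jac_def H1v_def grad_H1)

lemma H1v_L2: "v \<in> H1v \<Omega> \<Longrightarrow> v \<in> L2 \<Omega>"
  by (intro L2_vec) (simp add: H1v_def H1_L2)

lemma divg_L2: "v \<in> H1v \<Omega> \<Longrightarrow> divg \<Omega> v \<in> L2 \<Omega>"
  unfolding divg_def[abs_def] trace_def by (intro L2_sum L2_nth jac_L2)

lemma symgrad_L2:
  assumes "v \<in> H1v \<Omega>"
  shows "symgrad \<Omega> v \<in> L2 \<Omega>"
proof -
  have "(\<lambda>x. transpose (jac \<Omega> v x)) \<in> L2 \<Omega>"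
    by (intro L2_vec) (simp add: transpose_def, intro L2_nth jac_L2 assms)
  then show ?thesis
    unfolding symgrad_def[abs_def] by (intro L2_linear jac_L2 assms)
qed

text \<open>This makes differences of discrete functions admissible as test functions.\<close>

lemma finite_dim_space_lincomb:
  fixes S :: "(real^'d \<Rightarrow> 'b::real_vector) set"
  assumes "finite_dim_space S" "u \<in> S" "v \<in> S"
  shows "(\<lambda>x. a *\<^sub>R u x + b *\<^sub>R v x) \<in> S"
proof -
  obtain B where B: "finite B" "S = {(\<lambda>x. \<Sum>b\<in>B. c b *\<^sub>R b x) | c. True}"
    using assms(1) by (auto simp: finite_dim_space_def)
  then obtain c d where "u = (\<lambda>x. \<Sum>b\<in>B. c b *\<^sub>R b x)" "v = (\<lambda>x. \<Sum>b\<in>B. d b *\<^sub>R b x)"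
    using assms by blast
  then have "(\<lambda>x. a *\<^sub>R u x + b *\<^sub>R v x) = (\<lambda>x. \<Sum>f\<in>B. (a * c f + b * d f) *\<^sub>R f x)"
    by (simp add: scaleR_sum_right scaleR_add_left sum.distrib)
  then have "\<exists>e. (\<lambda>x. a *\<^sub>R u x + b *\<^sub>R v x) = (\<lambda>x. \<Sum>f\<in>B. e f *\<^sub>R f x)"
    by (rule exI[of _ "\<lambda>f. a * c f + b * d f"])
  then show ?thesis by (simp add: B(2))
qed

text \<open>The bilinear form whose diagonal is \<open>cns_sq\<close>. The phase history is
  projected orthogonally with respect to this form.\<close>

definition cns_form :: "('d::finite) fe_setting \<Rightarrow> 'd model \<Rightarrow> (real^'d \<Rightarrow> real) \<Rightarrow> (real^'d \<Rightarrow> real) \<Rightarrow> real" where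
  "cns_form D M u v = (Cn M)\<^sup>2 * ip (region D) (grad (region D) u) (grad (region D) v) + stab M * ip (region D) u v"

lemma cns_form_commute: "cns_form D M u v = cns_form D M v u"
  by (simp add: cns_form_def ip_commute)

lemma cns_sq_form: "cns_sq D M u = cns_form D M u u"
  by (simp add: cns_sq_def cns_form_def nrm_sq)

lemma cns_form_linear:
  assumes \<Omega>: "open (region D)" "bounded (region D)"
    and u: "u \<in> H1 (region D)" and v: "v \<in> H1 (region D)" and w: "w \<in> H1 (region D)"
  shows "cns_form D M (\<lambda>x. c * u x + e * v x) w = c * cns_form D M u w + e * cns_form D M v w"
proof -
  let ?\<Omega> = "region D"
  note g = grad_H1(1)[OF u] grad_H1(1)[OF v] grad_H1(1)[OF w]
  have "ip ?\<Omega> (grad ?\<Omega> (\<lambda>x. c * u x + e * v x)) (grad ?\<Omega> w)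
      = ip ?\<Omega> (\<lambda>x. c *\<^sub>R grad ?\<Omega> u x + e *\<^sub>R grad ?\<Omega> v x) (grad ?\<Omega> w)"
    using g grad_H1(1)[OF H1_linear[OF \<Omega> u v]] grad_linear[OF \<Omega> u v]
    by (intro ip_cong_AE L2_linear) (auto simp: aeq_def)
  also have "\<dots> = c * ip ?\<Omega> (grad ?\<Omega> u) (grad ?\<Omega> w) + e * ip ?\<Omega> (grad ?\<Omega> v) (grad ?\<Omega> w)"
    using g by (simp add: ip_linear L2_linear)
  finally have 1: "ip ?\<Omega> (grad ?\<Omega> (\<lambda>x. c * u x + e * v x)) (grad ?\<Omega> w) = \<dots>" .
  have "ip ?\<Omega> (\<lambda>x. c *\<^sub>R u x + e *\<^sub>R v x) w = c * ip ?\<Omega> u w + e * ip ?\<Omega> v w"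
    using H1_L2[OF u] H1_L2[OF v] H1_L2[OF w] by (simp only: ip_linear L2_linear)
  with 1 show ?thesis by (simp add: cns_form_def algebra_simps)
qed

section \<open>The ALE transfer is an isometry\<close>

lemma negligible_lipschitz_image:
  fixes f :: "'a::euclidean_space \<Rightarrow> 'a"
  assumes "L-lipschitz_on S f" "negligible N" "N \<subseteq> S"
  shows "negligible (f ` N)"
proof (rule negligible_locally_Lipschitz_image)
  fix x assume "x \<in> N"
  then show "\<exists>T B. open T \<and> x \<in> T \<and> (\<forall>y\<in>N \<inter> T. norm (f y - f x) \<le> B * norm (y - x))"
    using lipschitz_onD[OF assms(1)] assms(3)
    by (intro exI[of _ UNIV] exI[of _ L]) (auto simp: dist_norm subset_iff)
qed (use assms in auto)

text \<open>A preimage under \<open>P\<close> is an image under its inverse \<open>Q\<close>.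
  Lipschitz images of Lebesgue sets are Lebesgue sets because null sets go to null sets; continuity
  of \<open>P\<close> alone would settle Borel sets only.\<close>

lemma borel_measurable_lipschitz_substitution:
  fixes P Q :: "real^'d \<Rightarrow> real^'d" and g :: "real^'d \<Rightarrow> 'b::euclidean_space"
  assumes S: "S \<in> sets lebesgue" and T: "T \<in> sets lebesgue" and Q: "L-lipschitz_on T Q"
    and P: "\<And>x. x \<in> S \<Longrightarrow> P x \<in> T \<and> Q (P x) = x" and Q': "\<And>y. y \<in> T \<Longrightarrow> Q y \<in> S \<and> P (Q y) = y"
    and g: "g \<in> borel_measurable (lebesgue_on T)"
  shows "(\<lambda>x. g (P x)) \<in> borel_measurable (lebesgue_on S)"
proof (rule measurableI)
  fix B :: "'b set" assume B: "B \<in> sets borel"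
  have "{y \<in> T. g y \<in> B} = g -` B \<inter> space (lebesgue_on T)" by auto
  also have "\<dots> \<in> sets (lebesgue_on T)" by (rule measurable_sets[OF g B])
  finally have "{y \<in> T. g y \<in> B} \<in> sets lebesgue"
    using T by (auto simp: sets_restrict_space_iff)
  then have "Q ` {y \<in> T. g y \<in> B} \<in> sets lebesgue"
    by (rule sets_lebesgue_continuous_image[OF _ lipschitz_on_continuous_on[OF Q]])
      (auto intro: negligible_lipschitz_image[OF Q])
  moreover have "(\<lambda>x. g (P x)) -` B \<inter> space (lebesgue_on S) = Q ` {y \<in> T. g y \<in> B}"
  proof (intro equalityI subsetI)
    fix x assume "x \<in> (\<lambda>x. g (P x)) -` B \<inter> space (lebesgue_on S)"
    then have "x = Q (P x)" "P x \<in> {y \<in> T. g y \<in> B}" using P by auto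
    then show "x \<in> Q ` {y \<in> T. g y \<in> B}" by (rule image_eqI)
  qed (use Q' in auto)
  ultimately show "(\<lambda>x. g (P x)) -` B \<inter> space (lebesgue_on S) \<in> sets (lebesgue_on S)"
    using S Q' by (auto simp: sets_restrict_space_iff)
qed simp

text \<open>By completeness every subset of the null set \<open>S - U\<close> is measurable,
  whatever \<open>f\<close> does there.\<close>

lemma borel_measurable_spike_lebesgue_on:
  assumes S: "S \<in> sets lebesgue" and U: "U \<subseteq> S" "U \<in> sets lebesgue" "negligible (S - U)"
    and f: "f \<in> borel_measurable (lebesgue_on U)"
  shows "f \<in> borel_measurable (lebesgue_on S)"
proof (rule measurableI)
  fix B :: "'b set" assume B: "B \<in> sets borel"
  have "f -` B \<inter> U \<in> sets lebesgue"
    using measurable_sets[OF f B] U by (simp add: sets_restrict_space_iff)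
  moreover have "negligible (f -` B \<inter> (S - U))"
    by (rule negligible_subset[OF U(3)]) auto
  then have "f -` B \<inter> (S - U) \<in> sets lebesgue" by (rule negligible_imp_sets)
  ultimately have "(f -` B \<inter> U) \<union> (f -` B \<inter> (S - U)) \<in> sets lebesgue" by (rule sets.Un)
  moreover have "(f -` B \<inter> U) \<union> (f -` B \<inter> (S - U)) = f -` B \<inter> S" using U by auto
  ultimately show "f -` B \<inter> space (lebesgue_on S) \<in> sets (lebesgue_on S)"
    using S by (simp add: sets_restrict_space_iff)
qed simp

lemma has_bochner_integral_lebesgue_on_iff:
  fixes f :: "real^'d \<Rightarrow> real"
  assumes S: "S \<in> sets lebesgue"
  shows "has_bochner_integral (lebesgue_on S) f b \<longleftrightarrow> f absolutely_integrable_on S \<and> integral S f = b"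
proof -
  have "integrable (lebesgue_on S) f \<longleftrightarrow> f absolutely_integrable_on S"
    using S by (simp add: integrable_restrict_space set_integrable_def)
  moreover have "integral\<^sup>L (lebesgue_on S) f = integral S f" if "integrable (lebesgue_on S) f"
    using that S by (rule lebesgue_integral_eq_integral)
  ultimately show ?thesis by (auto simp: has_bochner_integral_iff)
qed

section \<open>Reference configuration and pullback of integrals\<close>

lemma polyhedral_domain_props:
  assumes "polyhedral_domain \<Omega>"
  shows "open \<Omega>" "bounded \<Omega>" "\<Omega> \<in> lmeasurable" "\<Omega> \<in> sets lebesgue" "interior (closure \<Omega>) = \<Omega>"
  using assms by (auto simp: polyhedral_domain_def lmeasurable_open)

text \<open>The reference map is known to be differentiable only inside the elements, so the change
  of variables takes place on this set.\<close>

definition ref_interior :: "('d::finite) fe_setting \<Rightarrow> nat \<Rightarrow> (real^'d) set" where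
  "ref_interior D l = (\<Union>K\<in>refmesh D l. interior K)"

text \<open>Simplices are convex, so their frontiers are null, and finitely many of them cover the
  skeleton. An element is only known to lie in the closed domain; its interior lies in the open one
  because that domain is the interior of its closure.\<close>

lemma
  fixes D :: "('d::finite) fe_setting"
  assumes X: "valid_ref_map D \<Lambda> l"
  shows open_ref_interior: "open (ref_interior D l)"
    and ref_interior_subset: "ref_interior D l \<subseteq> refdom D l"
    and negligible_ref_skeleton: "negligible (refdom D l - ref_interior D l)"
proof -
  have t: "triangulates (refmesh D l) (refdom D l)" and p: "polyhedral_domain (refdom D l)"
    using X by (auto simp: valid_ref_map_def)
  then have fin: "finite (refmesh D l)" and simp: "\<And>K. K \<in> refmesh D l \<Longrightarrow> int CARD('d) simplex K"
    and U: "\<Union>(refmesh D l) = closure (refdom D l)"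
    by (auto simp: triangulates_def triangulation_def)
  show "open (ref_interior D l)" by (auto simp: ref_interior_def)
  have "interior K \<subseteq> interior (closure (refdom D l))" if "K \<in> refmesh D l" for K
    using that U by (intro interior_mono) auto
  then show "ref_interior D l \<subseteq> refdom D l"
    using polyhedral_domain_props(5)[OF p] by (auto simp: ref_interior_def)
  have "negligible (\<Union>K\<in>refmesh D l. frontier K)"
    using fin simp by (intro negligible_Union) (auto intro: negligible_convex_frontier convex_simplex)
  moreover have "refdom D l - ref_interior D l \<subseteq> (\<Union>K\<in>refmesh D l. frontier K)"
  proof
    fix x assume x: "x \<in> refdom D l - ref_interior D l"
    then have "x \<in> \<Union>(refmesh D l)" using U closure_subset by auto
    then obtain K where "K \<in> refmesh D l" "x \<in> K" by blast
    with x show "x \<in> (\<Union>K\<in>refmesh D l. frontier K)"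
      using closure_subset by (force simp: frontier_def ref_interior_def)
  qed
  ultimately show "negligible (refdom D l - ref_interior D l)" by (rule negligible_subset)
qed

text \<open>Nothing is known about \<open>Jdet\<close> on the skeleton: its measurability comes from
  continuity inside the elements and from completeness on the remaining null set.\<close>

lemma
  fixes D :: "('d::finite) fe_setting"
  assumes X: "valid_ref_map D \<Lambda> l"
  shows Jdet_pos: "x \<in> ref_interior D l \<Longrightarrow> Jdet D l x > 0"
    and Xmap_derivative: "x \<in> ref_interior D l \<Longrightarrow> (Xmap D l has_derivative (*v) (Fmat D l x)) (at x)"
    and Jdet_measurable: "Jdet D l \<in> borel_measurable (lebesgue_on (refdom D l))"
proof -
  show "x \<in> ref_interior D l \<Longrightarrow> Jdet D l x > 0"
    using X by (auto simp: valid_ref_map_def ref_interior_def)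
  show "x \<in> ref_interior D l \<Longrightarrow> (Xmap D l has_derivative (*v) (Fmat D l x)) (at x)"
    using X by (auto simp: valid_ref_map_def ref_interior_def Fmat_def jacobian_works[symmetric])
  have "continuous_on (ref_interior D l) (Fmat D l)"
    unfolding ref_interior_def using X by (intro continuous_on_open_UN) (auto simp: valid_ref_map_def)
  then have "continuous_on (ref_interior D l) (Jdet D l)"
    unfolding Jdet_def[abs_def] det_def by (intro continuous_intros)
  then have "Jdet D l \<in> borel_measurable (lebesgue_on (ref_interior D l))"
    by (rule continuous_imp_measurable_on_sets_lebesgue) (use open_ref_interior[OF X] in auto)
  moreover have "polyhedral_domain (refdom D l)" using X by (simp add: valid_ref_map_def)
  ultimately show "Jdet D l \<in> borel_measurable (lebesgue_on (refdom D l))"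
    using borel_measurable_spike_lebesgue_on[of "refdom D l" "ref_interior D l" "Jdet D l"]
      open_ref_interior[OF X] ref_interior_subset[OF X] negligible_ref_skeleton[OF X]
    by (auto simp: polyhedral_domain_props)
qed

lemma
  assumes X: "valid_ref_map D \<Lambda> l"
  shows Xmap_region: "x \<in> refdom D l \<Longrightarrow> Xmap D l x \<in> region D"
    and Xinv_Xmap: "x \<in> refdom D l \<Longrightarrow> Xinv D l (Xmap D l x) = x"
    and Xinv_refdom: "y \<in> region D \<Longrightarrow> Xinv D l y \<in> refdom D l"
    and Xmap_Xinv: "y \<in> region D \<Longrightarrow> Xmap D l (Xinv D l y) = y"
proof -
  have b: "inj_on (Xmap D l) (closure (refdom D l))" and im: "Xmap D l ` refdom D l = region D"
    using X by (auto simp: valid_ref_map_def bij_betw_def)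
  then show "x \<in> refdom D l \<Longrightarrow> Xmap D l x \<in> region D" by auto
  have inv: "Xinv D l (Xmap D l x) = x" if "x \<in> refdom D l" for x
    unfolding Xinv_def using that b closure_subset by (auto intro!: inv_into_f_f)
  then show "x \<in> refdom D l \<Longrightarrow> Xinv D l (Xmap D l x) = x" .
  have "Xinv D l y \<in> refdom D l \<and> Xmap D l (Xinv D l y) = y" if y: "y \<in> region D"
  proof -
    obtain x where "x \<in> refdom D l" "y = Xmap D l x" using y im by blast
    then show ?thesis by (simp add: inv)
  qed
  then show "y \<in> region D \<Longrightarrow> Xinv D l y \<in> refdom D l" "y \<in> region D \<Longrightarrow> Xmap D l (Xinv D l y) = y"
    by auto
qed

lemma
  fixes D :: "('d::finite) fe_setting" and g h :: "real^'d \<Rightarrow> 'b::euclidean_space"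
  assumes X: "valid_ref_map D \<Lambda> l" and \<Omega>: "polyhedral_domain (region D)"
  shows borel_measurable_pullback: "g \<in> borel_measurable (lebesgue_on (region D)) \<Longrightarrow>
      (\<lambda>x. g (Xmap D l x)) \<in> borel_measurable (lebesgue_on (refdom D l))"
    and borel_measurable_pushforward: "h \<in> borel_measurable (lebesgue_on (refdom D l)) \<Longrightarrow>
      (\<lambda>y. h (Xinv D l y)) \<in> borel_measurable (lebesgue_on (region D))"
proof -
  have R: "polyhedral_domain (refdom D l)" using X by (simp add: valid_ref_map_def)
  have L: "\<Lambda>-lipschitz_on (refdom D l) (Xmap D l)" "\<Lambda>-lipschitz_on (region D) (Xinv D l)"
    by (rule lipschitz_on_subset[OF _ closure_subset], use X in \<open>simp add: valid_ref_map_def\<close>)+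
  note f = Xmap_region[OF X] Xinv_Xmap[OF X] Xinv_refdom[OF X] Xmap_Xinv[OF X]
    polyhedral_domain_props(4)[OF R] polyhedral_domain_props(4)[OF \<Omega>]
  show "g \<in> borel_measurable (lebesgue_on (region D)) \<Longrightarrow>
      (\<lambda>x. g (Xmap D l x)) \<in> borel_measurable (lebesgue_on (refdom D l))"
    by (rule borel_measurable_lipschitz_substitution[where T = "region D" and Q = "Xinv D l", OF _ _ L(2)])
      (auto simp: f)
  show "h \<in> borel_measurable (lebesgue_on (refdom D l)) \<Longrightarrow>
      (\<lambda>y. h (Xinv D l y)) \<in> borel_measurable (lebesgue_on (region D))"
    by (rule borel_measurable_lipschitz_substitution[where T = "refdom D l" and Q = "Xmap D l", OF _ _ L(1)])
      (auto simp: f)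
qed

text \<open>The formula is applied inside the elements. The Lipschitz image of the null skeleton is
  null, so the image of \<open>ref_interior\<close> exhausts the region up to a null set.\<close>

lemma has_bochner_integral_pullback:
  fixes D :: "('d::finite) fe_setting" and f :: "real^'d \<Rightarrow> real"
  assumes dim: "CARD('d) = 2 \<or> CARD('d) = 3"
    and X: "valid_ref_map D \<Lambda> l" and \<Omega>: "polyhedral_domain (region D)"
  shows "has_bochner_integral (lebesgue_on (ref_interior D l)) (\<lambda>x. Jdet D l x * f (Xmap D l x)) b
     \<longleftrightarrow> has_bochner_integral (lebesgue_on (region D)) f b"
proof -
  let ?U = "ref_interior D l" and ?X = "Xmap D l"
  have U: "?U \<in> sets lebesgue" using open_ref_interior[OF X] by auto
  have inj: "inj_on ?X ?U"
    using ref_interior_subset[OF X] Xinv_Xmap[OF X] by (metis inj_onI subsetD)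
  have "has_bochner_integral (lebesgue_on ?U) (\<lambda>x. Jdet D l x * f (?X x)) b
      \<longleftrightarrow> has_bochner_integral (lebesgue_on ?U) (\<lambda>x. \<bar>det (Fmat D l x)\<bar> * f (?X x)) b"
    using U Jdet_pos[OF X] by (intro has_bochner_integral_cong) (auto simp: Jdet_def[symmetric] abs_of_pos)
  also have "\<dots> \<longleftrightarrow> f absolutely_integrable_on (?X ` ?U) \<and> integral (?X ` ?U) f = b"
    unfolding has_bochner_integral_lebesgue_on_iff[OF U]
    by (rule change_of_variables_dim_2_3[OF dim U Xmap_derivative[OF X] inj])
  also have "\<dots> \<longleftrightarrow> f absolutely_integrable_on region D \<and> integral (region D) f = b"
  proof -
    have "negligible (?X ` (refdom D l - ?U))"
    proof (rule negligible_lipschitz_image)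
      show "\<Lambda>-lipschitz_on (closure (refdom D l)) ?X" using X by (simp add: valid_ref_map_def)
    qed (use negligible_ref_skeleton[OF X] closure_subset in auto)
    moreover have "region D - ?X ` ?U \<subseteq> ?X ` (refdom D l - ?U)"
    proof
      fix y assume y: "y \<in> region D - ?X ` ?U"
      then have "y = ?X (Xinv D l y)" "Xinv D l y \<in> refdom D l - ?U"
        using Xmap_Xinv[OF X] Xinv_refdom[OF X] by (auto, metis imageI)
      then show "y \<in> ?X ` (refdom D l - ?U)" by (rule image_eqI)
    qed
    ultimately have n: "negligible (region D - ?X ` ?U)" by (rule negligible_subset)
    have "?X ` ?U - region D = {}"
      using Xmap_region[OF X] ref_interior_subset[OF X] by auto
    then have n': "negligible (?X ` ?U - region D)" by simp
    have "f absolutely_integrable_on (?X ` ?U) \<longleftrightarrow> f absolutely_integrable_on region D"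
      by (rule absolutely_integrable_spike_set_eq) (use n n' in \<open>auto intro: negligible_subset\<close>)
    moreover have "integral (?X ` ?U) f = integral (region D) f"
      by (rule integral_spike_set) (use n n' in \<open>auto intro: negligible_subset\<close>)
    ultimately show ?thesis by simp
  qed
  finally show ?thesis
    by (simp add: has_bochner_integral_lebesgue_on_iff[OF polyhedral_domain_props(4)[OF \<Omega>]])
qed

text \<open>Pulled back by the new map, the squared norm of the transfer has the same density
  \<open>Jdet D n x * (norm (g (Xmap D n x)))\<^sup>2\<close> on the reference domain as that of
  \<open>g\<close> pulled back by the old map. Arguing with \<open>has_bochner_integral\<close>
  yields integrability and the value together.\<close>

lemma
  fixes D :: "('d::finite) fe_setting" and g :: "real^'d \<Rightarrow> real^'d"
  assumes dim: "CARD('d) = 2 \<or> CARD('d) = 3" and \<Omega>: "polyhedral_domain (region D)"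
    and X: "valid_ref_map D \<Lambda> n" and Y: "valid_ref_map D \<Lambda> (Suc n)"
    and R: "refdom D n = refdom D (Suc n)" "refmesh D n = refmesh D (Suc n)"
    and g: "g \<in> L2 (region D)"
  shows ale_transfer_L2: "ale_transfer D n g \<in> L2 (region D)"
    and nrm_ale_transfer: "nrm (region D) (ale_transfer D n g) = nrm (region D) g"
proof -
  let ?T = "ale_transfer D n g" and ?U = "ref_interior D (Suc n)"
  have U: "ref_interior D n = ?U" using R by (simp add: ref_interior_def)
  let ?h = "\<lambda>x. (1 / sqrt (Jdet D (Suc n) x) * sqrt (Jdet D n x)) *\<^sub>R g (Xmap D n x)"
  have "?h \<in> borel_measurable (lebesgue_on (refdom D (Suc n)))"
    using borel_measurable_pullback[OF X \<Omega> L2_measurable[OF g]] Jdet_measurable[OF X] Jdet_measurable[OF Y]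
    unfolding R by measurable
  then have m: "?T \<in> borel_measurable (lebesgue_on (region D))"
    using borel_measurable_pushforward[OF Y \<Omega>, of ?h] by (simp add: ale_transfer_def[abs_def] Let_def)
  have "has_bochner_integral (lebesgue_on (region D)) (\<lambda>y. (norm (g y))\<^sup>2) (ip (region D) g g)"
    using g by (auto simp: L2_def has_bochner_integral_iff ip_def power2_norm_eq_inner)
  then have "has_bochner_integral (lebesgue_on ?U) (\<lambda>x. Jdet D n x * (norm (g (Xmap D n x)))\<^sup>2) (ip (region D) g g)"
    using has_bochner_integral_pullback[OF dim X \<Omega>, of "\<lambda>y. (norm (g y))\<^sup>2"] U by simp
  also have "?this \<longleftrightarrow> has_bochner_integral (lebesgue_on ?U)
      (\<lambda>x. Jdet D (Suc n) x * (norm (?T (Xmap D (Suc n) x)))\<^sup>2) (ip (region D) g g)"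
  proof (rule has_bochner_integral_cong)
    fix x assume "x \<in> space (lebesgue_on ?U)"
    then have x: "x \<in> ?U" by simp
    then have "Jdet D n x > 0" "Jdet D (Suc n) x > 0" "Xinv D (Suc n) (Xmap D (Suc n) x) = x"
      using Jdet_pos[OF X] Jdet_pos[OF Y] ref_interior_subset[OF Y] Xinv_Xmap[OF Y] U by auto
    then show "Jdet D n x * (norm (g (Xmap D n x)))\<^sup>2 = Jdet D (Suc n) x * (norm (?T (Xmap D (Suc n) x)))\<^sup>2"
      by (simp add: ale_transfer_def Let_def power_mult_distrib power_divide)
  qed auto
  finally have "has_bochner_integral (lebesgue_on (region D)) (\<lambda>y. (norm (?T y))\<^sup>2) (ip (region D) g g)"
    by (simp only: has_bochner_integral_pullback[OF dim Y \<Omega>, of "\<lambda>y. (norm (?T y))\<^sup>2"])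
  then show "?T \<in> L2 (region D)" "nrm (region D) ?T = nrm (region D) g"
    using m by (auto simp: L2_def has_bochner_integral_iff nrm_def ip_def power2_norm_eq_inner)
qed

section \<open>The pressure-correction scheme\<close>

lemma nrm_scaleR: "nrm \<Omega> (\<lambda>x. c *\<^sub>R f x) = \<bar>c\<bar> * nrm \<Omega> f"
  by (simp add: nrm_def ip_scaleR_left ip_scaleR_right real_sqrt_mult mult.assoc[symmetric])

section \<open>Norm preservation by the two history transfers\<close>

lemma ale_transfer_update:
  fixes D :: "('d::finite) fe_setting" and g :: "real^'d \<Rightarrow> real^'d"
  assumes dim: "CARD('d) = 2 \<or> CARD('d) = 3" and \<Omega>: "polyhedral_domain (region D)"
    and u: "valid_update D \<Lambda> k n" "fixed_topo D n" and g: "g \<in> L2 (region D)"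
  shows "ale_transfer D n g \<in> L2 (region D)" "nrm (region D) (ale_transfer D n g) = nrm (region D) g"
proof -
  have "valid_ref_map D \<Lambda> n" "valid_ref_map D \<Lambda> (Suc n)"
    "refdom D n = refdom D (Suc n)" "refmesh D n = refmesh D (Suc n)"
    using u by (auto simp: valid_update_def)
  from ale_transfer_L2[OF dim \<Omega> this g] nrm_ale_transfer[OF dim \<Omega> this g]
  show "ale_transfer D n g \<in> L2 (region D)" "nrm (region D) (ale_transfer D n g) = nrm (region D) g" .
qed

text \<open>After remeshing the factor in front of the projection depends on \<open>g\<close>, so
  the transfer is not linear; the energy argument relies on these two facts alone. A field of norm
  zero is sent to zero, which keeps its norm as well.\<close>

lemma
  fixes D :: "('d::finite) fe_setting" and g :: "real^'d \<Rightarrow> real^'d"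
  assumes dim: "CARD('d) = 2 \<or> CARD('d) = 3" and \<Omega>: "polyhedral_domain (region D)"
    and u: "valid_update D \<Lambda> k n" and l: "valid_level D \<kappa> \<beta> (Suc n)" and g: "g \<in> L2 (region D)"
  shows kin_transfer_L2: "kin_transfer D n g \<in> L2 (region D)"
    and nrm_kin_transfer:
      "(\<not> fixed_topo D n \<Longrightarrow> nrm (region D) g \<noteq> 0 \<Longrightarrow> nrm (region D) (Hproj D (Suc n) g) \<noteq> 0)
       \<Longrightarrow> nrm (region D) (kin_transfer D n g) = nrm (region D) g"
proof -
  have P: "Hproj D (Suc n) g \<in> L2 (region D)"
    using l g by (auto simp: valid_level_def L2_projection_def)
  let ?c = "if nrm (region D) g = 0 then 0 else nrm (region D) g / nrm (region D) (Hproj D (Suc n) g)"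
  have r: "remesh_transfer D n g = (\<lambda>y. ?c *\<^sub>R Hproj D (Suc n) g y)"
    by (simp add: remesh_transfer_def[abs_def] fun_eq_iff)
  show "kin_transfer D n g \<in> L2 (region D)"
    using ale_transfer_update[OF dim \<Omega> u _ g] L2_scaleR[OF P] by (simp add: kin_transfer_def r)
  show "nrm (region D) (kin_transfer D n g) = nrm (region D) g"
    if "\<not> fixed_topo D n \<Longrightarrow> nrm (region D) g \<noteq> 0 \<Longrightarrow> nrm (region D) (Hproj D (Suc n) g) \<noteq> 0"
  proof (cases "fixed_topo D n")
    case True
    then show ?thesis using ale_transfer_update[OF dim \<Omega> u _ g] by (simp add: kin_transfer_def)
  next
    case False
    have "0 \<le> nrm (region D) h" for h :: "real^'d \<Rightarrow> real^'d" by (simp add: nrm_def ip_nonneg)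
    then have "nrm (region D) (remesh_transfer D n g) = nrm (region D) g"
      unfolding r nrm_scaleR using that[OF False] by (auto simp: abs_of_nonneg)
    then show ?thesis using False by (simp add: kin_transfer_def)
  qed
qed

section \<open>Algebra of the pressure splitting\<close>

text \<open>Used with \<open>c = \<gamma>\<^sub>k / \<tau>\<close>, the kinetic variable \<open>z\<close>, its history \<open>zH\<close>, \<open>a = \<rho>\<^sup>1\<^sup>/\<^sup>2 u\<^sub>*\<close>,
  the transported gradient \<open>X\<close>, and the weighted gradients \<open>b\<close>, \<open>T\<close>, \<open>B\<close> of the pressure increment, the
  transported pressure and the pressure in the momentum equation.\<close>

lemma pressure_splitting:
  assumes L2: "z \<in> L2 \<Omega>" "zH \<in> L2 \<Omega>" "b \<in> L2 \<Omega>" "T \<in> L2 \<Omega>" "B \<in> L2 \<Omega>" "X \<in> L2 \<Omega>"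
    and a: "a = (\<lambda>x. z x + (1/c) *\<^sub>R b x)" and c: "c \<noteq> 0"
    and orth: "ip \<Omega> z b = 0" "ip \<Omega> z B = 0"
    and bar: "ip \<Omega> B b = ip \<Omega> (\<lambda>x. X x + c *\<^sub>R zH x) b"
    and tr: "ip \<Omega> T b = ip \<Omega> X b" "ip \<Omega> T T = ip \<Omega> X T"
  shows "c * ip \<Omega> (\<lambda>x. a x - zH x) a + ip \<Omega> B a
    = c * ip \<Omega> (\<lambda>x. z x - zH x) z
      + 1 / (2 * c) * (ip \<Omega> (\<lambda>x. T x + b x) (\<lambda>x. T x + b x) - ip \<Omega> X X
          + ip \<Omega> (\<lambda>x. X x - T x) (\<lambda>x. X x - T x) + ip \<Omega> b b)"
proof -
  have 1: "ip \<Omega> B b = ip \<Omega> X b + c * ip \<Omega> zH b"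
    using bar L2 by (simp only: ip_linear L2_linear)
  have "ip \<Omega> (\<lambda>x. a x - zH x) a = ip \<Omega> z z + 1 / c * ip \<Omega> b z + 1 / c * (ip \<Omega> z b + 1 / c * ip \<Omega> b b)
      - (ip \<Omega> zH z + 1 / c * ip \<Omega> zH b)"
    unfolding a using L2 by (simp only: ip_linear L2_linear) (simp add: algebra_simps)
  then have 2: "ip \<Omega> (\<lambda>x. a x - zH x) a = ip \<Omega> z z + 1 / c * (1 / c * ip \<Omega> b b)
      - (ip \<Omega> zH z + 1 / c * ip \<Omega> zH b)"
    using orth(1) ip_commute[of \<Omega> b z] by simp
  \<comment> \<open>As \<open>z\<close> is orthogonal to \<open>B\<close>, only the increment part
    of \<open>a\<close> pairs with \<open>B\<close>. The equation for \<open>B\<close> then produces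
    the pairing of \<open>zH\<close> with \<open>b\<close>, which cancels the one left over from the
    history term in 2.\<close>
  have 3: "ip \<Omega> B a = 1 / c * (ip \<Omega> X b + c * ip \<Omega> zH b)"
    unfolding a using L2 orth(2) ip_commute[of \<Omega> B z] 1 by (simp only: ip_linear L2_linear)
  have 4: "ip \<Omega> (\<lambda>x. z x - zH x) z = ip \<Omega> z z - ip \<Omega> zH z"
    using L2 by (simp only: ip_linear L2_linear)
  have 5: "ip \<Omega> (\<lambda>x. T x + b x) (\<lambda>x. T x + b x) = ip \<Omega> X T + 2 * ip \<Omega> X b + ip \<Omega> b b"
    using L2 tr ip_commute[of \<Omega> b T] by (simp only: ip_linear L2_linear)
  have 6: "ip \<Omega> (\<lambda>x. X x - T x) (\<lambda>x. X x - T x) = ip \<Omega> X X - ip \<Omega> X T"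
    using L2 tr ip_commute[of \<Omega> T X] by (simp only: ip_linear L2_linear)
  \<comment> \<open>Both sides now differ from their common kinetic part by
    \<open>(ip \<Omega> X b + ip \<Omega> b b) / c\<close>: the terms \<open>ip \<Omega> X T\<close>
    and \<open>ip \<Omega> X X\<close> drop out between 5, 6 and the old pressure energy.\<close>
  show ?thesis unfolding 2 3 4 5 6 using c by (simp add: field_simps)
qed

text \<open>The assumptions reach back to level 0 because the histories contain earlier velocities
  and pressures, whose membership in the discrete spaces is derived from the initial state or from
  the step that produced them.\<close>

locale pc_scheme =
  fixes D :: "('d::finite) fe_setting" and M :: "'d model" and Z :: "'d state"
    and \<kappa> \<beta> \<Lambda> rho_lo rho_up eta_lo eta_up :: real and K n :: nat
  assumes dim: "CARD('d) = 2 \<or> CARD('d) = 3"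
    and domain: "valid_domain D"
    and levels: "\<And>l. l \<le> Suc n \<Longrightarrow> valid_level D \<kappa> \<beta> l"
    and updates: "\<And>m. m \<le> n \<Longrightarrow> valid_update D \<Lambda> (step_order K m) m"
    and model: "valid_model M (region D)"
    and order: "K \<in> {1, 2}"
    and density: "0 < rho_lo"
      "\<And>l. l \<le> Suc n \<Longrightarrow> AE x in lebesgue_on (region D). rho_lo \<le> rhoh M Z l x \<and> rhoh M Z l x \<le> rho_up"
    and viscosity: "0 < eta_lo"
      "\<And>l. l \<le> Suc n \<Longrightarrow> AE x in lebesgue_on (region D). eta_lo \<le> etah M Z l x \<and> etah M Z l x \<le> eta_up"
    and dgrads: "\<And>l. l \<le> Suc n \<Longrightarrow> discrete_gradient D M Z l"
    and init: "initial_state D M Z"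
    and steps: "\<And>m. m \<le> n \<Longrightarrow> pc_step (step_order K m) D M Z m"
begin

section \<open>Membership of the computed quantities in the discrete spaces\<close>

abbreviation \<Omega> where "\<Omega> \<equiv> region D"

lemma poly: "polyhedral_domain \<Omega>"
  using domain by (simp add: valid_domain_def)

lemmas region_props = polyhedral_domain_props[OF poly]

lemma phi_in_S: "l \<le> Suc n \<Longrightarrow> phi Z l \<in> Ssp D l"
  using init steps[of "l - 1"]
  by (cases l) (auto simp: initial_state_def pc_step_def phase_step_def Let_def)

lemma S_H1: "l \<le> Suc n \<Longrightarrow> u \<in> Ssp D l \<Longrightarrow> u \<in> H1 \<Omega>"
  using levels[of l] by (auto simp: valid_level_def)

lemmas phi_H1 = S_H1[OF _ phi_in_S]

lemma V_H1v: "l \<le> Suc n \<Longrightarrow> v \<in> Vsp D l \<Longrightarrow> v \<in> H1v \<Omega>"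
  using levels[of l] by (auto simp: valid_level_def)

lemmas V_L2 = H1v_L2[OF V_H1v]

lemma P0_L2: "l \<le> Suc n \<Longrightarrow> p \<in> Psp0 D l \<Longrightarrow> p \<in> L2 \<Omega>"
  using levels[of l] by (auto simp: valid_level_def zero_mean_def)

lemma P0_add:
  assumes l: "l \<le> Suc n" and p: "p \<in> Psp0 D l" and p': "p' \<in> Psp0 D l"
  shows "(\<lambda>x. p x + p' x) \<in> Psp0 D l"
proof -
  have "(\<lambda>x. 1 *\<^sub>R p x + 1 *\<^sub>R p' x) \<in> Psp D l"
    using levels[OF l] p p' by (intro finite_dim_space_lincomb) (auto simp: valid_level_def zero_mean_def)
  moreover have "integrable (lebesgue_on \<Omega>) p" "integrable (lebesgue_on \<Omega>) p'"
    using P0_L2[OF l p] P0_L2[OF l p'] integrable_L2 region_props(3) by blast+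
  ultimately show ?thesis using p p' by (simp add: zero_mean_def)
qed

lemma rhoh_measurable: "l \<le> Suc n \<Longrightarrow> rhoh M Z l \<in> borel_measurable (lebesgue_on \<Omega>)"
  using L2_measurable[OF H1_L2[OF phi_H1[of l]]] by (simp add: rhoh_def[abs_def] rho_def)

lemma etah_measurable: "l \<le> Suc n \<Longrightarrow> etah M Z l \<in> borel_measurable (lebesgue_on \<Omega>)"
  using L2_measurable[OF H1_L2[OF phi_H1[of l]]] by (simp add: etah_def[abs_def] eta_def)

lemma sqrt_rho_L2:
  assumes l: "l \<le> Suc n" and f: "f \<in> L2 \<Omega>"
  shows "(\<lambda>x. sqrt (rhoh M Z l x) *\<^sub>R f x) \<in> L2 \<Omega>"
proof (rule L2_bounded_scaleR[OF _ _ f])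
  show "(\<lambda>x. sqrt (rhoh M Z l x)) \<in> borel_measurable (lebesgue_on \<Omega>)"
    using rhoh_measurable[OF l] by simp
  show "AE x in lebesgue_on \<Omega>. \<bar>sqrt (rhoh M Z l x)\<bar> \<le> sqrt rho_up"
    using density(2)[OF l] by eventually_elim (use density(1) in auto)
qed

lemma rgrad_eq: "rgrad M Z l p = (\<lambda>x. sqrt (rhoh M Z l x) *\<^sub>R dgrad Z l p x)"
  by (simp add: rgrad_def fun_eq_iff)

lemma ip_rho:
  assumes l: "l \<le> Suc n" and f: "f \<in> L2 \<Omega>" and g: "g \<in> L2 \<Omega>"
  shows "ip \<Omega> (\<lambda>x. rhoh M Z l x *\<^sub>R f x) g
    = ip \<Omega> (\<lambda>x. sqrt (rhoh M Z l x) *\<^sub>R f x) (\<lambda>x. sqrt (rhoh M Z l x) *\<^sub>R g x)"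
  unfolding ip_def
proof (rule integral_cong_AE)
  show "AE x in lebesgue_on \<Omega>. (rhoh M Z l x *\<^sub>R f x) \<bullet> g x
      = (sqrt (rhoh M Z l x) *\<^sub>R f x) \<bullet> (sqrt (rhoh M Z l x) *\<^sub>R g x)"
    using density(2)[OF l] by eventually_elim (use density(1) in \<open>simp add: mult.assoc[symmetric]\<close>)
qed (use L2_measurable[OF f] L2_measurable[OF g] rhoh_measurable[OF l] in measurable)

lemma dgrad_V: "l \<le> Suc n \<Longrightarrow> p \<in> Psp0 D l \<Longrightarrow> dgrad Z l p \<in> Vsp D l"
  using dgrads[of l] by (auto simp: discrete_gradient_def)

lemma rgrad_L2: "l \<le> Suc n \<Longrightarrow> p \<in> Psp0 D l \<Longrightarrow> rgrad M Z l p \<in> L2 \<Omega>"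
  unfolding rgrad_eq by (intro sqrt_rho_L2 V_L2[of l] dgrad_V)

lemma ip_rgrad:
  assumes l: "l \<le> Suc n" and p: "p \<in> Psp0 D l" and v: "v \<in> Vsp D l"
  shows "ip \<Omega> (rgrad M Z l p) (\<lambda>x. sqrt (rhoh M Z l x) *\<^sub>R v x) = - ip \<Omega> p (divg \<Omega> v)"
  using dgrads[OF l] p v ip_rho[OF l V_L2[OF l dgrad_V[OF l p]] V_L2[OF l v]]
  by (simp add: discrete_gradient_def rgrad_eq)

text \<open>\<open>dgrad\<close> is known only through its defining identity. The defect of
  additivity lies in the velocity space, so it may be tested with itself; linearity of the
  right-hand side makes its weighted norm zero.\<close>

lemma rgrad_add:
  assumes l: "l \<le> Suc n" and p: "p \<in> Psp0 D l" and p': "p' \<in> Psp0 D l"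
  shows "aeq \<Omega> (rgrad M Z l (\<lambda>x. p x + p' x)) (\<lambda>x. rgrad M Z l p x + rgrad M Z l p' x)"
proof -
  let ?s = "\<lambda>x. p x + p' x"
  note s = P0_add[OF l p p']
  define w where "w = (\<lambda>x. dgrad Z l ?s x - dgrad Z l p x - dgrad Z l p' x)"
  have fd: "finite_dim_space (Vsp D l)" using levels[OF l] by (simp add: valid_level_def)
  note V = dgrad_V[OF l s] dgrad_V[OF l p] dgrad_V[OF l p']
  have "(\<lambda>x. 1 *\<^sub>R (1 *\<^sub>R dgrad Z l ?s x + (-1) *\<^sub>R dgrad Z l p x) + (-1) *\<^sub>R dgrad Z l p' x) \<in> Vsp D l"
    by (rule finite_dim_space_lincomb[OF fd finite_dim_space_lincomb[OF fd V(1,2)] V(3)])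
  then have w: "w \<in> Vsp D l" by (simp add: w_def)
  let ?w = "\<lambda>x. sqrt (rhoh M Z l x) *\<^sub>R w x"
  have W: "?w \<in> L2 \<Omega>" by (rule sqrt_rho_L2[OF l V_L2[OF l w]])
  have eq: "?w = (\<lambda>x. rgrad M Z l ?s x - rgrad M Z l p x - rgrad M Z l p' x)"
    by (simp add: w_def rgrad_eq scaleR_diff_right)
  note L = rgrad_L2[OF l s] rgrad_L2[OF l p] rgrad_L2[OF l p']
  have "ip \<Omega> ?s (divg \<Omega> w) = ip \<Omega> p (divg \<Omega> w) + ip \<Omega> p' (divg \<Omega> w)"
    by (intro ip_add_left P0_L2[OF l] p p' divg_L2 V_H1v[OF l w])
  then have "ip \<Omega> (rgrad M Z l ?s) ?w - ip \<Omega> (rgrad M Z l p) ?w - ip \<Omega> (rgrad M Z l p') ?w = 0"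
    by (simp add: ip_rgrad[OF l] s p p' w)
  then have "ip \<Omega> (\<lambda>x. rgrad M Z l ?s x - rgrad M Z l p x - rgrad M Z l p' x) ?w = 0"
    using L W by (simp only: ip_linear L2_linear)
  then have "aeq \<Omega> ?w (\<lambda>x. 0)" using ip_self_eq_0[OF W] eq by metis
  then show ?thesis unfolding eq aeq_def by eventually_elim (simp add: algebra_simps)
qed

lemma pr_P0:
  assumes l: "l \<le> Suc n" shows "pr Z l \<in> Psp0 D l"
proof (cases l)
  case 0
  then show ?thesis using init by (simp add: initial_state_def)
next
  case (Suc m)
  then have "pc_step (step_order K m) D M Z m" using l steps by simp
  then have "pr Z l = (\<lambda>x. prtr Z l x + dpr Z l x)" "prtr Z l \<in> Psp0 D l" "dpr Z l \<in> Psp0 D l"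
    using Suc by (auto simp: pc_step_def projection_step_def pressure_transport_def Let_def)
  then show ?thesis using P0_add[OF l] by simp
qed

lemma ustar_V: "m \<le> n \<Longrightarrow> ustar Z (Suc m) \<in> Vsp D (Suc m)"
  using steps[of m] by (simp add: pc_step_def momentum_step_def Let_def ustar_def)

lemma vel_V:
  assumes l: "l \<le> Suc n" shows "vel Z l \<in> Vsp D l"
proof (cases l)
  case 0
  then show ?thesis using init by (simp add: initial_state_def)
next
  case (Suc m)
  let ?c = "tau M / gam (step_order K m)"
  have "pc_step (step_order K m) D M Z m" using l steps Suc by simp
  then have v: "vel Z l = (\<lambda>x. 1 *\<^sub>R ustar Z l x + (- ?c) *\<^sub>R dgrad Z l (dpr Z l) x)"
    and "dpr Z l \<in> Psp0 D l"
    using Suc by (auto simp: pc_step_def projection_step_def Let_def)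
  then show ?thesis
    unfolding v using levels[OF l] ustar_V[of m] Suc l
    by (intro finite_dim_space_lincomb dgrad_V) (auto simp: valid_level_def)
qed

lemma zeta_L2: "l \<le> Suc n \<Longrightarrow> zeta M Z l \<in> L2 \<Omega>"
  unfolding zeta_def[abs_def] by (intro sqrt_rho_L2 V_L2[of l] vel_V)

lemma transfer_L2: "m \<le> n \<Longrightarrow> g \<in> L2 \<Omega> \<Longrightarrow> kin_transfer D m g \<in> L2 \<Omega>"
  using updates[of m] levels[of "Suc m"] by (intro kin_transfer_L2[OF dim poly]) auto

lemma kin_L2: "l \<le> Suc n \<Longrightarrow> kin D M Z j l \<in> L2 \<Omega>"
  unfolding kin_def by (cases l) (auto intro!: L2_linear zeta_L2 transfer_L2)

abbreviation k where "k \<equiv> step_order K n"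

lemma k_cases: "k = 1 \<or> k = 2 \<and> n \<ge> 1"
  using order by (auto simp: step_order_def)

lemma model_pos: "Cn M > 0" "Pe M > 0" "Rey M > 0" "We M > 0" "alphaq M > 0" "tau M > 0"
  using model by (auto simp: valid_model_def)

lemma gam_pos: "gam j > 0"
  by (simp add: gam_def)

lemma step_n: "pc_step k D M Z n"
  by (simp add: steps)

section \<open>Energy balance of the phase field and its auxiliary variable\<close>

lemma form_lin:
  assumes "u \<in> H1 \<Omega>" "v \<in> H1 \<Omega>" "w \<in> H1 \<Omega>"
  shows "cns_form D M (\<lambda>x. c * u x + e * v x) w = c * cns_form D M u w + e * cns_form D M v w"
    and "cns_form D M w (\<lambda>x. c * u x + e * v x) = c * cns_form D M w u + e * cns_form D M w v"
  using cns_form_linear[OF region_props(1,2) assms] cns_form_commute by metis+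

lemmas H1_lin = H1_linear[OF region_props(1,2)]

lemma cns_sq_lin2:
  assumes "u \<in> H1 \<Omega>" "v \<in> H1 \<Omega>"
  shows "cns_sq D M (\<lambda>x. c * u x + e * v x)
    = c\<^sup>2 * cns_form D M u u + 2 * c * e * cns_form D M u v + e\<^sup>2 * cns_form D M v v"
  using assms cns_form_commute[of D M v u]
  by (simp add: cns_sq_form form_lin H1_lin) (simp add: power2_eq_square algebra_simps)

lemma phase_test:
  defines "\<phi> \<equiv> phi Z (Suc n)" and "hist \<equiv> \<lambda>x. histH k (\<lambda>l. phi Z l x) n"
  assumes hist: "hist \<in> H1 \<Omega>"
  shows "tau M * (ip \<Omega> (\<lambda>x. phiE k Z n x *\<^sub>R uc Z (Suc n) x) (grad \<Omega> (mu Z (Suc n)))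
           - 1 / Pe M * ip \<Omega> (\<lambda>x. mE k M Z n x *\<^sub>R grad \<Omega> (mu Z (Suc n)) x) (grad \<Omega> (mu Z (Suc n))))
    = gam k * (cns_form D M \<phi> \<phi> - cns_form D M hist \<phi>)
      + 2 * gam k * rsav Z (Suc n) * (rsav Z (Suc n) - histH k (rsav Z) n)"
proof -
  let ?\<mu> = "mu Z (Suc n)" and ?U = "UE k D M Z n" and ?dG = "\<lambda>x. deriv (Gpot M) (phiE k Z n x)"
  let ?d\<phi> = "\<lambda>x. (gam k / tau M) * (\<phi> x - phiH Z (Suc n) x)" and ?r = "rsav Z (Suc n)"
  have p: "phase_step k D M Z n" and h: "phase_history k D M Z n"
    using step_n by (auto simp: pc_step_def)
  have \<phi>: "\<phi> \<in> Ssp D (Suc n)" and \<mu>: "?\<mu> \<in> Ssp D (Suc n)" and U: "?U > 0"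
    and 1: "ip \<Omega> ?d\<phi> ?\<mu> - ip \<Omega> (\<lambda>x. phiE k Z n x *\<^sub>R uc Z (Suc n) x) (grad \<Omega> ?\<mu>)
        + 1 / Pe M * ip \<Omega> (\<lambda>x. mE k M Z n x *\<^sub>R grad \<Omega> ?\<mu> x) (grad \<Omega> ?\<mu>) = 0"
    and 2: "\<And>\<theta>. \<theta> \<in> Ssp D (Suc n) \<Longrightarrow> ip \<Omega> ?\<mu> \<theta> = cns_form D M \<phi> \<theta> + ?r / ?U * ip \<Omega> ?dG \<theta>"
    and 3: "Dtau (tau M) k (rsav Z) n = 1 / (2 * ?U) * ip \<Omega> ?dG ?d\<phi>"
    using p by (auto simp: phase_step_def Let_def \<phi>_def cns_form_def)
  \<comment> \<open>Testing the projection with the new phase field replaces the projected history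
    by the unprojected one, so the energy difference involves accepted phase fields only.\<close>
  have pH: "phiH Z (Suc n) \<in> Ssp D (Suc n)"
    and 4: "cns_form D M (phiH Z (Suc n)) \<phi> = cns_form D M hist \<phi>"
    using h \<phi> by (auto simp: phase_history_def Let_def hist_def cns_form_def)
  have d: "?d\<phi> = (\<lambda>x. (gam k / tau M) * \<phi> x + (- (gam k / tau M)) * phiH Z (Suc n) x)"
    by (simp add: fun_eq_iff algebra_simps)
  have fd: "finite_dim_space (Ssp D (Suc n))" using levels[of "Suc n"] by (simp add: valid_level_def)
  have dS: "?d\<phi> \<in> Ssp D (Suc n)"
    using finite_dim_space_lincomb[OF fd \<phi> pH, of "gam k / tau M" "- (gam k / tau M)"] d by simp
  have "cns_form D M \<phi> ?d\<phi> = gam k / tau M * (cns_form D M \<phi> \<phi> - cns_form D M hist \<phi>)"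
    unfolding d using S_H1[OF le_refl \<phi>] S_H1[OF le_refl pH] 4 cns_form_commute[of D M \<phi> "phiH Z (Suc n)"]
    by (simp only: form_lin) (simp add: algebra_simps)
  \<comment> \<open>The equation for \<open>r\<close> was designed for this: it converts the pairing
    of the nonlinear potential with the discrete time derivative into a scalar difference.\<close>
  moreover have "?r / ?U * ip \<Omega> ?dG ?d\<phi> = 2 * ?r * Dtau (tau M) k (rsav Z) n"
    unfolding 3 by simp
  ultimately have "ip \<Omega> ?d\<phi> ?\<mu> = gam k / tau M * (cns_form D M \<phi> \<phi> - cns_form D M hist \<phi>)
      + 2 * ?r * (gam k / tau M * (?r - histH k (rsav Z) n))"
    unfolding ip_commute[of \<Omega> ?d\<phi> ?\<mu>] 2[OF dS] by (simp only: Dtau_def real_scaleR_def)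
  then have "tau M * ip \<Omega> ?d\<phi> ?\<mu> = gam k * (cns_form D M \<phi> \<phi> - cns_form D M hist \<phi>)
      + 2 * gam k * ?r * (?r - histH k (rsav Z) n)"
    using model_pos(6) by (simp add: distrib_left)
  moreover have "ip \<Omega> ?d\<phi> ?\<mu> = ip \<Omega> (\<lambda>x. phiE k Z n x *\<^sub>R uc Z (Suc n) x) (grad \<Omega> ?\<mu>)
      - 1 / Pe M * ip \<Omega> (\<lambda>x. mE k M Z n x *\<^sub>R grad \<Omega> ?\<mu> x) (grad \<Omega> ?\<mu>)"
    using 1 by linarith
  ultimately show ?thesis by (simp only:)
qed

text \<open>The bracket that \<open>N_h\<close> multiplies by the new \<open>q\<close>, isolated
  because the phase balance is scaled by \<open>q\<close> only when the balances are
  combined.\<close>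

definition phase_dissipation :: real where
  "phase_dissipation = (if k = 1 then
      1 / (2 * We M * Cn M) * cns_sq D M (\<lambda>x. phi Z (Suc n) x - phi Z n x)
        + 1 / (We M * Cn M) * (rsav Z (Suc n) - rsav Z n)\<^sup>2
    else 1 / (4 * We M * Cn M) * cns_sq D M (\<lambda>x. phi Z (Suc n) x - 2 * phi Z n x + phi Z (n - 1) x)
        + 1 / (2 * We M * Cn M) * (rsav Z (Suc n) - 2 * rsav Z n + rsav Z (n - 1))\<^sup>2)"

text \<open>For order two the identity is 2a(3a - 4b + c) = a^2 + (2a - b)^2 - b^2 - (2b - c)^2 + (a
  - 2b + c)^2, used for \<open>cns_form\<close> and for \<open>r\<close>. The squares of
  \<open>r\<close> carry twice the weight because of the factor 2 in \<open>phase_test\<close>; the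
  constant \<open>CA\<close> cancels in the difference.\<close>

lemma phase_energy:
  "tau M / (We M * Cn M) * (ip \<Omega> (\<lambda>x. phiE k Z n x *\<^sub>R uc Z (Suc n) x) (grad \<Omega> (mu Z (Suc n)))
      - 1 / Pe M * ip \<Omega> (\<lambda>x. mE k M Z n x *\<^sub>R grad \<Omega> (mu Z (Suc n)) x) (grad \<Omega> (mu Z (Suc n))))
    = E_phase k D M Z (Suc n) - E_phase k D M Z n + phase_dissipation"
  (is "tau M / ?W * ?G = _")
proof -
  let ?p = "phi Z (Suc n)" and ?pn = "phi Z n" and ?pm = "phi Z (n - 1)"
  have H: "?p \<in> H1 \<Omega>" "?pn \<in> H1 \<Omega>" "?pm \<in> H1 \<Omega>" by (simp_all add: phi_H1)
  note comm = cns_form_commute[of D M ?pn ?p] cns_form_commute[of D M ?pm ?p] cns_form_commute[of D M ?pm ?pn]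
  have W: "We M > 0" "Cn M > 0" using model_pos by auto
  show ?thesis
    using k_cases
  proof (elim disjE conjE)
    assume k: "k = 1"
    have h: "(\<lambda>x. histH k (\<lambda>l. phi Z l x) n) = ?pn" by (simp add: histH_def k)
    have G: "tau M * ?G = cns_form D M ?p ?p - cns_form D M ?pn ?p
        + 2 * rsav Z (Suc n) * (rsav Z (Suc n) - rsav Z n)"
      using phase_test[unfolded h, OF H(2)] by (simp add: k gam_def histH_def)
    have sq: "cns_sq D M (\<lambda>x. ?p x - ?pn x) = cns_form D M ?p ?p - 2 * cns_form D M ?pn ?p + cns_form D M ?pn ?pn"
      using cns_sq_lin2[OF H(1,2), of 1 "-1"] comm by simp
    have "tau M / ?W * ?G = (tau M * ?G) / ?W" by simp
    also have "\<dots> = E_phase k D M Z (Suc n) - E_phase k D M Z n + phase_dissipation"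
      unfolding G E_phase_def phase_dissipation_def using k W
      by (simp add: sq) (simp add: cns_sq_form field_simps power2_eq_square)
    finally show ?thesis .
  next
    assume k: "k = 2"
    have h: "(\<lambda>x. histH k (\<lambda>l. phi Z l x) n) = (\<lambda>x. (4/3) * ?pn x + (-1/3) * ?pm x)"
      by (simp add: histH_def k fun_eq_iff algebra_simps)
    have "(\<lambda>x. histH k (\<lambda>l. phi Z l x) n) \<in> H1 \<Omega>" unfolding h using H by (intro H1_lin)
    note t = phase_test[OF this, unfolded h form_lin(1)[OF H(2,3,1)]]
    have G: "tau M * ?G = 3/2 * cns_form D M ?p ?p - 2 * cns_form D M ?pn ?p + 1/2 * cns_form D M ?pm ?p
        + 3 * rsav Z (Suc n) * (rsav Z (Suc n) - (4 * rsav Z n - rsav Z (n - 1)) / 3)"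
      unfolding t by (simp add: k gam_def histH_def field_simps)
    have sq1: "cns_sq D M (\<lambda>x. 2 * ?p x - ?pn x) = 4 * cns_form D M ?p ?p - 4 * cns_form D M ?pn ?p + cns_form D M ?pn ?pn"
      using cns_sq_lin2[OF H(1,2), of 2 "-1"] comm by simp
    have sq2: "cns_sq D M (\<lambda>x. 2 * ?pn x - ?pm x) = 4 * cns_form D M ?pn ?pn - 4 * cns_form D M ?pm ?pn + cns_form D M ?pm ?pm"
      using cns_sq_lin2[OF H(2,3), of 2 "-1"] comm by simp
    have sq3: "cns_sq D M (\<lambda>x. ?p x - 2 * ?pn x + ?pm x) = cns_form D M ?p ?p + 4 * cns_form D M ?pn ?pn
        + cns_form D M ?pm ?pm - 4 * cns_form D M ?pn ?p + 2 * cns_form D M ?pm ?p - 4 * cns_form D M ?pm ?pn"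
    proof -
      have e: "(\<lambda>x. ?p x - 2 * ?pn x + ?pm x) = (\<lambda>x. 1 * (1 * ?p x + (-2) * ?pn x) + 1 * ?pm x)" by simp
      show ?thesis
        unfolding e cns_sq_lin2[OF H1_lin[OF H(1,2)] H(3)] using H comm
        by (simp only: form_lin H1_lin) (simp add: algebra_simps)
    qed
    define w where "w = 1 / ?W"
    have w: "1 / (4 * We M * Cn M) = w / 4" "1 / (2 * We M * Cn M) = w / 2" by (simp_all add: w_def)
    have k1: "k \<noteq> 1" using k by simp
    have "tau M / ?W * ?G = w * (tau M * ?G)" by (simp add: w_def)
    also have "\<dots> = E_phase k D M Z (Suc n) - E_phase k D M Z n + phase_dissipation"
      unfolding G E_phase_def phase_dissipation_def
      by (simp only: k1 if_False diff_Suc_1 sq1 sq2 sq3 w) (simp add: cns_sq_form field_simps power2_eq_square)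
    finally show ?thesis .
  qed
qed

section \<open>Transferred histories and the kinetic balance\<close>

lemma xi_L2: "xi D M Z n \<in> L2 \<Omega>"
  and nrm_xi: "nrm \<Omega> (xi D M Z n) = nrm \<Omega> (rgrad M Z n (pr Z n))"
proof -
  have r: "rgrad M Z n (pr Z n) \<in> L2 \<Omega>" by (rule rgrad_L2) (simp_all add: pr_P0)
  \<comment> \<open>On a topology change \<open>xi\<close> is the old weighted gradient itself, so
    the isometry is called on for fixed topology only.\<close>
  show "xi D M Z n \<in> L2 \<Omega>" "nrm \<Omega> (xi D M Z n) = nrm \<Omega> (rgrad M Z n (pr Z n))"
    using ale_transfer_update[OF dim poly updates[OF le_refl] _ r] r by (auto simp: xi_def)
qed

lemma kinH_L2: "kinH D M Z j n \<in> L2 \<Omega>"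
  unfolding kinH_def by (intro transfer_L2 kin_L2) auto

text \<open>The range of \<open>j\<close> is that of the histories which a step of this order uses,
  and for which nondegeneracy of the projection is assumed.\<close>

lemma nrm_kinH:
  assumes "j < k" shows "nrm \<Omega> (kinH D M Z j n) = nrm \<Omega> (kin D M Z j n)"
  unfolding kinH_def
proof (rule nrm_kin_transfer[OF dim poly updates[OF le_refl] levels[OF le_refl] kin_L2])
  have "history_nondegenerate k D M Z n" using step_n by (simp add: pc_step_def)
  then show "\<not> fixed_topo D n \<Longrightarrow> nrm \<Omega> (kin D M Z j n) \<noteq> 0 \<Longrightarrow> nrm \<Omega> (Hproj D (Suc n) (kin D M Z j n)) \<noteq> 0"
    using assms by (auto simp: history_nondegenerate_def)
qed simp

lemma zetaH_L2: "zetaH k D M Z n \<in> L2 \<Omega>"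
proof (cases "k = 1")
  case True
  then have "zetaH k D M Z n = kinH D M Z 0 n" by (simp add: zetaH_def[abs_def])
  then show ?thesis by (simp add: kinH_L2)
next
  case False
  then have "zetaH k D M Z n = (\<lambda>x. (1/3) *\<^sub>R (2 *\<^sub>R kinH D M Z 0 n x + kinH D M Z 1 n x))"
    by (simp add: zetaH_def[abs_def])
  then show ?thesis by (simp only: L2_linear kinH_L2)
qed

definition kin_energy :: "nat \<Rightarrow> real" where
  "kin_energy l = (if k = 1 then 1/2 * (nrm \<Omega> (kin D M Z 0 l))\<^sup>2
     else 1/4 * ((nrm \<Omega> (kin D M Z 0 l))\<^sup>2 + (nrm \<Omega> (kin D M Z 1 l))\<^sup>2))"

definition kin_dissipation :: real where
  "kin_dissipation = (if k = 1 then 1/2 * (nrm \<Omega> (\<lambda>x. zeta M Z (Suc n) x - kinH D M Z 0 n x))\<^sup>2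
     else 1/4 * (nrm \<Omega> (\<lambda>x. zeta M Z (Suc n) x - kinH D M Z 1 n x))\<^sup>2)"

text \<open>For order two the weights 2/3 and 1/3 in \<open>zetaH\<close> give 6 z.z - 4 z.g0 - 2
  z.g1 = |z|^2 + |2z - g0|^2 - |g0|^2 - |g1|^2 + |z - g1|^2 with transferred g0 and g1. The product
  of g0 with g1 does not occur, so preservation of the two norms is enough to return to the old
  energy.\<close>

lemma kinetic_identity:
  "gam k * ip \<Omega> (\<lambda>x. zeta M Z (Suc n) x - zetaH k D M Z n x) (zeta M Z (Suc n))
    = kin_energy (Suc n) - kin_energy n + kin_dissipation"
proof -
  let ?z = "zeta M Z (Suc n)" and ?g0 = "kinH D M Z 0 n" and ?g1 = "kinH D M Z 1 n"
  have L: "?z \<in> L2 \<Omega>" "?g0 \<in> L2 \<Omega>" "?g1 \<in> L2 \<Omega>" by (simp_all add: zeta_L2 kinH_L2)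
  note comm = ip_commute[of \<Omega> ?g0 ?z] ip_commute[of \<Omega> ?g1 ?z]
  have k0: "kin D M Z 0 (Suc n) = ?z" by (simp add: kin_def)
  show ?thesis
    using k_cases
  proof (elim disjE conjE)
    assume k: "k = 1"
    have "zetaH k D M Z n = ?g0" by (simp add: zetaH_def[abs_def] k)
    moreover have "ip \<Omega> ?g0 ?g0 = ip \<Omega> (kin D M Z 0 n) (kin D M Z 0 n)"
      using nrm_kinH[of 0] k by (metis nrm_sq zero_less_one)
    moreover have "ip \<Omega> (\<lambda>x. ?z x - ?g0 x) (\<lambda>x. ?z x - ?g0 x) = ip \<Omega> ?z ?z - 2 * ip \<Omega> ?z ?g0 + ip \<Omega> ?g0 ?g0"
      using comm by (simp only: ip_linear L2_linear L)
    moreover have "ip \<Omega> (\<lambda>x. ?z x - ?g0 x) ?z = ip \<Omega> ?z ?z - ip \<Omega> ?z ?g0"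
      using comm by (simp only: ip_linear L2_linear L)
    ultimately show ?thesis
      by (simp add: kin_energy_def kin_dissipation_def k gam_def nrm_sq k0 algebra_simps)
  next
    assume k: "k = 2"
    have zH: "zetaH k D M Z n = (\<lambda>x. (1/3) *\<^sub>R (2 *\<^sub>R ?g0 x + ?g1 x))"
      by (simp add: zetaH_def[abs_def] k)
    \<comment> \<open>The new second history is built from the same transferred field
      \<open>?g0\<close> that enters \<open>zetaH\<close>.\<close>
    have k1: "kin D M Z 1 (Suc n) = (\<lambda>x. 2 *\<^sub>R ?z x - ?g0 x)"
      by (simp add: kin_def kinH_def fun_eq_iff)
    have "ip \<Omega> ?g0 ?g0 = ip \<Omega> (kin D M Z 0 n) (kin D M Z 0 n)" "ip \<Omega> ?g1 ?g1 = ip \<Omega> (kin D M Z 1 n) (kin D M Z 1 n)"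
      using nrm_kinH[of 0] nrm_kinH[of 1] k by (simp_all flip: nrm_sq)
    moreover have "ip \<Omega> (\<lambda>x. ?z x - ?g1 x) (\<lambda>x. ?z x - ?g1 x) = ip \<Omega> ?z ?z - 2 * ip \<Omega> ?z ?g1 + ip \<Omega> ?g1 ?g1"
      using comm by (simp only: ip_linear L2_linear L)
    moreover have "ip \<Omega> (\<lambda>x. 2 *\<^sub>R ?z x - ?g0 x) (\<lambda>x. 2 *\<^sub>R ?z x - ?g0 x)
        = 4 * ip \<Omega> ?z ?z - 4 * ip \<Omega> ?z ?g0 + ip \<Omega> ?g0 ?g0"
      using comm by (simp only: ip_linear L2_linear L) (simp add: algebra_simps)
    moreover have "ip \<Omega> (\<lambda>x. ?z x - (1/3) *\<^sub>R (2 *\<^sub>R ?g0 x + ?g1 x)) ?z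
        = ip \<Omega> ?z ?z - 1/3 * (2 * ip \<Omega> ?z ?g0 + ip \<Omega> ?z ?g1)"
      using comm by (simp only: ip_linear L2_linear L)
    moreover have "k \<noteq> 1" "gam k = 3/2" using k by (simp_all add: gam_def)
    ultimately show ?thesis
      unfolding kin_energy_def kin_dissipation_def k0 k1 zH nrm_sq
      by (simp only: if_False) (simp add: algebra_simps)
  qed
qed

section \<open>Momentum balance with the pressure correction\<close>

lemma momentum_pressure:
  defines "c \<equiv> gam k / tau M"
  shows "c * ip \<Omega> (\<lambda>x. sqrt (rhoh M Z (Suc n) x) *\<^sub>R ustar Z (Suc n) x - zetaH k D M Z n x)
            (\<lambda>x. sqrt (rhoh M Z (Suc n) x) *\<^sub>R ustar Z (Suc n) x)
      - ip \<Omega> (prbar Z (Suc n)) (divg \<Omega> (ustar Z (Suc n)))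
    = c * ip \<Omega> (\<lambda>x. zeta M Z (Suc n) x - zetaH k D M Z n x) (zeta M Z (Suc n))
      + 1 / (2 * c) * ((nrm \<Omega> (rgrad M Z (Suc n) (pr Z (Suc n))))\<^sup>2 - (nrm \<Omega> (rgrad M Z n (pr Z n)))\<^sup>2
          + (nrm \<Omega> (\<lambda>x. xi D M Z n x - rgrad M Z (Suc n) (prtr Z (Suc n)) x))\<^sup>2
          + (nrm \<Omega> (rgrad M Z (Suc n) (dpr Z (Suc n))))\<^sup>2)"
proof -
  let ?N = "Suc n"
  let ?r = "rgrad M Z ?N" and ?P0 = "Psp0 D ?N" and ?u = "ustar Z ?N" and ?z = "zeta M Z ?N"
  let ?T = "?r (prtr Z ?N)" and ?B = "?r (prbar Z ?N)" and ?b = "?r (dpr Z ?N)"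
  let ?a = "\<lambda>x. sqrt (rhoh M Z ?N x) *\<^sub>R ?u x" and ?zH = "zetaH k D M Z n" and ?X = "xi D M Z n"
  have c: "c \<noteq> 0" using gam_pos[of k] model_pos(6) by (simp add: c_def)
  have c': "tau M / gam k = 1 / c" by (simp add: c_def)
  have pt: "pressure_transport k D M Z n" and ps: "projection_step k D M Z n"
    using step_n by (auto simp: pc_step_def)
  have P: "prtr Z ?N \<in> ?P0" "prbar Z ?N \<in> ?P0" "dpr Z ?N \<in> ?P0"
    using pt ps by (auto simp: pressure_transport_def projection_step_def Let_def)
  have u: "?u \<in> Vsp D ?N" by (rule ustar_V) simp
  have iprho: "ip \<Omega> (\<lambda>x. rhoh M Z ?N x *\<^sub>R dgrad Z ?N p x) (dgrad Z ?N \<alpha>) = ip \<Omega> (?r p) (?r \<alpha>)"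
    if "p \<in> ?P0" "\<alpha> \<in> ?P0" for p \<alpha>
    using ip_rho[OF le_refl V_L2[OF le_refl dgrad_V[OF le_refl that(1)]] V_L2[OF le_refl dgrad_V[OF le_refl that(2)]]]
    by (simp add: rgrad_eq)
  have tr: "ip \<Omega> ?T (?r \<alpha>) = ip \<Omega> ?X (?r \<alpha>)"
    and bar: "ip \<Omega> ?B (?r \<alpha>) = ip \<Omega> (\<lambda>x. ?X x + c *\<^sub>R ?zH x) (?r \<alpha>)" if "\<alpha> \<in> ?P0" for \<alpha>
    using pt that P by (auto simp: pressure_transport_def Let_def iprho rgrad_eq[symmetric] c_def)
  have proj: "ip \<Omega> ?b (?r \<alpha>) = - c * ip \<Omega> (divg \<Omega> ?u) \<alpha>" if "\<alpha> \<in> ?P0" for \<alpha>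
    using ps that P by (auto simp: projection_step_def Let_def iprho c_def)
  have L: "?r p \<in> L2 \<Omega>" if "p \<in> ?P0" for p by (rule rgrad_L2[OF le_refl that])
  have aL: "?a \<in> L2 \<Omega>" by (rule sqrt_rho_L2[OF le_refl V_L2[OF le_refl u]])
  have vel: "vel Z ?N = (\<lambda>x. ?u x - (1 / c) *\<^sub>R dgrad Z ?N (dpr Z ?N) x)"
    and pr: "pr Z ?N = (\<lambda>x. prtr Z ?N x + dpr Z ?N x)"
    using ps by (auto simp: projection_step_def Let_def c')
  have z: "?z = (\<lambda>x. ?a x - (1 / c) *\<^sub>R ?b x)"
    by (simp add: zeta_def[abs_def] vel rgrad_eq algebra_simps)
  \<comment> \<open>The equation for the increment says that \<open>(1 / c) *\<^sub>R ?b x\<close>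
    is the orthogonal projection of \<open>?a\<close> onto the weighted discrete gradients;
    \<open>?z\<close> is the remainder.\<close>
  have orth: "ip \<Omega> ?z (?r \<alpha>) = 0" if \<alpha>: "\<alpha> \<in> ?P0" for \<alpha>
  proof -
    have "ip \<Omega> ?z (?r \<alpha>) = ip \<Omega> ?a (?r \<alpha>) - 1 / c * ip \<Omega> ?b (?r \<alpha>)"
      unfolding z using L[OF \<alpha>] L[OF P(3)] aL by (simp only: ip_linear L2_linear)
    also have "ip \<Omega> ?a (?r \<alpha>) = - ip \<Omega> \<alpha> (divg \<Omega> ?u)"
      using ip_rgrad[OF le_refl \<alpha> u] by (simp add: ip_commute)
    finally show ?thesis using proj[OF \<alpha>] c by (simp add: ip_commute)
  qed
  have a: "?a = (\<lambda>x. ?z x + (1 / c) *\<^sub>R ?b x)" by (simp add: z)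
  \<comment> \<open>The pressures add pointwise, their weighted gradients only almost
    everywhere.\<close>
  have "aeq \<Omega> (?r (pr Z ?N)) (\<lambda>x. ?T x + ?b x)"
    unfolding pr by (rule rgrad_add[OF le_refl P(1,3)])
  then have nT: "ip \<Omega> (?r (pr Z ?N)) (?r (pr Z ?N)) = ip \<Omega> (\<lambda>x. ?T x + ?b x) (\<lambda>x. ?T x + ?b x)"
    using L P pr_P0[of ?N] by (intro ip_cong_AE L2_add) auto
  have "ip \<Omega> ?X ?X = ip \<Omega> (rgrad M Z n (pr Z n)) (rgrad M Z n (pr Z n))"
    by (simp flip: nrm_sq add: nrm_xi)
  then show ?thesis
    using pressure_splitting[OF zeta_L2[OF le_refl] zetaH_L2 L[OF P(3)] L[OF P(1)] L[OF P(2)] xi_L2 a c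
        orth[OF P(3)] orth[OF P(2)] bar[OF P(3)] tr[OF P(3)] tr[OF P(1)]]
      ip_rgrad[OF le_refl P(2) u] nT
    by (simp add: nrm_sq)
qed

lemma momentum_test:
  "gam k / tau M * ip \<Omega> (\<lambda>x. sqrt (rhoh M Z (Suc n) x) *\<^sub>R ustar Z (Suc n) x - zetaH k D M Z n x)
            (\<lambda>x. sqrt (rhoh M Z (Suc n) x) *\<^sub>R ustar Z (Suc n) x)
      - ip \<Omega> (prbar Z (Suc n)) (divg \<Omega> (ustar Z (Suc n)))
    + 2 / Rey M * (nrm \<Omega> (\<lambda>x. sqrt (etah M Z (Suc n) x) *\<^sub>R symgrad \<Omega> (ustar Z (Suc n)) x))\<^sup>2
    = ip \<Omega> (force M (Suc n)) (ustar Z (Suc n))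
      - qsav Z (Suc n) / (We M * Cn M)
        * ip \<Omega> (\<lambda>x. phi Z (Suc n) x *\<^sub>R grad \<Omega> (mu Z (Suc n)) x) (ustar Z (Suc n))"
proof -
  let ?u = "ustar Z (Suc n)"
  have u: "?u \<in> Vsp D (Suc n)" by (rule ustar_V) simp
  have S: "symgrad \<Omega> ?u \<in> L2 \<Omega>" by (rule symgrad_L2[OF V_H1v[OF le_refl u]])
  have visc: "ip \<Omega> (\<lambda>x. etah M Z (Suc n) x *\<^sub>R symgrad \<Omega> ?u x) (symgrad \<Omega> ?u)
      = ip \<Omega> (\<lambda>x. sqrt (etah M Z (Suc n) x) *\<^sub>R symgrad \<Omega> ?u x) (\<lambda>x. sqrt (etah M Z (Suc n) x) *\<^sub>R symgrad \<Omega> ?u x)"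
    unfolding ip_def
  proof (rule integral_cong_AE)
    show "AE x in lebesgue_on \<Omega>. (etah M Z (Suc n) x *\<^sub>R symgrad \<Omega> ?u x) \<bullet> symgrad \<Omega> ?u x
      = (sqrt (etah M Z (Suc n) x) *\<^sub>R symgrad \<Omega> ?u x) \<bullet> (sqrt (etah M Z (Suc n) x) *\<^sub>R symgrad \<Omega> ?u x)"
      using viscosity(2)[OF le_refl] by eventually_elim (use viscosity(1) in \<open>simp add: mult.assoc[symmetric]\<close>)
  qed (use L2_measurable[OF S] etah_measurable[OF le_refl] in measurable)
  have "momentum_step k D M Z n" using step_n by (simp add: pc_step_def)
  \<comment> \<open>The momentum equation holds for every scalar argument. At the new
    \<open>q\<close> its capillary coefficient agrees with the one in the equation for
    \<open>q\<close>.\<close>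
  then have "gam k / tau M * ip \<Omega> (\<lambda>x. sqrt (rhoh M Z (Suc n) x) *\<^sub>R ?u x - zetaH k D M Z n x)
                                 (\<lambda>x. sqrt (rhoh M Z (Suc n) x) *\<^sub>R ?u x)
      + convection k D M Z n ?u ?u
      + 2 / Rey M * ip \<Omega> (\<lambda>x. etah M Z (Suc n) x *\<^sub>R symgrad \<Omega> ?u x) (symgrad \<Omega> ?u)
      = ip \<Omega> (prbar Z (Suc n)) (divg \<Omega> ?u) + ip \<Omega> (force M (Suc n)) ?u
        - qsav Z (Suc n) / (We M * Cn M) * ip \<Omega> (\<lambda>x. phi Z (Suc n) x *\<^sub>R grad \<Omega> (mu Z (Suc n)) x) ?u"
    using u unfolding momentum_step_def Let_def ustar_def by blast
  moreover have "convection k D M Z n ?u ?u = 0" by (simp add: convection_def)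
  ultimately show ?thesis unfolding nrm_sq visc[symmetric] by linarith
qed

section \<open>The scalar variable and the combination of the balances\<close>

definition q_energy :: "nat \<Rightarrow> real" where
  "q_energy l = (if k = 1 then 1 / (2 * alphaq M) * (qsav Z l)\<^sup>2
     else 1 / (4 * alphaq M) * ((qsav Z l)\<^sup>2 + (2 * qsav Z l - qsav Z (l - 1))\<^sup>2))"

definition q_dissipation :: real where
  "q_dissipation = (if k = 1 then 1 / (2 * alphaq M) * (qsav Z (Suc n) - qsav Z n)\<^sup>2
     else 1 / (4 * alphaq M) * (qsav Z (Suc n) - 2 * qsav Z n + qsav Z (n - 1))\<^sup>2)"

lemma q_identity:
  "gam k * qsav Z (Suc n) / alphaq M * (qsav Z (Suc n) - histH k (qsav Z) n)
    = q_energy (Suc n) - q_energy n + q_dissipation"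
  using k_cases model_pos(5)
  by (auto simp: q_energy_def q_dissipation_def gam_def histH_def field_simps power2_eq_square)

lemma E_pc_eq:
  "E_pc k D M Z l = kin_energy l + qsav Z l * E_phase k D M Z l + q_energy l
     + (tau M)\<^sup>2 / (2 * gam k) * (nrm \<Omega> (rgrad M Z l (pr Z l)))\<^sup>2"
  using k_cases by (auto simp: E_pc_def E_h_def kin_energy_def q_energy_def)

lemma N_h_eq: "N_h k D M Z n = kin_dissipation + qsav Z (Suc n) * phase_dissipation + q_dissipation"
  using k_cases by (auto simp: N_h_def kin_dissipation_def phase_dissipation_def q_dissipation_def Let_def)

lemma q_balance:
  defines "q \<equiv> qsav Z (Suc n)"
  shows "q_energy (Suc n) - q_energy n + q_dissipation + (q - qsav Z n) * E_phase k D M Z n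
    + q * tau M / (We M * Cn M) * ip \<Omega> (\<lambda>x. phiE k Z n x *\<^sub>R uc Z (Suc n) x) (grad \<Omega> (mu Z (Suc n)))
    = q * tau M / (We M * Cn M)
        * ip \<Omega> (\<lambda>x. phi Z (Suc n) x *\<^sub>R grad \<Omega> (mu Z (Suc n)) x) (ustar Z (Suc n))"
proof -
  let ?A = "ip \<Omega> (\<lambda>x. phiE k Z n x *\<^sub>R uc Z (Suc n) x) (grad \<Omega> (mu Z (Suc n)))"
  let ?C = "ip \<Omega> (\<lambda>x. phi Z (Suc n) x *\<^sub>R grad \<Omega> (mu Z (Suc n)) x) (ustar Z (Suc n))"
  have "q_step k D M Z n" using step_n by (simp add: pc_step_def)
  then have "tau M * (gam k * q / (alphaq M * tau M) * (q - histH k (qsav Z) n)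
      + (q - qsav Z n) / tau M * E_phase k D M Z n + q / (We M * Cn M) * ?A - q / (We M * Cn M) * ?C) = 0"
    by (simp add: q_step_def Let_def q_def ustar_def)
  moreover have "tau M * (gam k * q / (alphaq M * tau M) * x + y / tau M * e + q / (We M * Cn M) * a - q / (We M * Cn M) * b)
      = gam k * q / alphaq M * x + y * e + q * tau M / (We M * Cn M) * a - q * tau M / (We M * Cn M) * b" for x y e a b
    using model_pos(6) by (simp add: distrib_left right_diff_distrib mult_ac)
  ultimately have "gam k * q / alphaq M * (q - histH k (qsav Z) n) + (q - qsav Z n) * E_phase k D M Z n
      + q * tau M / (We M * Cn M) * ?A - q * tau M / (We M * Cn M) * ?C = 0"
    by (simp only:)
  then show ?thesis using q_identity by (simp add: q_def)
qed

text \<open>The equation for \<open>q\<close> contributes the increment of \<open>q\<close> times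
  the old phase energy, and the phase balance scaled by the new \<open>q\<close> contributes the new
  \<open>q\<close> times the energy increment. By the discrete product rule their sum is the
  increment of \<open>qsav * E_phase\<close>.\<close>

lemma energy_identity:
  "E_pc k D M Z (Suc n) - E_pc k D M Z n + N_h k D M Z n + N_p k D M Z n
    + 2 * tau M / Rey M
      * (nrm \<Omega> (\<lambda>x. sqrt (etah M Z (Suc n) x) *\<^sub>R symgrad \<Omega> (ustar Z (Suc n)) x))\<^sup>2
    + tau M * qsav Z (Suc n) / (Pe M * We M * Cn M)
      * ip \<Omega> (\<lambda>x. mE k M Z n x *\<^sub>R grad \<Omega> (mu Z (Suc n)) x) (grad \<Omega> (mu Z (Suc n)))
   = tau M * ip \<Omega> (force M (Suc n)) (ustar Z (Suc n))"
proof -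
  define q where "q = qsav Z (Suc n)"
  define c where "c = gam k / tau M"
  define w where "w = q * tau M / (We M * Cn M)"
  define A where "A = ip \<Omega> (\<lambda>x. phiE k Z n x *\<^sub>R uc Z (Suc n) x) (grad \<Omega> (mu Z (Suc n)))"
  define Y where "Y = ip \<Omega> (\<lambda>x. mE k M Z n x *\<^sub>R grad \<Omega> (mu Z (Suc n)) x) (grad \<Omega> (mu Z (Suc n)))"
  define C where "C = ip \<Omega> (\<lambda>x. phi Z (Suc n) x *\<^sub>R grad \<Omega> (mu Z (Suc n)) x) (ustar Z (Suc n))"
  define V where "V = (nrm \<Omega> (\<lambda>x. sqrt (etah M Z (Suc n) x) *\<^sub>R symgrad \<Omega> (ustar Z (Suc n)) x))\<^sup>2"
  define F where "F = ip \<Omega> (force M (Suc n)) (ustar Z (Suc n))"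
  define R where "R = (nrm \<Omega> (rgrad M Z (Suc n) (pr Z (Suc n))))\<^sup>2 - (nrm \<Omega> (rgrad M Z n (pr Z n)))\<^sup>2
          + (nrm \<Omega> (\<lambda>x. xi D M Z n x - rgrad M Z (Suc n) (prtr Z (Suc n)) x))\<^sup>2
          + (nrm \<Omega> (rgrad M Z (Suc n) (dpr Z (Suc n))))\<^sup>2"
  let ?zz = "ip \<Omega> (\<lambda>x. zeta M Z (Suc n) x - zetaH k D M Z n x) (zeta M Z (Suc n))"
  let ?E' = "E_phase k D M Z (Suc n)" and ?E = "E_phase k D M Z n"
  have t: "tau M > 0" "gam k > 0" using model_pos gam_pos by auto
  have "c * ?zz + 1 / (2 * c) * R + 2 / Rey M * V = F - q / (We M * Cn M) * C"
    using momentum_test unfolding momentum_pressure c_def R_def V_def F_def q_def C_def .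
  then have "tau M * (c * ?zz + 1 / (2 * c) * R + 2 / Rey M * V) = tau M * (F - q / (We M * Cn M) * C)"
    by simp
  moreover have "tau M * (c * ?zz) = gam k * ?zz" using t by (simp add: c_def)
  \<comment> \<open>This is the origin of the weight of the pressure energy: one factor
    \<open>tau M\<close> comes from scaling the momentum balance, the other from
    \<open>1 / c\<close>.\<close>
  moreover have "tau M * (1 / (2 * c) * R) = (tau M)\<^sup>2 / (2 * gam k) * R"
    by (simp add: c_def power2_eq_square)
  moreover have "tau M * (F - q / (We M * Cn M) * C) = tau M * F - w * C"
    by (simp add: w_def algebra_simps)
  ultimately have 1: "kin_energy (Suc n) - kin_energy n + kin_dissipation + (tau M)\<^sup>2 / (2 * gam k) * R
      + 2 * tau M / Rey M * V = tau M * F - w * C"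
    unfolding kinetic_identity by (simp add: algebra_simps)
  have 2: "q_energy (Suc n) - q_energy n + q_dissipation + (q - qsav Z n) * ?E + w * A = w * C"
    using q_balance by (simp add: q_def w_def A_def C_def)
  have "q * (tau M / (We M * Cn M) * (A - 1 / Pe M * Y)) = q * (?E' - ?E + phase_dissipation)"
    using phase_energy by (simp only: A_def Y_def)
  moreover have "q * (tau M / (We M * Cn M) * (A - 1 / Pe M * Y)) = w * A - tau M * q / (Pe M * We M * Cn M) * Y"
    by (simp add: w_def right_diff_distrib diff_divide_distrib mult_ac)
  ultimately have 3: "w * A = q * ?E' - q * ?E + q * phase_dissipation + tau M * q / (Pe M * We M * Cn M) * Y"
    by (simp add: algebra_simps)
  have 4: "(tau M)\<^sup>2 / (2 * gam k) * R = (tau M)\<^sup>2 / (2 * gam k) * (nrm \<Omega> (rgrad M Z (Suc n) (pr Z (Suc n))))\<^sup>2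
      - (tau M)\<^sup>2 / (2 * gam k) * (nrm \<Omega> (rgrad M Z n (pr Z n)))\<^sup>2 + N_p k D M Z n"
    by (simp add: R_def N_p_def algebra_simps)
  have 5: "(q - qsav Z n) * ?E = q * ?E - qsav Z n * ?E" by (simp add: algebra_simps)
  \<comment> \<open>The capillary product \<open>w * C\<close> cancels between 1 and 2, the
    transport product \<open>w * A\<close> between 2 and 3, and 5 exposes the product rule; the rest
    is linear in the named quantities and their products.\<close>
  show ?thesis
    unfolding E_pc_eq N_h_eq A_def[symmetric] Y_def[symmetric] V_def[symmetric] F_def[symmetric] q_def[symmetric]
    using 1 2 3 4 5 by linarith
qed

end

theorem theorem4p5:
  fixes D :: "('d::finite) fe_setting" and M :: "'d model" and Z :: "'d state"
    and \<kappa> \<beta> \<Lambda> rho_lo rho_up eta_lo eta_up :: real and K k n :: nat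
  assumes dim: "CARD('d) = 2 \<or> CARD('d) = 3"
    and domain: "valid_domain D"
    and constants: "\<kappa> > 0" "\<beta> > 0" "\<Lambda> > 0"
    and levels: "\<And>l. l \<le> Suc n \<Longrightarrow> valid_level D \<kappa> \<beta> l"
    and updates: "\<And>m. m \<le> n \<Longrightarrow> valid_update D \<Lambda> (step_order K m) m"
    and model: "valid_model M (region D)"
    and order: "K \<in> {1, 2}" "k = step_order K n"
    and density: "0 < rho_lo"
      "\<And>l. l \<le> Suc n \<Longrightarrow> AE x in lebesgue_on (region D). rho_lo \<le> rhoh M Z l x \<and> rhoh M Z l x \<le> rho_up"
    and viscosity: "0 < eta_lo"
      "\<And>l. l \<le> Suc n \<Longrightarrow> AE x in lebesgue_on (region D). eta_lo \<le> etah M Z l x \<and> etah M Z l x \<le> eta_up"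
    and dgrads: "\<And>l. l \<le> Suc n \<Longrightarrow> discrete_gradient D M Z l"
    and init: "initial_state D M Z"
    and steps: "\<And>m. m \<le> n \<Longrightarrow> pc_step (step_order K m) D M Z m"
    and q_pos: "qsav Z (Suc n) > 0"
  shows "E_pc k D M Z (Suc n) - E_pc k D M Z n + N_h k D M Z n + N_p k D M Z n
         + 2 * tau M / Rey M
           * (nrm (region D) (\<lambda>x. sqrt (etah M Z (Suc n) x) *\<^sub>R symgrad (region D) (ustar Z (Suc n)) x))\<^sup>2
         + tau M * qsav Z (Suc n) / (Pe M * We M * Cn M)
           * ip (region D) (\<lambda>x. mE k M Z n x *\<^sub>R grad (region D) (mu Z (Suc n)) x)
                        (grad (region D) (mu Z (Suc n)))
         = tau M * ip (region D) (force M (Suc n)) (ustar Z (Suc n))"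
proof -
  note k_eq = order(2)
  interpret pc_scheme D M Z \<kappa> \<beta> \<Lambda> rho_lo rho_up eta_lo eta_up K n
    by unfold_locales (fact dim domain levels updates model order(1) density viscosity dgrads init steps)+
  show ?thesis unfolding k_eq by (rule energy_identity)
qed

end
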